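(* Let $q\in L_{1,loc}(\mathbb{R}_+)$ be a complex-valued function, $\mathbb{R}_+=[0,+\infty)$, and suppose $q$ is sectorial: there exist $x_0\ge 0$, $q_0\in\mathbb{C}$ and $-\pi<\alpha\le\beta<\pi$ with $\beta-\alpha<\pi$ such that for all $x>x_0$ the values $q(x)-q_0$ lie in the sector $\alpha\le\arg(q(x)-q_0)\le\beta$. Let $l(y)=-y''+qy$, $$\mathscr{D}=\{y\in L_2(\mathbb{R}_+):\ y,y'\in AC_{loc}(\mathbb{R}_+),\ l(y)\in L_2(\mathbb{R}_+)\},$$ and for fixed $A,B\in\mathbb{C}$ with $|A|+|B|>0$ let $L_U$ be the operator in $L_2(\mathbb{R}_+)$ with domain $\mathscr{D}_U=\{y\in\mathscr{D}:\ Ay(0)+By'(0)=0\}$ acting by $L_Uy=l(y)$. Then $L_U$ has compact resolvent if and only if $q$ satisfies the Molchanov condition: for every infinite system of pairwise disjoint intervals $D_n\subset\mathbb{R}_+$ of equal length, $\int_{D_n}|q(x)|\,dx\to+\infty$ as $n\to\infty$.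
   Context: $AC_{loc}(\mathbb{R}_+)$ denotes functions absolutely continuous on every compact subinterval of $[0,+\infty)$. An operator has compact resolvent if its resolvent set is nonempty and its resolvent is a compact operator. *)

theory Defs
  imports "HOL-Analysis.Analysis"
begin

text \<open>Functions on R+ = [0,+inf) are represented as total functions real => complex;
  only their values on {0..} matter.  Elements of L2(R+) are handled modulo a.e. equality.\<close>

definition ae_eq_Rp :: "(real \<Rightarrow> complex) \<Rightarrow> (real \<Rightarrow> complex) \<Rightarrow> bool" where
  "ae_eq_Rp f g \<longleftrightarrow> (AE x in lborel. x \<ge> 0 \<longrightarrow> f x = g x)"

definition L2_Rp :: "(real \<Rightarrow> complex) \<Rightarrow> bool" where
  "L2_Rp f \<longleftrightarrow> set_borel_measurable lborel {0..} f \<and>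
     set_integrable lborel {0..} (\<lambda>x. (cmod (f x))\<^sup>2)"

definition L2_norm_Rp :: "(real \<Rightarrow> complex) \<Rightarrow> real" where
  "L2_norm_Rp f = sqrt (LBINT x:{0..}. (cmod (f x))\<^sup>2)"

definition L1_loc_Rp :: "(real \<Rightarrow> complex) \<Rightarrow> bool" where
  "L1_loc_Rp q \<longleftrightarrow> (\<forall>b\<ge>0. set_integrable lborel {0..b} q)"

definition AC_on :: "real \<Rightarrow> real \<Rightarrow> (real \<Rightarrow> complex) \<Rightarrow> bool" where
  "AC_on a b f \<longleftrightarrow> (\<forall>\<epsilon>>0. \<exists>\<delta>>0. \<forall>(n::nat) (u::nat \<Rightarrow> real) v.
      (\<forall>i<n. a \<le> u i \<and> u i \<le> v i \<and> v i \<le> b) \<and>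
      (\<forall>i<n. \<forall>j<n. i \<noteq> j \<longrightarrow> v i \<le> u j \<or> v j \<le> u i) \<and>
      (\<Sum>i<n. v i - u i) < \<delta> \<longrightarrow> (\<Sum>i<n. cmod (f (v i) - f (u i))) < \<epsilon>)"

definition AC_loc_Rp :: "(real \<Rightarrow> complex) \<Rightarrow> bool" where
  "AC_loc_Rp f \<longleftrightarrow> (\<forall>b\<ge>0. AC_on 0 b f)"

definition sectorial :: "(real \<Rightarrow> complex) \<Rightarrow> bool" where
  "sectorial q \<longleftrightarrow> (\<exists>x0 q0 \<alpha> \<beta>. x0 \<ge> 0 \<and> -pi < \<alpha> \<and> \<alpha> \<le> \<beta> \<and> \<beta> < pi \<and> \<beta> - \<alpha> < pi \<and>
     (\<forall>x>x0. q x = q0 \<or> (\<alpha> \<le> Arg (q x - q0) \<and> Arg (q x - q0) \<le> \<beta>)))"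

definition LU_graph :: "(real \<Rightarrow> complex) \<Rightarrow> complex \<Rightarrow> complex \<Rightarrow>
    ((real \<Rightarrow> complex) \<times> (real \<Rightarrow> complex)) set" where
  "LU_graph q A B = {(y, f). L2_Rp y \<and> L2_Rp f \<and>
     (\<exists>y1 y2. AC_loc_Rp y \<and> AC_loc_Rp y1 \<and>
        (AE x in lborel. x > 0 \<longrightarrow> (y has_vector_derivative y1 x) (at x)) \<and>
        (AE x in lborel. x > 0 \<longrightarrow> (y1 has_vector_derivative y2 x) (at x)) \<and>
        ae_eq_Rp f (\<lambda>x. - y2 x + q x * y x) \<and>
        A * y 0 + B * y1 0 = 0)}"

definition in_resolvent_set :: "((real \<Rightarrow> complex) \<times> (real \<Rightarrow> complex)) set \<Rightarrow> complex \<Rightarrow> bool" where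
  "in_resolvent_set G mu \<longleftrightarrow>
     (\<forall>f. L2_Rp f \<longrightarrow> (\<exists>y g. (y, g) \<in> G \<and> ae_eq_Rp (\<lambda>x. g x - mu * y x) f)) \<and>
     (\<forall>y g. (y, g) \<in> G \<and> ae_eq_Rp (\<lambda>x. g x - mu * y x) (\<lambda>x. 0) \<longrightarrow> ae_eq_Rp y (\<lambda>x. 0)) \<and>
     (\<exists>C. \<forall>y g. (y, g) \<in> G \<longrightarrow>
        L2_norm_Rp y \<le> C * L2_norm_Rp (\<lambda>x. g x - mu * y x))"

text \<open>The resolvent (L - lambda)^(-1) is compact: it maps bounded sequences to sequences
  with an L2-Cauchy (hence convergent) subsequence.\<close>
definition resolvent_compact :: "((real \<Rightarrow> complex) \<times> (real \<Rightarrow> complex)) set \<Rightarrow> complex \<Rightarrow> bool" where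
  "resolvent_compact G mu \<longleftrightarrow>
     (\<forall>(y :: nat \<Rightarrow> real \<Rightarrow> complex) g M. (\<forall>n. (y n, g n) \<in> G) \<and>
        (\<forall>n. L2_norm_Rp (\<lambda>x. g n x - mu * y n x) \<le> M) \<longrightarrow>
        (\<exists>r::nat \<Rightarrow> nat. strict_mono r \<and> (\<forall>\<epsilon>>0. \<exists>N. \<forall>m\<ge>N. \<forall>n\<ge>N.
            L2_norm_Rp (\<lambda>x. y (r m) x - y (r n) x) < \<epsilon>)))"

definition has_compact_resolvent :: "((real \<Rightarrow> complex) \<times> (real \<Rightarrow> complex)) set \<Rightarrow> bool" where
  "has_compact_resolvent G \<longleftrightarrow> (\<exists>mu. in_resolvent_set G mu \<and> resolvent_compact G mu)"

definition molchanov :: "(real \<Rightarrow> complex) \<Rightarrow> bool" where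
  "molchanov q \<longleftrightarrow> (\<forall>(h::real) (a::nat \<Rightarrow> real). h > 0 \<and> (\<forall>n. a n \<ge> 0) \<and>
      (\<forall>m n. m \<noteq> n \<longrightarrow> {a m..<a m + h} \<inter> {a n..<a n + h} = {}) \<longrightarrow>
      filterlim (\<lambda>n. LBINT x:{a n..<a n + h}. cmod (q x)) at_top sequentially)"

end

(* For a suitable theta with cos theta > 0 one has Re (cis theta * (q - q0)) >= delta |q - q0|. Testing the
   equation - y'' + (q - mu) y = f with eta^2 cnj y, where eta is a linear cutoff, therefore bounds
   y' in L2, y in L2 and |q - q0| |y|^2 in L1 by the L2 norm of f, for mu far out in the direction opposite
   to the rotated axis. This gives uniqueness, a bounded inverse, and existence by shooting on [0,b], b to
   infinity. Under Molchanov's condition the weight |q - q0| makes these bounds compact. Conversely, on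
   intervals where the integral of |q| stays bounded, cut-off solutions of - u'' + q u = mu u form a
   noncompact sequence with bounded images. *)
theory Submission
  imports Defs "HOL-Complex_Analysis.Great_Picard"
begin

section \<open>Absolutely continuous functions\<close>

text \<open>Two contributions lack a sign: the boundary form at 0, which the boundary condition
  turns into a multiple of |y(0)|^2, and the mass of \<open>q - q0\<close> on [0, x0], where nothing
  is known about the argument. Both are dominated by the supremum of |z|^2 for the cut-off function
  z, hence by a small multiple of the energy plus a large multiple of the squared L2 norm of z. The
  large multiple is paid for by \<open>mu\<close>: with \<open>mu = q0 - K * cnj e\<close> and
  \<open>e = cis \<theta>\<close>, \<open>e * (q - mu)\<close> equals
  \<open>e * (q - q0) + K\<close>. The condition cos \<theta> > 0 keeps the |z'|^2 term positive
  after the rotation. Since q is merely locally integrable, all derivatives of y' exist only almost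
  everywhere, so the calculus rests on both halves of the fundamental theorem for absolutely
  continuous functions.\<close>

lemma AC_on_tagged_partial_division:
  assumes AC: "AC_on a b F" and "\<epsilon> > 0"
  obtains \<delta> where "\<delta> > 0"
    "\<And>p. p tagged_partial_division_of {a..b} \<Longrightarrow> (\<Sum>(x,K)\<in>p. measure lborel K) < \<delta> \<Longrightarrow>
       (\<Sum>(x,K)\<in>p. norm (F (Sup K) - F (Inf K))) < \<epsilon>"
proof -
  from AC have "\<exists>\<delta>>0. \<forall>(n::nat) (u::nat \<Rightarrow> real) v.
      (\<forall>i<n. a \<le> u i \<and> u i \<le> v i \<and> v i \<le> b) \<and>
      (\<forall>i<n. \<forall>j<n. i \<noteq> j \<longrightarrow> v i \<le> u j \<or> v j \<le> u i) \<and>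
      (\<Sum>i<n. v i - u i) < \<delta> \<longrightarrow> (\<Sum>i<n. cmod (F (v i) - F (u i))) < \<epsilon>"
    unfolding AC_on_def by (elim allE[of _ \<epsilon>] mp) (rule \<open>\<epsilon> > 0\<close>)
  then obtain \<delta> where "\<delta> > 0" and \<delta>: "\<forall>(n::nat) (u::nat \<Rightarrow> real) v.
      (\<forall>i<n. a \<le> u i \<and> u i \<le> v i \<and> v i \<le> b) \<and>
      (\<forall>i<n. \<forall>j<n. i \<noteq> j \<longrightarrow> v i \<le> u j \<or> v j \<le> u i) \<and>
      (\<Sum>i<n. v i - u i) < \<delta> \<longrightarrow> (\<Sum>i<n. cmod (F (v i) - F (u i))) < \<epsilon>"
    by (elim exE conjE)
  show thesis
  proof (rule that[OF \<open>\<delta> > 0\<close>])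
    fix p assume p: "p tagged_partial_division_of {a..b}" and less: "(\<Sum>(x,K)\<in>p. measure lborel K) < \<delta>"
    note pD = tagged_partial_division_ofD[OF p]
    \<comment> \<open>Degenerate cells must be dropped: a one-point cell has empty interior and may
      sit in the middle of another cell, which violates the ordering of endpoints required by
      \<open>AC_on\<close>. They contribute nothing to either sum.\<close>
    define p' where "p' = {xK\<in>p. Inf (snd xK) < Sup (snd xK)}"
    have fin: "finite p" "finite p'" using pD(1) by (auto simp: p'_def)
    have K: "\<exists>u v. K = {u..v} \<and> u \<le> v \<and> Inf K = u \<and> Sup K = v \<and> measure lborel K = v - u \<and> a \<le> u \<and> v \<le> b"
      if "(x,K) \<in> p" for x K
    proof -
      obtain u v where uv: "K = cbox u v" using pD(4) \<open>(x,K) \<in> p\<close> by blast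
      moreover have "x \<in> K" "K \<subseteq> {a..b}" using pD(2,3) \<open>(x,K) \<in> p\<close> by blast+
      ultimately show ?thesis by (intro exI[of _ u] exI[of _ v]) auto
    qed
    obtain g where g: "bij_betw g {..<card p'} p'"
      using ex_bij_betw_nat_finite[OF fin(2)] by (auto simp: atLeast0LessThan)
    define u v where "u i = Inf (snd (g i))" and "v i = Sup (snd (g i))" for i
    have gi: "g i \<in> p'" if "i < card p'" for i using g that by (auto simp: bij_betw_def)
    have disj: "v i \<le> u j \<or> v j \<le> u i" if ij: "i < card p'" "j < card p'" "i \<noteq> j" for i j
    proof -
      obtain x K where 1: "g i = (x,K)" by fastforce
      obtain y L where 2: "g j = (y,L)" by fastforce
      have ne: "g i \<noteq> g j" using ij g by (metis bij_betw_def inj_on_def lessThan_iff)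
      have m: "(x,K) \<in> p" "(y,L) \<in> p" using gi[OF ij(1)] gi[OF ij(2)] 1 2 by (auto simp: p'_def)
      obtain u1 v1 where K1: "K = {u1..v1}" "Inf K = u1" "Sup K = v1" using K m by blast
      obtain u2 v2 where K2: "L = {u2..v2}" "Inf L = u2" "Sup L = v2" using K m by blast
      have lt: "u1 < v1" "u2 < v2" using gi[OF ij(1)] gi[OF ij(2)] 1 2 K1 K2 by (auto simp: p'_def)
      have "interior K \<inter> interior L = {}" using pD(5)[OF m] ne 1 2 by auto
      then have e: "{u1<..<v1} \<inter> {u2<..<v2} = {}" by (simp add: K1(1) K2(1))
      have "v1 \<le> u2 \<or> v2 \<le> u1"
      proof (rule ccontr)
        assume "\<not> ?thesis"
        then have "(max u1 u2 + min v1 v2)/2 \<in> {u1<..<v1} \<inter> {u2<..<v2}" using lt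
          by (auto simp: max_def min_def)
        with e show False by blast
      qed
      then show ?thesis unfolding u_def v_def 1 2 snd_conv K1(2,3) K2(2,3) .
    qed
    have bnd: "a \<le> u i \<and> u i \<le> v i \<and> v i \<le> b" if "i < card p'" for i
    proof -
      obtain x L where 1: "g i = (x,L)" by fastforce
      have m: "(x,L) \<in> p" using gi[OF that] 1 by (auto simp: p'_def)
      show ?thesis using K[OF m] by (auto simp: u_def v_def 1)
    qed
    have "(\<Sum>i<card p'. v i - u i) = (\<Sum>xK\<in>p'. Sup (snd xK) - Inf (snd xK))"
      unfolding u_def v_def using sum.reindex_bij_betw[OF g, of "\<lambda>xK. Sup (snd xK) - Inf (snd xK)"] .
    also have "\<dots> = (\<Sum>(x,K)\<in>p'. measure lborel K)"
    proof (rule sum.cong[OF refl], safe)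
      fix x L assume "(x, L) \<in> p'"
      then have m: "(x,L) \<in> p" by (auto simp: p'_def)
      show "Sup (snd (x, L)) - Inf (snd (x, L)) = measure lborel L" using K[OF m] by force
    qed
    also have "\<dots> \<le> (\<Sum>(x,K)\<in>p. measure lborel K)"
      by (rule sum_mono2) (use fin in \<open>auto simp: p'_def\<close>)
    finally have "(\<Sum>i<card p'. v i - u i) < \<delta>" using less by simp
    then have "(\<Sum>i<card p'. cmod (F (v i) - F (u i))) < \<epsilon>"
      using \<delta>[rule_format, of "card p'" u v] bnd disj by simp
    also have "(\<Sum>i<card p'. cmod (F (v i) - F (u i))) = (\<Sum>xK\<in>p'. cmod (F (Sup (snd xK)) - F (Inf (snd xK))))"
      unfolding u_def v_def
      using sum.reindex_bij_betw[OF g, of "\<lambda>xK. cmod (F (Sup (snd xK)) - F (Inf (snd xK)))"] .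
    also have "\<dots> = (\<Sum>xK\<in>p. cmod (F (Sup (snd xK)) - F (Inf (snd xK))))"
    proof (rule sum.mono_neutral_left)
      show "\<forall>i\<in>p - p'. cmod (F (Sup (snd i)) - F (Inf (snd i))) = 0"
      proof
        fix i assume i: "i \<in> p - p'"
        obtain x L where 1: "i = (x,L)" by fastforce
        have m: "(x,L) \<in> p" "\<not> Inf L < Sup L" using i 1 by (auto simp: p'_def)
        show "cmod (F (Sup (snd i)) - F (Inf (snd i))) = 0" using K[OF m(1)] m(2) 1 by auto
      qed
    qed (use fin in \<open>auto simp: p'_def\<close>)
    finally show "(\<Sum>(x,K)\<in>p. norm (F (Sup K) - F (Inf K))) < \<epsilon>" by (simp add: case_prod_unfold)
  qed
qed

lemma tagged_partial_division_content_le: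
  fixes U :: "real set"
  assumes p: "p tagged_partial_division_of S" and U: "U \<in> lmeasurable"
    and sub: "\<And>x K. (x,K) \<in> p \<Longrightarrow> K \<subseteq> U"
  shows "(\<Sum>(x,K)\<in>p. measure lborel K) \<le> measure lebesgue U"
proof -
  have td: "p tagged_division_of (\<Union>(snd ` p))" by (rule tagged_partial_division_of_Union_self[OF p])
  have dv: "snd ` p division_of (\<Union>(snd ` p))" by (rule division_of_tagged_division[OF td])
  have "(\<Sum>(x,K)\<in>p. measure lborel K) = (\<Sum>K\<in>snd ` p. measure lborel K)"
    by (rule sum.over_tagged_division_lemma[OF td]) (simp add: content_eq_0_interior)
  also have "\<dots> = (\<Sum>K\<in>snd ` p. measure lebesgue K)"
  proof (rule sum.cong[OF refl])
    fix K assume "K \<in> snd ` p"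
    then obtain a b where "K = cbox a b" using division_ofD(4)[OF dv] by blast
    then show "measure lborel K = measure lebesgue K" by simp
  qed
  also have "\<dots> = measure lebesgue (\<Union>(snd ` p))"
    by (rule content_division[OF dv])
  also have "\<dots> \<le> measure lebesgue U"
  proof (rule measure_mono_fmeasurable[OF _ _ U])
    show "\<Union> (snd ` p) \<subseteq> U" using sub by force
    show "\<Union> (snd ` p) \<in> sets lebesgue" using dv lmeasurable_division by blast
  qed
  finally show ?thesis .
qed

text \<open>The gauge integral makes this direct: away from a null set the gauge comes from
  differentiability, and on the null set it confines the intervals to an open set of small measure,
  where absolute continuity applies.\<close>
lemma AC_on_has_integral:
  assumes AC: "AC_on a b F" and "a \<le> b"
    and der: "AE x in lborel. a < x \<and> x < b \<longrightarrow> (F has_vector_derivative g x) (at x)"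
  shows "(g has_integral (F b - F a)) {a..b}"
proof -
  obtain N0 where N0: "N0 \<in> null_sets lborel" "\<And>x. x \<notin> N0 \<Longrightarrow> a < x \<and> x < b \<longrightarrow> (F has_vector_derivative g x) (at x)"
    using AE_E3[OF der] by auto
  define N where "N = N0 \<union> {a,b}"
  have "N0 \<in> null_sets lebesgue" using N0(1) null_sets_completionI by blast
  then have Nneg: "negligible N" unfolding N_def by (intro negligible_Un) (auto simp: negligible_iff_null_sets[symmetric])
  have dN: "(F has_vector_derivative g x) (at x)" if "x \<in> {a..b}" "x \<notin> N" for x
    using that N0(2)[of x] by (auto simp: N_def)
  \<comment> \<open>Setting the integrand to 0 on \<open>N\<close> leaves, for cells tagged in
    \<open>N\<close>, only the increments of \<open>F\<close>, which absolute continuity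
    controls.\<close>
  define G where "G x = (if x \<in> N then 0 else g x)" for x
  have "(G has_integral (F b - F a)) {a..b}"
    unfolding has_integral_real
  proof (intro allI impI)
    fix e :: real assume "e > 0"
    \<comment> \<open>The summand 1 keeps the denominator positive when a = b.\<close>
    define e1 where "e1 = e / (2 * (b - a + 1))"
    have e1: "e1 > 0" using \<open>e > 0\<close> \<open>a \<le> b\<close> by (simp add: e1_def)
    have e1': "e1 * (b - a) < e/2" using \<open>e > 0\<close> \<open>a \<le> b\<close> by (simp add: e1_def field_simps)
    obtain \<delta> where "\<delta> > 0" and \<delta>: "\<forall>p. p tagged_partial_division_of {a..b} \<longrightarrow> (\<Sum>(x,K)\<in>p. measure lborel K) < \<delta> \<longrightarrow>
       (\<Sum>(x,K)\<in>p. norm (F (Sup K) - F (Inf K))) < e/2"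
    proof (rule AC_on_tagged_partial_division[OF AC])
      show "e/2 > 0" using \<open>e > 0\<close> by simp
    qed (rule that, assumption, blast)
    obtain U where U: "open U" "N \<subseteq> U" "U - N \<in> lmeasurable" "emeasure lebesgue (U - N) < ennreal \<delta>"
      using sets_lebesgue_outer_open[OF negligible_imp_sets[OF Nneg] \<open>\<delta> > 0\<close>] by blast
    have UNm: "U = (U - N) \<union> N" using U(2) by auto
    have Um: "U \<in> lmeasurable" using UNm U(3) Nneg by (metis fmeasurable.Un negligible_imp_measurable)
    have mU: "measure lebesgue U < \<delta>"
    proof -
      have "measure lebesgue U = measure lebesgue (U - N)"
        using Nneg Um by (simp add: measure_Diff_null_set negligible_iff_null_sets fmeasurableD)
      also have "\<dots> < \<delta>" using U(3,4) \<open>\<delta> > 0\<close>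
        by (metis emeasure_eq_measure2 ennreal_leI not_less)
      finally show ?thesis .
    qed
    have "\<exists>d>0. \<forall>y. norm (y - x) < d \<longrightarrow> norm (F y - F x - (y - x) *\<^sub>R g x) \<le> e1 * norm (y - x)"
      if "x \<in> {a..b}" "x \<notin> N" for x
      using dN[OF that] e1 unfolding has_vector_derivative_def has_derivative_at_alt by blast
    then obtain d where d: "\<And>x. x \<in> {a..b} \<Longrightarrow> x \<notin> N \<Longrightarrow> d x > 0 \<and> (\<forall>y. norm (y - x) < d x \<longrightarrow> norm (F y - F x - (y - x) *\<^sub>R g x) \<le> e1 * norm (y - x))"
      by metis
    define \<gamma> where "\<gamma> x = (if x \<in> N then U else if x \<in> {a..b} then ball x (d x) else UNIV)" for x
    have gauge: "gauge \<gamma>" unfolding gauge_def \<gamma>_def using U d by auto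
    have main: "norm ((\<Sum>(x,k)\<in>\<D>. measure lborel k *\<^sub>R G x) - (F b - F a)) < e"
      if \<D>: "\<D> tagged_division_of {a..b}" "\<gamma> fine \<D>" for \<D>
    proof -
      have tp: "\<D> tagged_partial_division_of {a..b}" using \<D>(1) by (simp add: tagged_division_of_def)
      note pD = tagged_partial_division_ofD[OF tp]
      define B where "B = {xK\<in>\<D>. fst xK \<in> N}"
      have Bp: "B tagged_partial_division_of {a..b}"
        by (rule tagged_partial_division_subset[OF tp]) (auto simp: B_def)
      have cB: "(\<Sum>(x,K)\<in>B. measure lborel K) < \<delta>"
      proof (rule le_less_trans[OF tagged_partial_division_content_le[OF Bp Um] mU])
        fix x K assume "(x,K) \<in> B"
        then have "(x,K) \<in> \<D>" "x \<in> N" by (auto simp: B_def)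
        then show "K \<subseteq> U" using \<D>(2) unfolding fine_def \<gamma>_def by fastforce
      qed
      have fin: "finite \<D>" "B \<subseteq> \<D>" using pD(1) by (auto simp: B_def)
      have 0: "(\<Sum>(x,K)\<in>\<D>. F (Sup K) - F (Inf K)) = F b - F a"
        by (rule additive_tagged_division_1[OF \<open>a \<le> b\<close> \<D>(1)])
      have cD: "(\<Sum>(x,K)\<in>\<D>. measure lborel K) = b - a"
        using additive_content_tagged_division[of \<D> a b] \<D>(1) \<open>a \<le> b\<close> by simp
      have "norm ((\<Sum>(x,k)\<in>\<D>. measure lborel k *\<^sub>R G x) - (F b - F a))
          = norm (\<Sum>(x,K)\<in>\<D>. measure lborel K *\<^sub>R G x - (F (Sup K) - F (Inf K)))"
        by (simp add: 0[symmetric] sum_subtractf case_prod_unfold)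
      also have "\<dots> \<le> (\<Sum>(x,K)\<in>\<D>. norm (measure lborel K *\<^sub>R G x - (F (Sup K) - F (Inf K))))"
        unfolding case_prod_unfold by (rule norm_sum)
      also have "\<dots> = (\<Sum>(x,K)\<in>\<D> - B. norm (measure lborel K *\<^sub>R G x - (F (Sup K) - F (Inf K)))) + (\<Sum>(x,K)\<in>B. norm (measure lborel K *\<^sub>R G x - (F (Sup K) - F (Inf K))))"
        by (rule sum.subset_diff[OF fin(2,1)])
      also have "(\<Sum>(x,K)\<in>B. norm (measure lborel K *\<^sub>R G x - (F (Sup K) - F (Inf K)))) = (\<Sum>(x,K)\<in>B. norm (F (Sup K) - F (Inf K)))"
        by (rule sum.cong) (auto simp: B_def G_def norm_minus_commute)
      also have "\<dots> < e/2" by (rule \<delta>[rule_format, OF Bp cB])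
      also have "(\<Sum>(x,K)\<in>\<D> - B. norm (measure lborel K *\<^sub>R G x - (F (Sup K) - F (Inf K)))) \<le> (\<Sum>(x,K)\<in>\<D> - B. e1 * measure lborel K)"
      proof (rule sum_mono, safe)
        fix x K assume m: "(x,K) \<in> \<D>" and nB: "(x,K) \<notin> B"
        have xN: "x \<notin> N" using m nB by (auto simp: B_def)
        obtain u v where uv: "K = cbox u v" using pD(4)[OF m] by blast
        have xK: "x \<in> K" "K \<subseteq> {a..b}" using pD(2,3) m by blast+
        then have le: "u \<le> x" "x \<le> v" and xab: "x \<in> {a..b}" using uv by auto
        have "K \<subseteq> ball x (d x)" using \<D>(2) m xN xab unfolding fine_def \<gamma>_def by fastforce
        then have "u \<in> ball x (d x)" "v \<in> ball x (d x)" using uv le by (auto simp: subset_iff)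
        then have nn: "norm (u - x) < d x" "norm (v - x) < d x" by (auto simp: dist_real_def)
        have "norm (F v - F x - (v - x) *\<^sub>R g x) \<le> e1 * (v - x)" "norm (F u - F x - (u - x) *\<^sub>R g x) \<le> e1 * (x - u)"
          using d[OF xab xN, THEN conjunct2, rule_format, OF nn(1)] d[OF xab xN, THEN conjunct2, rule_format, OF nn(2)] le
          by simp_all
        moreover have eq: "(v - u) *\<^sub>R g x - (F v - F u) = (F u - F x - (u - x) *\<^sub>R g x) - (F v - F x - (v - x) *\<^sub>R g x)"
          by (simp add: algebra_simps)
        ultimately have "norm ((v - u) *\<^sub>R g x - (F v - F u)) \<le> e1 * (x - u) + e1 * (v - x)"
          using norm_triangle_ineq4[of "F u - F x - (u - x) *\<^sub>R g x" "F v - F x - (v - x) *\<^sub>R g x"]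
          unfolding eq by linarith
        then show "norm (measure lborel K *\<^sub>R G x - (F (Sup K) - F (Inf K))) \<le> e1 * measure lborel K"
          using uv le xN by (simp add: G_def algebra_simps)
      qed
      also have "(\<Sum>(x,K)\<in>\<D> - B. e1 * measure lborel K) \<le> (\<Sum>(x,K)\<in>\<D>. e1 * measure lborel K)"
        by (rule sum_mono2) (use fin e1 in auto)
      also have "\<dots> = e1 * (b - a)" unfolding cD[symmetric] by (simp add: case_prod_unfold sum_distrib_left)
      also have "\<dots> < e/2" by (rule e1')
      finally show ?thesis by simp
    qed
    show "\<exists>\<gamma>. gauge \<gamma> \<and> (\<forall>\<D>. \<D> tagged_division_of {a..b} \<and> \<gamma> fine \<D> \<longrightarrow>
        norm ((\<Sum>(x,k)\<in>\<D>. measure lborel k *\<^sub>R G x) - (F b - F a)) < e)"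
      by (intro exI[of _ \<gamma>] conjI allI impI gauge, elim conjE, rule main)
  qed
  then show ?thesis
    by (rule has_integral_spike[OF Nneg, rotated]) (auto simp: G_def)
qed

text \<open>Around a point where the difference quotient fails, Henstock's lemma bounds the total length of
  disjoint bad intervals, and Vitali's covering lemma turns this into a measure bound.\<close>
lemma negligible_bad_difference_quotient:
  fixes g :: "real \<Rightarrow> complex"
  assumes g: "g integrable_on {a..b}" and "\<eta> > 0"
  defines "F \<equiv> \<lambda>t. integral {a..t} g"
  shows "negligible {x\<in>{a<..<b}. \<forall>d>0. \<exists>y. y \<noteq> x \<and> \<bar>y - x\<bar> < d \<and>
           norm (F y - F x - (y - x) *\<^sub>R g x) > \<eta> * \<bar>y - x\<bar>}"
proof -
  define E where "E = {x\<in>{a<..<b}. \<forall>d>0. \<exists>y. y \<noteq> x \<and> \<bar>y - x\<bar> < d \<and>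
           norm (F y - F x - (y - x) *\<^sub>R g x) > \<eta> * \<bar>y - x\<bar>}"
  have Eab: "x \<in> {a<..<b}" if "x \<in> E" for x using that unfolding E_def by blast
  have Ebad: "\<forall>d>0. \<exists>y. y \<noteq> x \<and> \<bar>y - x\<bar> < d \<and> norm (F y - F x - (y - x) *\<^sub>R g x) > \<eta> * \<bar>y - x\<bar>"
    if "x \<in> E" for x using that unfolding E_def mem_Collect_eq by (rule conjunct2)
  have "negligible E"
    unfolding negligible_outer_le
  proof (intro allI impI)
    fix \<epsilon> :: real assume "\<epsilon> > 0"
    \<comment> \<open>The factor 10 is the length of a ball of radius 5 r in units of r, the
      enlargement in Vitali's lemma; \<eta> converts the Henstock defect of a bad interval into its
      length.\<close>
    then have "\<epsilon> * \<eta> / 10 > 0" using \<open>\<eta> > 0\<close> by simp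
    have "\<exists>\<gamma>. gauge \<gamma> \<and> (\<forall>p. p tagged_partial_division_of (cbox a b) \<and> \<gamma> fine p \<longrightarrow> sum (\<lambda>(x,k). norm (measure lborel k *\<^sub>R g x - integral k g)) p < \<epsilon> * \<eta> / 10)"
    proof (rule Henstock_lemma[OF g[folded box_real(2)] \<open>\<epsilon> * \<eta> / 10 > 0\<close>])
      fix \<gamma> assume gauge: "gauge \<gamma>" and H: "\<And>p. \<lbrakk>p tagged_partial_division_of (cbox a b); \<gamma> fine p\<rbrakk> \<Longrightarrow> sum (\<lambda>(x,k). norm (measure lborel k *\<^sub>R g x - integral k g)) p < \<epsilon> * \<eta> / 10"
      show ?thesis by (intro exI[of _ \<gamma>] conjI allI impI gauge, elim conjE, rule H)
    qed
    then obtain \<gamma> where \<gamma>: "gauge \<gamma>"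
      and H: "\<forall>p. p tagged_partial_division_of (cbox a b) \<and> \<gamma> fine p \<longrightarrow> sum (\<lambda>(x,k). norm (measure lborel k *\<^sub>R g x - integral k g)) p < \<epsilon> * \<eta> / 10"
      by (elim exE conjE)
    have "\<exists>y. y \<noteq> x \<and> norm (F y - F x - (y - x) *\<^sub>R g x) > \<eta> * \<bar>y - x\<bar> \<and> cball x \<bar>y - x\<bar> \<subseteq> \<gamma> x \<inter> {a<..<b} \<and> \<bar>y - x\<bar> \<le> 1"
      if "x \<in> E" for x
    proof -
      note xab = Eab[OF that] and bad = Ebad[OF that]
      have "open (\<gamma> x \<inter> {a<..<b})" using \<gamma> by (intro open_Int) (auto simp: gauge_def)
      moreover have "x \<in> \<gamma> x \<inter> {a<..<b}" using \<gamma> xab by (auto simp: gauge_def)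
      ultimately obtain d where d: "d > 0" "ball x d \<subseteq> \<gamma> x \<inter> {a<..<b}" by (rule openE)
      have "min d 1 > 0" using d(1) by simp
      with bad obtain y where y: "y \<noteq> x" "\<bar>y - x\<bar> < min d 1" "norm (F y - F x - (y - x) *\<^sub>R g x) > \<eta> * \<bar>y - x\<bar>"
        by (elim allE impE exE conjE)
      have c: "cball x \<bar>y - x\<bar> \<subseteq> ball x d" using y(2) by (auto simp: dist_real_def)
      have "\<bar>y - x\<bar> \<le> 1" using y(2) by simp
      with y(1,3) order_trans[OF c d(2)] show ?thesis by blast
    qed
    then have "\<forall>x\<in>E. \<exists>y. y \<noteq> x \<and> norm (F y - F x - (y - x) *\<^sub>R g x) > \<eta> * \<bar>y - x\<bar> \<and> cball x \<bar>y - x\<bar> \<subseteq> \<gamma> x \<inter> {a<..<b} \<and> \<bar>y - x\<bar> \<le> 1"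
      by (rule ballI)
    from bchoice[OF this] obtain Y where "\<forall>x\<in>E. Y x \<noteq> x \<and> norm (F (Y x) - F x - (Y x - x) *\<^sub>R g x) > \<eta> * \<bar>Y x - x\<bar> \<and> cball x \<bar>Y x - x\<bar> \<subseteq> \<gamma> x \<inter> {a<..<b} \<and> \<bar>Y x - x\<bar> \<le> 1" ..
    note Y = this[rule_format]
    define r where "r x = \<bar>Y x - x\<bar>" for x
    obtain C where C: "countable C" "C \<subseteq> E" "pairwise (\<lambda>i j. disjnt (cball i (r i)) (cball j (r j))) C"
       "E \<subseteq> (\<Union>i\<in>C. cball i (5 * r i))"
    proof (rule Vitali_covering_lemma_cballs[of E "\<lambda>x. x" r E 1])
      show "E \<subseteq> (\<Union>i\<in>E. cball i (r i))"
      proof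
        fix x assume "x \<in> E"
        moreover have "x \<in> cball x (r x)" by (simp add: r_def)
        ultimately show "x \<in> (\<Union>i\<in>E. cball i (r i))" by (rule UN_I)
      qed
      show "0 < r i \<and> r i \<le> 1" if "i \<in> E" for i
      proof -
        have "Y i \<noteq> i" "\<bar>Y i - i\<bar> \<le> 1" using Y[OF that] by blast+
        then show ?thesis unfolding r_def by simp
      qed
    qed auto
    have fin: "(\<Sum>x\<in>I. 10 * r x) \<le> \<epsilon>" if I: "I \<subseteq> C" "finite I" for I
    proof -
      \<comment> \<open>The bad interval runs from x to its witness \<open>Y x\<close> and is tagged
        at its endpoint x. It lies in the ball of radius \<open>r x\<close>, so disjointness of the
        balls and fineness for \<gamma> carry over.\<close>
      define J where "J x = {min x (Y x)..max x (Y x)}" for x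
      have Jc: "J x \<subseteq> cball x (r x)" for x by (auto simp: J_def r_def dist_real_def)
      have xE: "x \<in> E" if "x \<in> I" for x using that I C by blast
      define p where "p = (\<lambda>x. (x, J x)) ` I"
      have p: "p tagged_partial_division_of cbox a b"
        unfolding tagged_partial_division_of_def
      proof (intro conjI allI impI)
        show "finite p" using I by (simp add: p_def)
      next
        fix x K assume "(x,K) \<in> p"
        then have K: "K = J x" "x \<in> I" by (auto simp: p_def)
        show "x \<in> K" by (auto simp: K J_def)
        show "K \<subseteq> cbox a b"
        proof -
          have "cball x (r x) \<subseteq> {a<..<b}" using Y[OF xE[OF K(2)]] unfolding r_def by blast
          then show ?thesis using Jc[of x] K(1) by auto
        qed
        show "\<exists>a b. K = cbox a b" by (auto simp: K J_def)
      next
        fix x1 K1 x2 K2 assume *: "(x1,K1) \<in> p \<and> (x2,K2) \<in> p \<and> (x1,K1) \<noteq> (x2,K2)"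
        then have K: "K1 = J x1" "x1 \<in> I" "K2 = J x2" "x2 \<in> I" "x1 \<noteq> x2" by (auto simp: p_def)
        then have "disjnt (cball x1 (r x1)) (cball x2 (r x2))" using C(3) I(1) by (auto simp: pairwise_def)
        then have "K1 \<inter> K2 = {}" using Jc[of x1] Jc[of x2] K by (auto simp: disjnt_def)
        then show "interior K1 \<inter> interior K2 = {}" by (meson disjoint_iff interior_subset subsetD)
      qed
      have "\<gamma> fine p" unfolding fine_def
      proof safe
        fix x K t assume "(x,K) \<in> p" "t \<in> K"
        then have K: "t \<in> J x" "x \<in> I" by (auto simp: p_def)
        then show "t \<in> \<gamma> x" using Jc[of x] Y[OF xE[OF K(2)]] unfolding r_def by blast
      qed
      from H[rule_format, OF conjI[OF p this]] have H': "(\<Sum>x\<in>I. norm (measure lborel (J x) *\<^sub>R g x - integral (J x) g)) < \<epsilon> * \<eta> / 10"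
        unfolding p_def by (subst (asm) sum.reindex) (auto simp: inj_on_def)
      have "\<eta> * r x \<le> norm (measure lborel (J x) *\<^sub>R g x - integral (J x) g)" if "x \<in> I" for x
      proof -
        note Yx = Y[OF xE[OF that]]
        have "x \<in> {a<..<b}" by (rule Eab[OF xE[OF that]])
        then have ab: "a < x" "x < b" by auto
        have "Y x \<in> cball x \<bar>Y x - x\<bar>" by (auto simp: dist_real_def)
        then have "Y x \<in> {a<..<b}" using Yx by blast
        then have ab2: "a < Y x" "Y x < b" by auto
        have comb: "F v - F u = integral {u..v} g" if "a \<le> u" "u \<le> v" "v \<le> b" for u v
          using Henstock_Kurzweil_Integration.integral_combine[of a u v g] that integrable_on_subinterval[OF g, of a v]
          unfolding F_def by (simp add: algebra_simps)
        show ?thesis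
        proof (cases "x \<le> Y x")
          case True
          have "measure lborel (J x) *\<^sub>R g x - integral (J x) g = - (F (Y x) - F x - (Y x - x) *\<^sub>R g x)"
            using True comb[of x "Y x"] ab ab2 by (simp add: J_def)
          then show ?thesis using Yx unfolding r_def by (simp only: norm_minus_cancel) simp
        next
          case False
          have "measure lborel (J x) *\<^sub>R g x - integral (J x) g = (F (Y x) - F x - (Y x - x) *\<^sub>R g x)"
            using False comb[of "Y x" x] ab ab2 by (simp add: J_def algebra_simps)
          then show ?thesis using Yx unfolding r_def by simp
        qed
      qed
      then have "(\<Sum>x\<in>I. \<eta> * r x) \<le> (\<Sum>x\<in>I. norm (measure lborel (J x) *\<^sub>R g x - integral (J x) g))"
        by (rule sum_mono)
      with H' have "\<eta> * (\<Sum>x\<in>I. r x) \<le> \<epsilon> * \<eta> / 10" by (simp add: sum_distrib_left)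
      then have "10 * (\<Sum>x\<in>I. r x) \<le> \<epsilon>" using \<open>\<eta> > 0\<close> by (simp add: field_simps)
      then show ?thesis by (simp add: sum_distrib_left)
    qed
    define T where "T = (\<Union>i\<in>C. cball i (5 * r i))"
    have bound: "measure lebesgue (\<Union>i\<in>I. cball i (5 * r i)) \<le> \<epsilon>" if I: "I \<subseteq> C" "finite I" for I
    proof -
      have "measure lebesgue (\<Union>i\<in>I. cball i (5 * r i)) \<le> (\<Sum>i\<in>I. measure lebesgue (cball i (5 * r i)))"
        by (rule measure_UNION_le) (use I in auto)
      also have "\<dots> = (\<Sum>i\<in>I. 10 * r i)"
        by (rule sum.cong) (auto simp: cball_eq_atLeastAtMost r_def)
      also have "\<dots> \<le> \<epsilon>" by (rule fin[OF I])
      finally show ?thesis .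
    qed
    have "T \<in> lmeasurable" unfolding T_def
      by (rule fmeasurable_UN_bound[OF C(1) _ bound]) auto
    moreover have "measure lebesgue T \<le> \<epsilon>" unfolding T_def
      by (rule measure_UN_bound[OF C(1) _ bound]) auto
    ultimately show "\<exists>T. E \<subseteq> T \<and> T \<in> lmeasurable \<and> measure lebesgue T \<le> \<epsilon>"
      using C(4) unfolding T_def by blast
  qed
  then show ?thesis unfolding E_def .
qed

text \<open>Lebesgue's differentiation theorem: a point where differentiability fails is bad for
  some tolerance 1/(n+1), and each of these countably many bad sets is negligible. The passage from
  Lebesgue to Borel measure only uses completion.\<close>

lemma integral_has_vector_derivative_AE:
  fixes g :: "real \<Rightarrow> complex"
  assumes g: "g integrable_on {a..b}"
  shows "AE x in lborel. a < x \<and> x < b \<longrightarrow> ((\<lambda>t. integral {a..t} g) has_vector_derivative g x) (at x)"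
proof -
  let ?F = "\<lambda>t. integral {a..t} g"
  define E where "E \<eta> = {x\<in>{a<..<b}. \<forall>d>0. \<exists>y. y \<noteq> x \<and> \<bar>y - x\<bar> < d \<and>
           norm (?F y - ?F x - (y - x) *\<^sub>R g x) > \<eta> * \<bar>y - x\<bar>}" for \<eta>
  have "negligible (\<Union>n. E (1 / Suc n))"
  proof (rule negligible_countable_Union)
    fix S assume "S \<in> range (\<lambda>n. E (1 / Suc n))"
    then obtain n :: nat where n: "S = E (1 / Suc n)" by blast
    show "negligible S" unfolding n E_def by (rule negligible_bad_difference_quotient[OF g]) simp
  qed simp
  then have "AE x in lebesgue. x \<notin> (\<Union>n. E (1 / Suc n))"
    unfolding negligible_iff_null_sets by (rule AE_not_in)
  moreover have "((?F) has_vector_derivative g x) (at x)" if x: "x \<notin> (\<Union>n. E (1 / Suc n))" "a < x" "x < b" for x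
    unfolding has_vector_derivative_def has_derivative_at_alt
  proof (intro conjI allI impI)
    show "bounded_linear (\<lambda>h. h *\<^sub>R g x)" by (rule bounded_linear_scaleR_left)
    fix e :: real assume "e > 0"
    then obtain n where n: "1 / Suc n < e" using nat_approx_posE by blast
    from x n obtain d where d: "d > 0" "\<And>y. y \<noteq> x \<Longrightarrow> \<bar>y - x\<bar> < d \<Longrightarrow> norm (?F y - ?F x - (y - x) *\<^sub>R g x) \<le> (1 / Suc n) * \<bar>y - x\<bar>"
    proof -
      have "x \<notin> E (1 / Suc n)" using x by blast
      then have "\<not> (\<forall>d>0. \<exists>y. y \<noteq> x \<and> \<bar>y - x\<bar> < d \<and>
           norm (?F y - ?F x - (y - x) *\<^sub>R g x) > (1 / Suc n) * \<bar>y - x\<bar>)"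
        using x unfolding E_def by simp
      then show thesis using that by (meson not_less)
    qed
    have "norm (?F y - ?F x - (y - x) *\<^sub>R g x) \<le> e * norm (y - x)" if "norm (y - x) < d" for y
    proof (cases "y = x")
      case False
      have "(1 / Suc n) * \<bar>y - x\<bar> \<le> e * \<bar>y - x\<bar>" using n by (intro mult_right_mono) auto
      then show ?thesis using d(2)[of y] False that by simp
    qed auto
    then show "\<exists>d>0. \<forall>y. norm (y - x) < d \<longrightarrow> norm (?F y - ?F x - (y - x) *\<^sub>R g x) \<le> e * norm (y - x)"
      using d(1) by blast
  qed
  ultimately have "AE x in lebesgue. a < x \<and> x < b \<longrightarrow> ((\<lambda>t. integral {a..t} g) has_vector_derivative g x) (at x)"
    by (auto elim: eventually_mono)
  then show ?thesis by (subst (asm) AE_completion_iff)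
qed

text \<open>The single closure principle behind sums, products, conjugates and Lipschitz images:
  applying the definition to both dominating functions with tolerance \<epsilon>/(2L) on the same
  family of intervals suffices.\<close>

lemma AC_on_dominated:
  assumes F1: "AC_on a b F1" and F2: "AC_on a b F2" and "L > 0"
    and le: "\<And>u v. a \<le> u \<Longrightarrow> u \<le> v \<Longrightarrow> v \<le> b \<Longrightarrow>
      norm (G v - G u) \<le> L * (norm (F1 v - F1 u) + norm (F2 v - F2 u))"
  shows "AC_on a b G"
  unfolding AC_on_def
proof (intro allI impI)
  fix \<epsilon> :: real assume "\<epsilon> > 0"
  then have e: "\<epsilon> / (2*L) > 0" using \<open>L > 0\<close> by simp
  let ?P = "\<lambda>F d e. \<forall>(n::nat) (u::nat \<Rightarrow> real) v.
      (\<forall>i<n. a \<le> u i \<and> u i \<le> v i \<and> v i \<le> b) \<and>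
      (\<forall>i<n. \<forall>j<n. i \<noteq> j \<longrightarrow> v i \<le> u j \<or> v j \<le> u i) \<and>
      (\<Sum>i<n. v i - u i) < d \<longrightarrow> (\<Sum>i<n. cmod (F (v i) - F (u i))) < e"
  obtain d1 where d1: "d1 > 0" "?P F1 d1 (\<epsilon> / (2*L))"
    using F1 e unfolding AC_on_def
    by (elim allE[of _ "\<epsilon> / (2*L)"] impE[of "\<epsilon> / (2*L) > 0"]) (assumption, elim exE, erule conjE, rule that)
  obtain d2 where d2: "d2 > 0" "?P F2 d2 (\<epsilon> / (2*L))"
    using F2 e unfolding AC_on_def
    by (elim allE[of _ "\<epsilon> / (2*L)"] impE[of "\<epsilon> / (2*L) > 0"]) (assumption, elim exE, erule conjE, rule that)
  have "?P G (min d1 d2) \<epsilon>"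
  proof (intro allI impI, elim conjE)
    fix n and u v :: "nat \<Rightarrow> real"
    assume 1: "\<forall>i<n. a \<le> u i \<and> u i \<le> v i \<and> v i \<le> b"
      and 2: "\<forall>i<n. \<forall>j<n. i \<noteq> j \<longrightarrow> v i \<le> u j \<or> v j \<le> u i"
      and 3: "(\<Sum>i<n. v i - u i) < min d1 d2"
    have a1: "(\<Sum>i<n. cmod (F1 (v i) - F1 (u i))) < \<epsilon> / (2*L)"
      using d1(2)[rule_format, of n u v] 1 2 3 by simp
    have a2: "(\<Sum>i<n. cmod (F2 (v i) - F2 (u i))) < \<epsilon> / (2*L)"
      using d2(2)[rule_format, of n u v] 1 2 3 by simp
    have "(\<Sum>i<n. cmod (G (v i) - G (u i)))
        \<le> (\<Sum>i<n. L * (norm (F1 (v i) - F1 (u i)) + norm (F2 (v i) - F2 (u i))))"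
    proof (rule sum_mono)
      fix i assume "i \<in> {..<n}"
      then have "a \<le> u i" "u i \<le> v i" "v i \<le> b" using 1 by blast+
      then show "cmod (G (v i) - G (u i)) \<le> L * (norm (F1 (v i) - F1 (u i)) + norm (F2 (v i) - F2 (u i)))" by (rule le)
    qed
    also have "\<dots> = L * ((\<Sum>i<n. cmod (F1 (v i) - F1 (u i))) + (\<Sum>i<n. cmod (F2 (v i) - F2 (u i))))"
      by (simp only: sum.distrib sum_distrib_left distrib_left)
    also have "\<dots> < L * (\<epsilon> / (2*L) + \<epsilon> / (2*L))"
      using a1 a2 \<open>L > 0\<close> by (intro mult_strict_left_mono) auto
    also have "\<dots> = \<epsilon>" using \<open>L > 0\<close> by (simp add: field_simps)
    finally show "(\<Sum>i<n. cmod (G (v i) - G (u i))) < \<epsilon>" .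
  qed
  then show "\<exists>\<delta>>0. ?P G \<delta> \<epsilon>" using d1(1) d2(1) by (intro exI[of _ "min d1 d2"] conjI) (simp, assumption)
qed

lemma AC_on_imp_continuous_on:
  assumes "AC_on a b F" shows "continuous_on {a..b} F"
  unfolding continuous_on_iff
proof (intro ballI allI impI)
  fix x e :: real assume x: "x \<in> {a..b}" and "e > 0"
  then obtain d where "d > 0" and d: "\<forall>(n::nat) (u::nat \<Rightarrow> real) v.
      (\<forall>i<n. a \<le> u i \<and> u i \<le> v i \<and> v i \<le> b) \<and>
      (\<forall>i<n. \<forall>j<n. i \<noteq> j \<longrightarrow> v i \<le> u j \<or> v j \<le> u i) \<and>
      (\<Sum>i<n. v i - u i) < d \<longrightarrow> (\<Sum>i<n. cmod (F (v i) - F (u i))) < e"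
    using assms unfolding AC_on_def by (elim allE[of _ e] impE exE conjE)
  have *: "dist (F y) (F x) < e" if "y \<in> {a..b}" "dist y x < d" for y
  proof -
    have "a \<le> min x y" "max x y \<le> b" "max x y - min x y < d" "min x y \<le> max x y"
      using x that by (auto simp: dist_real_def)
    then have "cmod (F (max x y) - F (min x y)) < e"
      using d[rule_format, of 1 "\<lambda>_. min x y" "\<lambda>_. max x y"] by simp
    then show ?thesis by (cases "x \<le> y") (simp_all add: dist_norm norm_minus_commute max_def min_def)
  qed
  show "\<exists>d>0. \<forall>x'\<in>{a..b}. dist x' x < d \<longrightarrow> dist (F x') (F x) < e"
    by (intro exI[of _ d] conjI ballI impI \<open>d > 0\<close> *)
qed

lemma AC_on_of_real: "AC_on a b complex_of_real"
  unfolding AC_on_def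
proof (intro allI impI)
  fix \<epsilon> :: real assume e: "\<epsilon> > 0"
  show "\<exists>\<delta>>0. \<forall>(n::nat) (u::nat \<Rightarrow> real) v.
      (\<forall>i<n. a \<le> u i \<and> u i \<le> v i \<and> v i \<le> b) \<and>
      (\<forall>i<n. \<forall>j<n. i \<noteq> j \<longrightarrow> v i \<le> u j \<or> v j \<le> u i) \<and>
      (\<Sum>i<n. v i - u i) < \<delta> \<longrightarrow> (\<Sum>i<n. cmod (of_real (v i) - of_real (u i))) < \<epsilon>"
  proof (intro exI[of _ \<epsilon>] conjI e allI impI, elim conjE)
    fix n and u v :: "nat \<Rightarrow> real"
    assume 1: "\<forall>i<n. a \<le> u i \<and> u i \<le> v i \<and> v i \<le> b" and 3: "(\<Sum>i<n. v i - u i) < \<epsilon>"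
    have "(\<Sum>i<n. cmod (of_real (v i) - of_real (u i))) = (\<Sum>i<n. v i - u i)"
      by (rule sum.cong) (use 1 in \<open>auto simp flip: of_real_diff\<close>)
    then show "(\<Sum>i<n. cmod (of_real (v i) - of_real (u i))) < \<epsilon>" using 3 by simp
  qed
qed

lemma AC_on_Lipschitz:
  assumes F: "AC_on a b F" and "L \<ge> 0"
    and le: "\<And>u v. a \<le> u \<Longrightarrow> u \<le> v \<Longrightarrow> v \<le> b \<Longrightarrow> norm (G v - G u) \<le> L * norm (F v - F u)"
  shows "AC_on a b G"
proof (rule AC_on_dominated[OF F F, of "L + 1"])
  fix u v assume "a \<le> u" "u \<le> v" "v \<le> b"
  from le[OF this] show "norm (G v - G u) \<le> (L + 1) * (norm (F v - F u) + norm (F v - F u))"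
  proof -
    assume le: "norm (G v - G u) \<le> L * norm (F v - F u)"
    have "L * norm (F v - F u) \<le> (L + 1) * (norm (F v - F u) + norm (F v - F u))"
      by (rule mult_mono) (use \<open>L \<ge> 0\<close> in auto)
    with le show ?thesis by simp
  qed
qed (use \<open>L \<ge> 0\<close> in simp)

lemma AC_on_mult:
  assumes "AC_on a b F" "AC_on a b G" shows "AC_on a b (\<lambda>x. F x * G x)"
proof -
  have "bounded (F ` {a..b})" "bounded (G ` {a..b})"
    by (intro compact_imp_bounded compact_continuous_image AC_on_imp_continuous_on assms compact_Icc)+
  then obtain B1 B2 where B: "B1 > 0" "\<forall>x\<in>{a..b}. norm (F x) \<le> B1" "B2 > 0" "\<forall>x\<in>{a..b}. norm (G x) \<le> B2"
    unfolding bounded_pos ball_simps by (elim exE conjE)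
  show ?thesis
  proof (rule AC_on_dominated[OF assms, of "B1 + B2"])
    fix u v assume *: "a \<le> u" "u \<le> v" "v \<le> b"
    have "F v * G v - F u * G u = F v * (G v - G u) + (F v - F u) * G u" by (simp add: algebra_simps)
    then have "norm (F v * G v - F u * G u) \<le> norm (F v) * norm (G v - G u) + norm (F v - F u) * norm (G u)"
      using norm_triangle_ineq[of "F v * (G v - G u)" "(F v - F u) * G u"] by (simp add: norm_mult)
    also have "\<dots> \<le> (B1 + B2) * norm (G v - G u) + norm (F v - F u) * (B1 + B2)"
    proof (intro add_mono mult_right_mono mult_left_mono)
      show "norm (F v) \<le> B1 + B2" "norm (G u) \<le> B1 + B2"
        using B(2)[rule_format, of v] B(4)[rule_format, of u] B(1,3) * by simp_all
    qed auto
    finally show "norm (F v * G v - F u * G u) \<le> (B1 + B2) * (norm (F v - F u) + norm (G v - G u))"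
      by (simp add: algebra_simps)
  qed (use B in simp)
qed

lemma AC_on_add:
  assumes "AC_on a b F" "AC_on a b G" shows "AC_on a b (\<lambda>x. F x + G x)"
proof (rule AC_on_dominated[OF assms, of 1])
  fix u v
  have "F v + G v - (F u + G u) = (F v - F u) + (G v - G u)" by simp
  then show "norm (F v + G v - (F u + G u)) \<le> 1 * (norm (F v - F u) + norm (G v - G u))"
    using norm_triangle_ineq[of "F v - F u" "G v - G u"] by (simp only: mult_1)
qed simp

lemma AC_on_const: "AC_on a b (\<lambda>_. c)"
  by (rule AC_on_Lipschitz[OF AC_on_of_real, of 0]) auto

lemma AC_on_cnj: "AC_on a b F \<Longrightarrow> AC_on a b (\<lambda>x. cnj (F x))"
  by (erule AC_on_Lipschitz[of _ _ _ 1]) (auto simp flip: complex_cnj_diff)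

lemma AC_on_subset:
  assumes "AC_on a b F" "a \<le> a'" "b' \<le> b"
  shows "AC_on a' b' F"
  unfolding AC_on_def
proof (intro allI impI)
  let ?P = "\<lambda>a b d e. \<forall>(n::nat) (u::nat \<Rightarrow> real) v.
      (\<forall>i<n. a \<le> u i \<and> u i \<le> v i \<and> v i \<le> b) \<and>
      (\<forall>i<n. \<forall>j<n. i \<noteq> j \<longrightarrow> v i \<le> u j \<or> v j \<le> u i) \<and>
      (\<Sum>i<n. v i - u i) < d \<longrightarrow> (\<Sum>i<n. cmod (F (v i) - F (u i))) < e"
  fix \<epsilon> :: real assume "\<epsilon> > 0"
  then have "\<exists>\<delta>>0. ?P a b \<delta> \<epsilon>"
    using assms(1) unfolding AC_on_def by (elim allE[of _ \<epsilon>] mp)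
  then obtain \<delta> where d: "\<delta> > 0" "?P a b \<delta> \<epsilon>" by (elim exE conjE)
  have "?P a' b' \<delta> \<epsilon>"
  proof (intro allI impI, elim conjE)
    fix n and u v :: "nat \<Rightarrow> real"
    assume 1: "\<forall>i<n. a' \<le> u i \<and> u i \<le> v i \<and> v i \<le> b'"
      and 2: "\<forall>i<n. \<forall>j<n. i \<noteq> j \<longrightarrow> v i \<le> u j \<or> v j \<le> u i"
      and 3: "(\<Sum>i<n. v i - u i) < \<delta>"
    have "\<forall>i<n. a \<le> u i \<and> u i \<le> v i \<and> v i \<le> b" using 1 assms(2,3) by force
    then show "(\<Sum>i<n. cmod (F (v i) - F (u i))) < \<epsilon>"
      using d(2)[rule_format, of n u v] 2 3 by simp
  qed
  with d(1) show "\<exists>\<delta>>0. ?P a' b' \<delta> \<epsilon>" by (intro exI conjI)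
qed

section \<open>Primitives of integrable functions\<close>

lemma LBINT_split_at:
  fixes g :: "real \<Rightarrow> 'a::{banach, second_countable_topology}"
  assumes "set_integrable lborel {a..b} g" "a \<le> u" "u \<le> v" "v \<le> b"
  shows "(LBINT x:{a..v}. g x) - (LBINT x:{a..u}. g x) = (LBINT x:{u<..v}. g x)"
proof -
  have "{a..v} = {a..u} \<union> {u<..v}" using assms by auto
  moreover have "(LBINT x:{a..u} \<union> {u<..v}. g x) = (LBINT x:{a..u}. g x) + (LBINT x:{u<..v}. g x)"
    by (rule set_integral_Un) (use assms in \<open>auto intro: set_integrable_subset\<close>)
  ultimately show ?thesis by simp
qed

text \<open>Dominated convergence with majorant |f|: the excess of f over height n disappears
  pointwise. This supplies the splitting into a bounded part and a part of small integral.\<close>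

lemma set_integral_truncation_tendsto_0:
  fixes f :: "real \<Rightarrow> real"
  assumes "set_integrable lborel S f"
  shows "(\<lambda>n. LBINT x:S. max 0 (f x - real n)) \<longlonglongrightarrow> 0"
proof -
  have "(\<lambda>n. \<integral>x. max 0 (indicator S x * f x - real n) \<partial>lborel) \<longlonglongrightarrow> (\<integral>x. 0 \<partial>(lborel::real measure))"
  proof (rule integral_dominated_convergence[where w="\<lambda>x. \<bar>indicator S x * f x\<bar>"])
    have i: "integrable lborel (\<lambda>x. indicator S x * f x)"
      using assms by (simp add: set_integrable_def)
    then show "integrable lborel (\<lambda>x. \<bar>indicator S x * f x\<bar>)" by simp
    show "(\<lambda>x. max 0 (indicator S x * f x - real n)) \<in> borel_measurable lborel" for n
      using i by (intro borel_measurable_max borel_measurable_diff) auto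
    show "AE x in lborel. (\<lambda>n. max 0 (indicator S x * f x - real n)) \<longlonglongrightarrow> 0"
    proof (rule AE_I2, rule tendsto_eventually)
      fix x
      obtain N :: nat where N: "indicator S x * f x \<le> real N" using real_arch_simple by blast
      show "\<forall>\<^sub>F n in sequentially. max 0 (indicator S x * f x - real n) = 0"
        using N by (auto simp: eventually_sequentially intro!: exI[of _ N])
    qed
  qed auto
  moreover have "(\<integral>x. max 0 (indicator S x * f x - real n) \<partial>lborel) = (LBINT x:S. max 0 (f x - real n))" for n
    unfolding set_lebesgue_integral_def by (rule Bochner_Integration.integral_cong) (auto simp: indicator_def)
  ultimately show ?thesis by simp
qed

text \<open>Bound |g| by \<open>M + h\<close>, where \<open>h\<close> is the excess over the height
  \<open>M\<close> and has integral below \<epsilon>/2. On disjoint intervals the bounded part costs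
  at most M times the total length, and \<open>h\<close> costs at most its whole integral, however
  many intervals there are.\<close>

lemma AC_on_primitive:
  fixes g :: "real \<Rightarrow> complex"
  assumes g: "set_integrable lborel {a..b} g"
  shows "AC_on a b (\<lambda>t. LBINT x:{a..t}. g x)"
  unfolding AC_on_def
proof (intro allI impI)
  fix \<epsilon> :: real assume "\<epsilon> > 0"
  have gn: "set_integrable lborel {a..b} (\<lambda>x. norm (g x))" using g by (rule set_integrable_norm)
  obtain M :: nat where M: "(LBINT x:{a..b}. max 0 (norm (g x) - real M)) < \<epsilon>/2"
    using order_tendstoD(2)[OF set_integral_truncation_tendsto_0[OF gn], of "\<epsilon>/2"] \<open>\<epsilon> > 0\<close>
    by (auto simp: eventually_sequentially)
  define h where "h x = max 0 (norm (g x) - real M)" for x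
  have h: "set_integrable lborel {a..b} h" unfolding h_def
  proof (rule set_integrable_bound[OF gn])
    have "(\<lambda>x. indicator {a..b} x *\<^sub>R g x) \<in> borel_measurable lborel" using g by (simp add: set_integrable_def borel_measurable_integrable)
    then have "(\<lambda>x. max 0 (norm (indicator {a..b} x *\<^sub>R g x) - real M)) \<in> borel_measurable lborel" by measurable
    also have "(\<lambda>x. max 0 (norm (indicator {a..b} x *\<^sub>R g x) - real M)) = (\<lambda>x. indicator {a..b} x *\<^sub>R max 0 (norm (g x) - real M))"
      by (auto simp: indicator_def)
    finally show "set_borel_measurable lborel {a..b} (\<lambda>x. max 0 (norm (g x) - real M))"
      by (simp add: set_borel_measurable_def)
  qed auto
  have hI: "(LBINT x:{a..b}. h x) < \<epsilon>/2" using M by (simp add: h_def)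
  \<comment> \<open>The summand 1 covers M = 0.\<close>
  define \<delta> where "\<delta> = \<epsilon> / (2 * (real M + 1))"
  have "\<delta> > 0" using \<open>\<epsilon> > 0\<close> by (simp add: \<delta>_def)
  show "\<exists>\<delta>>0. \<forall>(n::nat) (u::nat \<Rightarrow> real) v.
      (\<forall>i<n. a \<le> u i \<and> u i \<le> v i \<and> v i \<le> b) \<and>
      (\<forall>i<n. \<forall>j<n. i \<noteq> j \<longrightarrow> v i \<le> u j \<or> v j \<le> u i) \<and>
      (\<Sum>i<n. v i - u i) < \<delta> \<longrightarrow> (\<Sum>i<n. cmod ((LBINT x:{a..v i}. g x) - (LBINT x:{a..u i}. g x))) < \<epsilon>"
  proof (intro exI[of _ \<delta>] conjI allI impI \<open>\<delta> > 0\<close>, elim conjE)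
    fix n and u v :: "nat \<Rightarrow> real"
    assume 1: "\<forall>i<n. a \<le> u i \<and> u i \<le> v i \<and> v i \<le> b"
      and 2: "\<forall>i<n. \<forall>j<n. i \<noteq> j \<longrightarrow> v i \<le> u j \<or> v j \<le> u i"
      and 3: "(\<Sum>i<n. v i - u i) < \<delta>"
    have sub: "{u i<..v i} \<subseteq> {a..b}" if "i < n" for i using 1 that by auto
    have hi: "set_integrable lborel {u i<..v i} h" if "i < n" for i
      by (rule set_integrable_subset[OF h _ sub[OF that]]) simp
    have ci: "set_integrable lborel {u i<..v i} (\<lambda>x. real M)" if "i < n" for i
    proof -
      have "integrable lborel (indicat_real {u i<..v i})"
        using 1 that by (intro integrable_real_indicator) auto
      then show ?thesis unfolding set_integrable_def by (simp add: integrable_mult_left)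
    qed
    have each: "cmod ((LBINT x:{a..v i}. g x) - (LBINT x:{a..u i}. g x)) \<le> (LBINT x:{u i<..v i}. h x) + real M * (v i - u i)"
      if "i < n" for i
    proof -
      have i: "a \<le> u i" "u i \<le> v i" "v i \<le> b" using 1 that by auto
      have gi: "set_integrable lborel {u i<..v i} g" by (rule set_integrable_subset[OF g _ sub[OF that]]) simp
      have "cmod ((LBINT x:{a..v i}. g x) - (LBINT x:{a..u i}. g x)) = cmod (LBINT x:{u i<..v i}. g x)"
        using LBINT_split_at[OF g i] by simp
      also have "\<dots> \<le> (LBINT x:{u i<..v i}. norm (g x))" by (rule set_integral_norm_bound[OF gi])
      also have "\<dots> \<le> (LBINT x:{u i<..v i}. h x + real M)"
        by (rule set_integral_mono[OF set_integrable_norm[OF gi] set_integral_add(1)[OF hi[OF that] ci[OF that]]]) (simp add: h_def)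
      also have "\<dots> = (LBINT x:{u i<..v i}. h x) + (LBINT x:{u i<..v i}. real M)"
        by (rule set_integral_add(2)[OF hi[OF that] ci[OF that]])
      also have "(LBINT x:{u i<..v i}. real M) = real M * (v i - u i)"
        unfolding set_lebesgue_integral_def using i by simp
      finally show ?thesis .
    qed
    have "(\<Sum>i<n. LBINT x:{u i<..v i}. h x) = (\<integral>x. (\<Sum>i<n. indicator {u i<..v i} x * h x) \<partial>lborel)"
      unfolding set_lebesgue_integral_def
      by (subst Bochner_Integration.integral_sum) (use hi in \<open>auto simp: set_integrable_def\<close>)
    also have "\<dots> \<le> (\<integral>x. indicator {a..b} x * h x \<partial>lborel)"
    proof (rule integral_mono)
      show "integrable lborel (\<lambda>x. \<Sum>i<n. indicator {u i<..v i} x * h x)"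
        by (rule Bochner_Integration.integrable_sum) (use hi in \<open>auto simp: set_integrable_def\<close>)
      show "integrable lborel (\<lambda>x. indicator {a..b} x * h x)" using h by (simp add: set_integrable_def)
      fix x
      show "(\<Sum>i<n. indicator {u i<..v i} x * h x) \<le> indicator {a..b} x * h x"
      \<comment> \<open>Half-open intervals that meet only at endpoints are disjoint, so at most one
        indicator is nonzero at x.\<close>
      proof (cases "\<exists>i<n. x \<in> {u i<..v i}")
        case True
        then obtain i where i: "i < n" "x \<in> {u i<..v i}" by blast
        have "(\<Sum>j<n. indicator {u j<..v j} x * h x) = (\<Sum>j<n. if j = i then h x else 0)"
        proof (rule sum.cong[OF refl])
          fix j assume "j \<in> {..<n}"
          then have "x \<notin> {u j<..v j}" if "j \<noteq> i" using 2[rule_format, of i j] that i by auto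
          then show "indicator {u j<..v j} x * h x = (if j = i then h x else 0)" using i by auto
        qed
        then show ?thesis using i sub[OF i(1)] by auto
      next
        case False
        then have z: "(\<Sum>i<n. indicator {u i<..v i} x * h x) = 0" by (intro sum.neutral) auto
        show ?thesis unfolding z by (simp add: h_def)
      qed
    qed
    also have "\<dots> < \<epsilon>/2" using hI by (simp add: set_lebesgue_integral_def)
    finally have A: "(\<Sum>i<n. LBINT x:{u i<..v i}. h x) < \<epsilon>/2" .
    have "real M * (\<Sum>i<n. v i - u i) \<le> real M * \<delta>" using 3 by (intro mult_left_mono) auto
    also have "\<dots> \<le> \<epsilon>/2" using \<open>\<epsilon> > 0\<close> by (simp add: \<delta>_def field_simps)
    finally have B: "real M * (\<Sum>i<n. v i - u i) \<le> \<epsilon>/2" .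
    have "(\<Sum>i<n. cmod ((LBINT x:{a..v i}. g x) - (LBINT x:{a..u i}. g x)))
      \<le> (\<Sum>i<n. (LBINT x:{u i<..v i}. h x) + real M * (v i - u i))"
      by (rule sum_mono) (use each in auto)
    also have "\<dots> = (\<Sum>i<n. LBINT x:{u i<..v i}. h x) + real M * (\<Sum>i<n. v i - u i)"
      by (simp add: sum.distrib sum_distrib_left)
    also have "\<dots> < \<epsilon>" using A B by simp
    finally show "(\<Sum>i<n. cmod ((LBINT x:{a..v i}. g x) - (LBINT x:{a..u i}. g x))) < \<epsilon>" .
  qed
qed

text \<open>Carrying a representative \<open>F'\<close> of the almost everywhere derivative as an
  argument turns product rule, conjugation and integration into rules on pairs. \<open>F'\<close>
  may be changed on null sets, and only values inside (a, b) matter.\<close>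

definition acd :: "real \<Rightarrow> real \<Rightarrow> (real \<Rightarrow> complex) \<Rightarrow> (real \<Rightarrow> complex) \<Rightarrow> bool" where
  "acd a b F F' \<longleftrightarrow> AC_on a b F \<and>
     (AE x in lborel. a < x \<and> x < b \<longrightarrow> (F has_vector_derivative F' x) (at x))"

lemma acd_mult:
  assumes "acd a b F F'" "acd a b G G'"
  shows "acd a b (\<lambda>x. F x * G x) (\<lambda>x. F x * G' x + F' x * G x)"
proof -
  have "AE x in lborel. a < x \<and> x < b \<longrightarrow> (F has_vector_derivative F' x) (at x)"
       "AE x in lborel. a < x \<and> x < b \<longrightarrow> (G has_vector_derivative G' x) (at x)"
    using assms by (auto simp: acd_def)
  then have "AE x in lborel. a < x \<and> x < b \<longrightarrow> ((\<lambda>x. F x * G x) has_vector_derivative F x * G' x + F' x * G x) (at x)"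
    by eventually_elim (auto intro: has_vector_derivative_mult)
  then show ?thesis using assms AC_on_mult by (auto simp: acd_def)
qed

lemma acd_add:
  assumes "acd a b F F'" "acd a b G G'"
  shows "acd a b (\<lambda>x. F x + G x) (\<lambda>x. F' x + G' x)"
proof -
  have "AE x in lborel. a < x \<and> x < b \<longrightarrow> (F has_vector_derivative F' x) (at x)"
       "AE x in lborel. a < x \<and> x < b \<longrightarrow> (G has_vector_derivative G' x) (at x)"
    using assms by (auto simp: acd_def)
  then have "AE x in lborel. a < x \<and> x < b \<longrightarrow> ((\<lambda>x. F x + G x) has_vector_derivative F' x + G' x) (at x)"
    by eventually_elim (auto intro: has_vector_derivative_add)
  then show ?thesis using assms AC_on_add by (auto simp: acd_def)
qed

lemma acd_const: "acd a b (\<lambda>_. c) (\<lambda>_. 0)"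
  by (auto simp: acd_def AC_on_const)

lemma acd_of_real: "acd a b complex_of_real (\<lambda>_. 1)"
proof -
  have "(complex_of_real has_vector_derivative 1) (at x)" for x
    using has_vector_derivative_of_real[OF DERIV_ident[of "at x"]] by simp
  then show ?thesis unfolding acd_def using AC_on_of_real by simp
qed

lemma acd_cnj: "acd a b F F' \<Longrightarrow> acd a b (\<lambda>x. cnj (F x)) (\<lambda>x. cnj (F' x))"
  unfolding acd_def
  by (elim conjE, rule conjI, erule AC_on_cnj, erule eventually_mono) (blast intro: has_vector_derivative_cnj)

lemma acd_cong_AE:
  assumes "acd a b F F'" "AE x in lborel. a < x \<and> x < b \<longrightarrow> F' x = F'' x"
  shows "acd a b F F''"
proof -
  have "AE x in lborel. a < x \<and> x < b \<longrightarrow> (F has_vector_derivative F' x) (at x)"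
    using assms(1) by (simp add: acd_def)
  with assms(2) have "AE x in lborel. a < x \<and> x < b \<longrightarrow> (F has_vector_derivative F'' x) (at x)"
    by eventually_elim auto
  then show ?thesis using assms(1) by (simp add: acd_def)
qed

lemma acd_subset: "acd a b F F' \<Longrightarrow> a \<le> a' \<Longrightarrow> b' \<le> b \<Longrightarrow> acd a' b' F F'"
  unfolding acd_def
  by (elim conjE, rule conjI, erule (2) AC_on_subset, erule eventually_mono) auto

lemma acd_primitive:
  assumes g: "set_integrable lborel {a..b} g"
  shows "acd a b (\<lambda>t. LBINT x:{a..t}. g x) g"
  unfolding acd_def
proof (rule conjI[OF AC_on_primitive[OF g]])
  have gi: "g integrable_on {a..b}" by (rule set_borel_integral_eq_integral(1)[OF g])
  have eq: "(LBINT x:{a..t}. g x) = integral {a..t} g" if "t \<le> b" for t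
    by (rule set_borel_integral_eq_integral(2)) (rule set_integrable_subset[OF g], use that in auto)
  show "AE x in lborel. a < x \<and> x < b \<longrightarrow> ((\<lambda>t. LBINT x:{a..t}. g x) has_vector_derivative g x) (at x)"
    using integral_has_vector_derivative_AE[OF gi]
  proof eventually_elim
    fix x assume *: "a < x \<and> x < b \<longrightarrow> ((\<lambda>t. integral {a..t} g) has_vector_derivative g x) (at x)"
    show "a < x \<and> x < b \<longrightarrow> ((\<lambda>t. LBINT x:{a..t}. g x) has_vector_derivative g x) (at x)"
    proof
      assume x: "a < x \<and> x < b"
      show "((\<lambda>t. LBINT x:{a..t}. g x) has_vector_derivative g x) (at x)"
        by (rule has_vector_derivative_transform_within_open[of "\<lambda>t. integral {a..t} g" _ _ "{a<..<b}"])
          (use * x eq in auto)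
    qed
  qed
qed

text \<open>The gauge integral of \<open>F'\<close> is always the increment of \<open>F\<close>;
  integrability is assumed so that the Lebesgue integral exists and agrees with it.\<close>

lemma acd_LBINT:
  assumes F: "acd a b F F'" and "a \<le> b" and i: "set_integrable lborel {a..b} F'"
  shows "(LBINT x:{a..b}. F' x) = F b - F a"
proof -
  have "(F' has_integral (F b - F a)) {a..b}"
    using F \<open>a \<le> b\<close> AC_on_has_integral by (auto simp: acd_def)
  then show ?thesis using set_borel_integral_eq_integral(2)[OF i] by (simp add: integral_unique)
qed

section \<open>Linear systems with integrable coefficients\<close>

lemma set_integrable_mult_bounded:
  fixes f g :: "real \<Rightarrow> 'a::{real_normed_algebra,banach,second_countable_topology}"
  assumes g: "set_integrable lborel S g" and f: "set_borel_measurable lborel S f"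
    and B: "\<And>x. x \<in> S \<Longrightarrow> norm (f x) \<le> B"
  shows "set_integrable lborel S (\<lambda>x. g x * f x)"
  unfolding set_integrable_def
proof (rule Bochner_Integration.integrable_bound)
  show "integrable lborel (\<lambda>x. \<bar>B\<bar> * norm (indicator S x *\<^sub>R g x))"
    using g unfolding set_integrable_def by (intro integrable_mult_right integrable_norm)
  have "(\<lambda>x. (indicator S x *\<^sub>R g x) * (indicator S x *\<^sub>R f x)) \<in> borel_measurable lborel"
    using g f unfolding set_integrable_def set_borel_measurable_def
    by (intro borel_measurable_times) (auto intro: borel_measurable_integrable)
  also have "(\<lambda>x. (indicator S x *\<^sub>R g x) * (indicator S x *\<^sub>R f x)) = (\<lambda>x. indicator S x *\<^sub>R (g x * f x))"
    by (auto simp: indicator_def)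
  finally show "(\<lambda>x. indicator S x *\<^sub>R (g x * f x)) \<in> borel_measurable lborel" .
  have "norm (g x * f x) \<le> \<bar>B\<bar> * norm (g x)" if "x \<in> S" for x
  proof -
    have "norm (g x * f x) \<le> norm (g x) * norm (f x)" by (rule norm_mult_ineq)
    also have "\<dots> \<le> norm (g x) * \<bar>B\<bar>" by (rule mult_left_mono) (use B[OF that] in auto)
    finally show ?thesis by (simp add: mult.commute)
  qed
  then show "AE x in lborel. norm (indicator S x *\<^sub>R (g x * f x)) \<le> norm (\<bar>B\<bar> * norm (indicator S x *\<^sub>R g x))"
    by (intro AE_I2) (auto simp: indicator_def abs_mult)
qed

lemma set_integrable_mult_continuous:
  fixes f g :: "real \<Rightarrow> 'a::{real_normed_algebra,banach,second_countable_topology}"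
  assumes g: "set_integrable lborel {a..b} g" and f: "continuous_on {a..b} f"
  shows "set_integrable lborel {a..b} (\<lambda>x. g x * f x)"
proof -
  have "bounded (f ` {a..b})" by (intro compact_imp_bounded compact_continuous_image f compact_Icc)
  then obtain B where B: "\<forall>x\<in>{a..b}. norm (f x) \<le> B" unfolding bounded_iff by auto
  have "set_borel_measurable lborel {a..b} f"
    using set_measurable_continuous_on[OF _ f] by (simp add: set_borel_measurable_def)
  then show ?thesis by (rule set_integrable_mult_bounded[OF g _ B[rule_format]])
qed

text \<open>The type of bounded continuous functions lives on the whole real line, so functions on
  the half line are extended by their value at 0 to the left.\<close>

lemma continuous_on_comp_max_0:
  fixes f :: "real \<Rightarrow> 'a::topological_space"
  assumes f: "\<And>b. b \<ge> 0 \<Longrightarrow> continuous_on {0..b} f"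
  shows "continuous_on UNIV (\<lambda>x. f (max 0 x))"
proof (rule continuous_at_imp_continuous_on, intro ballI)
  fix x :: real
  have "continuous_on {- (\<bar>x\<bar> + 1)..\<bar>x\<bar> + 1} (\<lambda>y. f (max 0 y))"
    by (rule continuous_on_compose2[OF f[of "\<bar>x\<bar> + 1"]]) (auto intro!: continuous_intros)
  then show "isCont (\<lambda>x. f (max 0 x)) x"
    by (rule continuous_on_interior) auto
qed

lemma continuous_on_primitive:
  fixes g :: "real \<Rightarrow> complex"
  assumes "set_integrable lborel {a..b} g"
  shows "continuous_on {a..b} (\<lambda>t. LBINT x:{a..t}. g x)"
  by (rule AC_on_imp_continuous_on[OF AC_on_primitive[OF assms]])

lemma continuous_on_primitive_real:
  fixes g :: "real \<Rightarrow> real"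
  assumes "set_integrable lborel {a..b} g"
  shows "continuous_on {a..b} (\<lambda>t. LBINT x:{a..t}. g x)"
proof -
  have "set_integrable lborel {a..b} (\<lambda>x. complex_of_real (g x))"
    using assms unfolding set_integrable_def by (simp add: scaleR_conv_of_real flip: of_real_mult)
  from continuous_on_Re[OF continuous_on_primitive[OF this]] show ?thesis
    by (simp add: set_integral_complex_of_real)
qed

text \<open>By the chain rule exp (2 Q) is absolutely continuous with derivative 2 m exp (2 Q), and
  the fundamental theorem applies. The factor 2 in the exponent is what later gives the contraction
  constant 1/2. The detour through complex values is due to \<open>acd\<close>.\<close>

lemma LBINT_exp_primitive:
  fixes m :: "real \<Rightarrow> real"
  assumes m: "set_integrable lborel {0..b} m" and "0 \<le> b" and pos: "\<And>x. m x \<ge> 0"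
  defines "Q \<equiv> \<lambda>t. LBINT x:{0..t}. m x"
  shows "(LBINT t:{0..b}. m t * exp (2 * Q t)) = (exp (2 * Q b) - 1) / 2"
proof -
  define mc where "mc x = complex_of_real (m x)" for x
  have mc: "set_integrable lborel {0..b} mc"
    using m unfolding set_integrable_def mc_def by (simp add: scaleR_conv_of_real flip: of_real_mult)
  have Qc: "complex_of_real (Q t) = (LBINT x:{0..t}. mc x)" for t
    unfolding Q_def mc_def by (rule set_integral_complex_of_real[symmetric])
  have cQ: "continuous_on {0..b} Q" unfolding Q_def by (rule continuous_on_primitive_real[OF m])
  have acdQ: "acd 0 b (\<lambda>t. complex_of_real (Q t)) mc" unfolding Qc by (rule acd_primitive[OF mc])
  define E where "E t = complex_of_real (exp (2 * Q t))" for t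
  have Qmono: "Q u \<le> Q v" if "0 \<le> u" "u \<le> v" "v \<le> b" for u v
  proof -
    have "Q v - Q u = (LBINT x:{u<..v}. m x)" unfolding Q_def by (rule LBINT_split_at[OF m that])
    also have "\<dots> \<ge> 0" unfolding set_lebesgue_integral_def by (rule Bochner_Integration.integral_nonneg) (use pos in auto)
    finally show ?thesis by simp
  qed
  have "acd 0 b E (\<lambda>t. 2 * mc t * E t)"
    unfolding acd_def
  proof
    show "AC_on 0 b E"
    \<comment> \<open>\<open>Q\<close> is nondecreasing, so its values stay below
      \<open>Q b\<close>, where exp (2 x) has Lipschitz constant 2 exp (2 Q b).\<close>
    proof (rule AC_on_Lipschitz[of 0 b "\<lambda>t. complex_of_real (Q t)" "2 * exp (2 * Q b)"])
      show "AC_on 0 b (\<lambda>t. complex_of_real (Q t))" using acdQ by (simp add: acd_def)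
      fix u v assume uv: "0 \<le> u" "u \<le> v" "v \<le> b"
      have le: "Q u \<le> Q v" "Q v \<le> Q b" using Qmono uv by auto
      have "exp (2 * Q v) - exp (2 * Q u) \<le> exp (2 * Q v) * (2 * Q v - 2 * Q u)"
      proof -
        have "1 - (2 * Q v - 2 * Q u) \<le> exp (- (2 * Q v - 2 * Q u))" using exp_ge_add_one_self[of "- (2 * Q v - 2 * Q u)"] by linarith
        then have "exp (2 * Q v) * (1 - (2 * Q v - 2 * Q u)) \<le> exp (2 * Q v) * exp (- (2 * Q v - 2 * Q u))" by (intro mult_left_mono) auto
        also have "\<dots> = exp (2 * Q u)" by (simp flip: exp_add)
        finally show ?thesis by (simp add: algebra_simps)
      qed
      also have "\<dots> \<le> exp (2 * Q b) * (2 * Q v - 2 * Q u)" using le by (intro mult_right_mono) auto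
      finally have "exp (2 * Q v) - exp (2 * Q u) \<le> 2 * exp (2 * Q b) * (Q v - Q u)" by (simp add: algebra_simps)
      moreover have "norm (E v - E u) = exp (2 * Q v) - exp (2 * Q u)"
        unfolding E_def of_real_diff[symmetric] norm_of_real using le by simp
      moreover have "norm (complex_of_real (Q v) - complex_of_real (Q u)) = Q v - Q u"
        unfolding of_real_diff[symmetric] norm_of_real using le by simp
      ultimately show "norm (E v - E u) \<le> 2 * exp (2 * Q b) * norm (complex_of_real (Q v) - complex_of_real (Q u))"
        by simp
    qed simp
    have "AE x in lborel. 0 < x \<and> x < b \<longrightarrow> ((\<lambda>t. complex_of_real (Q t)) has_vector_derivative mc x) (at x)"
      using acdQ by (simp add: acd_def)
    then show "AE x in lborel. 0 < x \<and> x < b \<longrightarrow> (E has_vector_derivative 2 * mc x * E x) (at x)"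
    proof (rule eventually_mono, intro impI)
      fix x assume "0 < x \<and> x < b \<longrightarrow> ((\<lambda>t. complex_of_real (Q t)) has_vector_derivative mc x) (at x)" "0 < x \<and> x < b"
      then have d: "((\<lambda>t. complex_of_real (Q t)) has_vector_derivative mc x) (at x)" by simp
      have "((\<lambda>z. exp (2 * z)) has_field_derivative (2 * exp (2 * complex_of_real (Q x)))) (at (complex_of_real (Q x)))"
        by (auto intro!: derivative_eq_intros)
      from field_vector_diff_chain_at[OF d this]
      show "(E has_vector_derivative 2 * mc x * E x) (at x)"
        unfolding E_def exp_of_real[symmetric] of_real_mult of_real_numeral by (simp add: o_def mult_ac)
    qed
  qed
  moreover have "set_integrable lborel {0..b} (\<lambda>t. 2 * mc t * E t)"
    by (intro set_integrable_mult_continuous set_integrable_mult_right mc)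
       (auto intro!: continuous_intros cQ simp: E_def)
  ultimately have "(LBINT t:{0..b}. 2 * mc t * E t) = E b - E 0"
    by (intro acd_LBINT \<open>0 \<le> b\<close>)
  moreover have "(LBINT t:{0..b}. 2 * mc t * E t) = complex_of_real (LBINT t:{0..b}. 2 * (m t * exp (2 * Q t)))"
    unfolding set_integral_complex_of_real[symmetric] by (simp add: mc_def E_def mult.assoc)
  moreover have "Q 0 = 0" unfolding Q_def set_lebesgue_integral_def
  proof (rule integral_eq_zero_AE)
    have "AE x in lborel. x \<noteq> (0::real)" by (rule AE_lborel_singleton)
    then show "AE x in lborel. indicat_real {0..0} x *\<^sub>R m x = 0" by eventually_elim auto
  qed
  ultimately have "complex_of_real (LBINT t:{0..b}. 2 * (m t * exp (2 * Q t))) = complex_of_real (exp (2 * Q b) - 1)"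
    by (simp add: E_def)
  then have "(LBINT t:{0..b}. 2 * (m t * exp (2 * Q t))) = exp (2 * Q b) - 1"
    by (simp only: of_real_eq_iff)
  then show ?thesis by (simp add: Q_def)
qed


lemma norm_LBINT_le:
  fixes f :: "real \<Rightarrow> 'a::{banach, second_countable_topology}"
  assumes f: "set_integrable lborel S f" and g: "set_integrable lborel S g"
    and le: "\<And>x. x \<in> S \<Longrightarrow> norm (f x) \<le> g x"
  shows "norm (LBINT x:S. f x) \<le> (LBINT x:S. g x)"
proof -
  have "norm (LBINT x:S. f x) \<le> (LBINT x:S. norm (f x))" by (rule set_integral_norm_bound[OF f])
  also have "\<dots> \<le> (LBINT x:S. g x)" by (rule set_integral_mono[OF set_integrable_norm[OF f] g le])
  finally show ?thesis .
qed

text \<open>Keeps the inhomogeneity bounded in the weighted norm: the integral of |F| is at most Q,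
  and the weight divides it by exp (2 Q).\<close>

lemma mult_exp_minus_2_le_1: "(x::real) * exp (- 2 * x) \<le> 1"
proof (cases "x \<ge> 0")
  case True
  have "x \<le> exp (2 * x)" using exp_ge_add_one_self[of "2 * x"] True by linarith
  then have "x * exp (- 2 * x) \<le> exp (2 * x) * exp (- 2 * x)" by (intro mult_right_mono) auto
  also have "\<dots> = 1" by (simp flip: exp_add)
  finally show ?thesis .
next
  case False
  then have "x * exp (- 2 * x) \<le> 0" by (simp add: mult_nonpos_nonneg)
  then show ?thesis by simp
qed

text \<open>In the weighted sup norm with weight exp (2 Q), where Q is the primitive of the sum of the
  moduli of the coefficients, the Volterra operator of the system is a contraction with factor 1/2
  on the whole half line.\<close>
lemma linear_system_exists:
  fixes r p F :: "real \<Rightarrow> complex" and c0 c1 :: complex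
  assumes r: "L1_loc_Rp r" and p: "L1_loc_Rp p" and F: "L1_loc_Rp F"
  defines "Q \<equiv> \<lambda>x. LBINT t:{0..x}. norm (r t) + norm (p t) + norm (F t)"
  shows "\<exists>u v. (\<forall>b\<ge>0. acd 0 b u (\<lambda>x. r x * v x) \<and> acd 0 b v (\<lambda>x. p x * u x + F x)) \<and> u 0 = c0 \<and> v 0 = c1 \<and>
     ((\<forall>x. F x = 0) \<longrightarrow> (\<forall>x\<ge>0. norm (u x) \<le> 2 * (norm c0 + norm c1) * exp (2 * Q x) \<and>
        norm (v x) \<le> 2 * (norm c0 + norm c1) * exp (2 * Q x)))"
proof -
  \<comment> \<open>Including |F| in the weight makes the fixed point operator map into bounded
    functions without any decay assumption on F.\<close>
  define m where "m x = norm (r x) + norm (p x) + norm (F x)" for x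
  have ri: "set_integrable lborel {0..b} r" for b
    using r by (cases "b \<ge> 0") (auto simp: L1_loc_Rp_def)
  have pi: "set_integrable lborel {0..b} p" for b
    using p by (cases "b \<ge> 0") (auto simp: L1_loc_Rp_def)
  have Fi: "set_integrable lborel {0..b} F" for b
    using F by (cases "b \<ge> 0") (auto simp: L1_loc_Rp_def)
  have mi: "set_integrable lborel {0..b} m" for b
    unfolding m_def by (intro set_integral_add set_integrable_norm ri pi Fi)
  have Qm: "Q x = (LBINT t:{0..x}. m t)" for x by (simp add: Q_def m_def)
  have m0: "m x \<ge> 0" for x by (simp add: m_def)
  have Q0: "Q x \<ge> 0" for x unfolding Qm set_lebesgue_integral_def
    by (rule Bochner_Integration.integral_nonneg) (simp add: m0)
  define W where "W x = exp (2 * Q x)" for x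
  have W1: "W x \<ge> 1" for x using Q0[of x] by (simp add: W_def)
  have Wpos: "W x > 0" for x by (simp add: W_def)
  have cQ: "continuous_on {0..b} Q" for b unfolding Qm by (rule continuous_on_primitive_real[OF mi])
  have cW: "continuous_on {0..b} W" for b unfolding W_def by (intro continuous_intros cQ)
  have mW: "(LBINT t:{0..b}. m t * W t) = (W b - 1) / 2" if "b \<ge> 0" for b
    unfolding W_def Qm by (rule LBINT_exp_primitive[OF mi that m0])
  have mWi: "set_integrable lborel {0..b} (\<lambda>t. m t * W t)" for b
    by (rule set_integrable_mult_continuous[OF mi cW])
  \<comment> \<open>The unknown \<zeta> is the pair (u / W, v / W), so the sup norm of \<zeta> is
    the weighted norm of (u, v). \<open>fu\<close> and \<open>fv\<close> are the unknown parts of u'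
    = r v and v' = p u + F.\<close>
  define fu where "fu \<zeta> t = r t * (of_real (W t) * snd (apply_bcontfun \<zeta> t))" for \<zeta> :: "real \<Rightarrow>\<^sub>C (complex \<times> complex)" and t
  define fv where "fv \<zeta> t = p t * (of_real (W t) * fst (apply_bcontfun \<zeta> t))" for \<zeta> :: "real \<Rightarrow>\<^sub>C (complex \<times> complex)" and t
  have c\<zeta>: "continuous_on S (apply_bcontfun \<zeta>)" for \<zeta> :: "real \<Rightarrow>\<^sub>C (complex \<times> complex)" and S
    by (rule continuous_on_apply_bcontfun)
  have fui: "set_integrable lborel {0..b} (fu \<zeta>)" for \<zeta> b unfolding fu_def
    by (rule set_integrable_mult_continuous[OF ri]) (intro continuous_intros cW c\<zeta>)
  have fvi: "set_integrable lborel {0..b} (fv \<zeta>)" for \<zeta> b unfolding fv_def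
    by (rule set_integrable_mult_continuous[OF pi]) (intro continuous_intros cW c\<zeta>)
  define G where "G \<zeta> x = (of_real (inverse (W x)) * (c0 + (LBINT t:{0..x}. fu \<zeta> t)),
       of_real (inverse (W x)) * (c1 + (LBINT t:{0..x}. fv \<zeta> t + F t)))" for \<zeta> x
  have cG: "continuous_on UNIV (\<lambda>x. G \<zeta> (max 0 x))" for \<zeta>
  proof (rule continuous_on_comp_max_0)
    fix b :: real
    have "W x \<noteq> 0" for x using Wpos[of x] by simp
    then show "continuous_on {0..b} (G \<zeta>)" unfolding G_def
      by (intro continuous_intros cW continuous_on_primitive fui set_integral_add(1) fvi Fi) auto
  qed
  have nfst: "norm (fst z) \<le> norm z" and nsnd: "norm (snd z) \<le> norm z" for z :: "complex \<times> complex"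
    using norm_fst_le[of "fst z" "snd z"] norm_snd_le[of "snd z" "fst z"] by simp_all
  have diff: "norm (fu \<zeta> t) \<le> norm (r t) * W t * norm (apply_bcontfun \<zeta> t)"
     "norm (fv \<zeta> t) \<le> norm (p t) * W t * norm (apply_bcontfun \<zeta> t)" for \<zeta> t
    using nfst[of "apply_bcontfun \<zeta> t"] nsnd[of "apply_bcontfun \<zeta> t"] Wpos[of t]
    by (auto simp: fu_def fv_def norm_mult mult.assoc intro!: mult_left_mono)
  have intb: "norm (LBINT t:{0..x}. fu \<zeta> t) + norm (LBINT t:{0..x}. fv \<zeta> t) \<le> norm \<zeta> * (W x / 2)"
    if "x \<ge> 0" for \<zeta> x
  proof -
    have i1: "set_integrable lborel {0..x} (\<lambda>t. norm \<zeta> * (norm (r t) * W t))"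
      by (intro set_integrable_mult_right set_integrable_mult_continuous set_integrable_norm ri cW)
    have i2: "set_integrable lborel {0..x} (\<lambda>t. norm \<zeta> * (norm (p t) * W t))"
      by (intro set_integrable_mult_right set_integrable_mult_continuous set_integrable_norm pi cW)
    have n\<zeta>: "norm (apply_bcontfun \<zeta> t) \<le> norm \<zeta>" for t by (rule norm_bounded)
    have b1: "norm (LBINT t:{0..x}. fu \<zeta> t) \<le> (LBINT t:{0..x}. norm \<zeta> * (norm (r t) * W t))"
    proof (rule norm_LBINT_le[OF fui i1])
      fix t
      have "norm (r t) * W t * norm (apply_bcontfun \<zeta> t) \<le> norm (r t) * W t * norm \<zeta>"
        using n\<zeta> Wpos[of t] by (intro mult_left_mono) auto
      then show "norm (fu \<zeta> t) \<le> norm \<zeta> * (norm (r t) * W t)" using diff(1)[of \<zeta> t] by (simp add: mult_ac)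
    qed
    have b2: "norm (LBINT t:{0..x}. fv \<zeta> t) \<le> (LBINT t:{0..x}. norm \<zeta> * (norm (p t) * W t))"
    proof (rule norm_LBINT_le[OF fvi i2])
      fix t
      have "norm (p t) * W t * norm (apply_bcontfun \<zeta> t) \<le> norm (p t) * W t * norm \<zeta>"
        using n\<zeta> Wpos[of t] by (intro mult_left_mono) auto
      then show "norm (fv \<zeta> t) \<le> norm \<zeta> * (norm (p t) * W t)" using diff(2)[of \<zeta> t] by (simp add: mult_ac)
    qed
    have "norm (LBINT t:{0..x}. fu \<zeta> t) + norm (LBINT t:{0..x}. fv \<zeta> t)
        \<le> (LBINT t:{0..x}. norm \<zeta> * (norm (r t) * W t) + norm \<zeta> * (norm (p t) * W t))"
      using b1 b2 set_integral_add(2)[OF i1 i2] by simp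
    also have "\<dots> \<le> (LBINT t:{0..x}. norm \<zeta> * (m t * W t))"
    proof (rule set_integral_mono[OF set_integral_add(1)[OF i1 i2] set_integrable_mult_right[OF mWi]])
      fix t
      have "norm \<zeta> * (norm (r t) * W t) + norm \<zeta> * (norm (p t) * W t) = norm \<zeta> * ((norm (r t) + norm (p t)) * W t)"
        by (simp add: algebra_simps)
      also have "\<dots> \<le> norm \<zeta> * (m t * W t)"
        using Wpos[of t] by (intro mult_left_mono mult_right_mono) (auto simp: m_def)
      finally show "norm \<zeta> * (norm (r t) * W t) + norm \<zeta> * (norm (p t) * W t) \<le> norm \<zeta> * (m t * W t)" .
    qed
    also have "\<dots> = norm \<zeta> * ((W x - 1) / 2)" using mW[OF that] by simp
    also have "\<dots> \<le> norm \<zeta> * (W x / 2)" by (intro mult_left_mono) auto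
    finally show ?thesis .
  qed
  have Fb: "norm (LBINT t:{0..x}. F t) \<le> Q x" for x unfolding Qm
    by (rule norm_LBINT_le[OF Fi mi]) (simp add: m_def)
  have Gb: "norm (G \<zeta> x) \<le> norm c0 + norm c1 + 1 + norm \<zeta> / 2" if "x \<ge> 0" for \<zeta> x
  proof -
    have iW: "inverse (W x) > 0" "inverse (W x) \<le> 1" using Wpos[of x] W1[of x] by (auto simp: inverse_le_1_iff)
    have "norm (G \<zeta> x) \<le> inverse (W x) * norm (c0 + (LBINT t:{0..x}. fu \<zeta> t)) + inverse (W x) * norm (c1 + (LBINT t:{0..x}. fv \<zeta> t + F t))"
      unfolding G_def using norm_Pair_le[of "of_real (inverse (W x)) * (c0 + (LBINT t:{0..x}. fu \<zeta> t))" "of_real (inverse (W x)) * (c1 + (LBINT t:{0..x}. fv \<zeta> t + F t))"] iW(1)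
      by (simp only: norm_mult norm_of_real abs_of_pos)
    also have "\<dots> = inverse (W x) * (norm (c0 + (LBINT t:{0..x}. fu \<zeta> t)) + norm (c1 + (LBINT t:{0..x}. fv \<zeta> t + F t)))"
      by (simp add: algebra_simps)
    also have "\<dots> \<le> inverse (W x) * ((norm c0 + norm c1) + norm \<zeta> * (W x / 2) + Q x)"
    proof (rule mult_left_mono)
      have "norm (c0 + (LBINT t:{0..x}. fu \<zeta> t)) \<le> norm c0 + norm (LBINT t:{0..x}. fu \<zeta> t)" by (rule norm_triangle_ineq)
      moreover have "norm (c1 + (LBINT t:{0..x}. fv \<zeta> t + F t)) \<le> norm c1 + (norm (LBINT t:{0..x}. fv \<zeta> t) + norm (LBINT t:{0..x}. F t))"
        unfolding set_integral_add(2)[OF fvi Fi]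
        by (intro order_trans[OF norm_triangle_ineq] add_left_mono norm_triangle_ineq)
      ultimately show "norm (c0 + (LBINT t:{0..x}. fu \<zeta> t)) + norm (c1 + (LBINT t:{0..x}. fv \<zeta> t + F t)) \<le> (norm c0 + norm c1) + norm \<zeta> * (W x / 2) + Q x"
        using intb[OF that, of \<zeta>] Fb[of x] by linarith
    qed (use iW in simp)
    also have "\<dots> = inverse (W x) * (norm c0 + norm c1) + norm \<zeta> / 2 + Q x * exp (- 2 * Q x)"
      using Wpos[of x] by (simp add: field_simps W_def exp_minus)
    also have "\<dots> \<le> 1 * (norm c0 + norm c1) + norm \<zeta> / 2 + 1"
      using iW mult_exp_minus_2_le_1[of "Q x"] by (intro add_mono mult_right_mono) auto
    finally show ?thesis by simp
  qed
  have Gbc: "(\<lambda>x. G \<zeta> (max 0 x)) \<in> bcontfun" for \<zeta>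
    unfolding bcontfun_def using cG[of \<zeta>] Gb[of "max 0 _" \<zeta>] by (auto simp: bounded_iff)
  define T where "T \<zeta> = Bcontfun (\<lambda>x. G \<zeta> (max 0 x))" for \<zeta>
  have T: "apply_bcontfun (T \<zeta>) x = G \<zeta> (max 0 x)" for \<zeta> x
    unfolding T_def using Gbc by (simp add: Bcontfun_inverse)
  have fu_diff: "fu \<zeta> t - fu \<xi> t = fu (\<zeta> - \<xi>) t" and fv_diff: "fv \<zeta> t - fv \<xi> t = fv (\<zeta> - \<xi>) t" for \<zeta> \<xi> t
    by (auto simp: fu_def fv_def algebra_simps)
  have "dist (T \<zeta>) (T \<xi>) \<le> 1/2 * dist \<zeta> \<xi>" for \<zeta> \<xi>
  proof (rule dist_bound)
    fix x :: real
    define x' where "x' = max 0 x"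
    have x': "x' \<ge> 0" by (simp add: x'_def)
    have "G \<zeta> x' - G \<xi> x' = (of_real (inverse (W x')) * (LBINT t:{0..x'}. fu (\<zeta> - \<xi>) t), of_real (inverse (W x')) * (LBINT t:{0..x'}. fv (\<zeta> - \<xi>) t))"
      unfolding G_def set_integral_add(2)[OF fvi Fi] fu_diff[symmetric] fv_diff[symmetric]
        set_integral_diff(2)[OF fui fui] set_integral_diff(2)[OF fvi fvi] by (simp add: algebra_simps)
    then have "norm (G \<zeta> x' - G \<xi> x') \<le> norm (of_real (inverse (W x')) * (LBINT t:{0..x'}. fu (\<zeta> - \<xi>) t)) + norm (of_real (inverse (W x')) * (LBINT t:{0..x'}. fv (\<zeta> - \<xi>) t))"
      by (simp only: norm_Pair_le)
    also have "\<dots> = inverse (W x') * (norm (LBINT t:{0..x'}. fu (\<zeta> - \<xi>) t) + norm (LBINT t:{0..x'}. fv (\<zeta> - \<xi>) t))"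
      using Wpos[of x'] by (simp add: norm_mult algebra_simps norm_inverse)
    also have "\<dots> \<le> inverse (W x') * (norm (\<zeta> - \<xi>) * (W x' / 2))"
      using Wpos[of x'] intb[OF x', of "\<zeta> - \<xi>"] by (intro mult_left_mono) auto
    also have "\<dots> = 1/2 * dist \<zeta> \<xi>" using Wpos[of x'] by (simp add: dist_norm)
    finally show "dist (apply_bcontfun (T \<zeta>) x) (apply_bcontfun (T \<xi>) x) \<le> 1/2 * dist \<zeta> \<xi>"
      by (simp only: T x'_def dist_norm)
  qed
  then have contr: "\<forall>\<zeta> \<xi>. dist (T \<zeta>) (T \<xi>) \<le> 1/2 * dist \<zeta> \<xi>" by blast
  have "\<exists>!\<zeta>. T \<zeta> = \<zeta>" by (rule banach_fix_type[OF _ _ contr]) auto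
  then obtain \<zeta> where \<zeta>: "T \<zeta> = \<zeta>" by blast
  define u where "u x = c0 + (LBINT t:{0..x}. fu \<zeta> t)" for x
  define v where "v x = c1 + (LBINT t:{0..x}. fv \<zeta> t + F t)" for x
  have uv: "u x = of_real (W x) * fst (apply_bcontfun \<zeta> x)" "v x = of_real (W x) * snd (apply_bcontfun \<zeta> x)" if "x \<ge> 0" for x
  proof -
    have "apply_bcontfun \<zeta> x = G \<zeta> x" using T[of \<zeta> x] \<zeta> that by (simp add: max_def)
    then show "u x = of_real (W x) * fst (apply_bcontfun \<zeta> x)" "v x = of_real (W x) * snd (apply_bcontfun \<zeta> x)"
      using Wpos[of x] by (auto simp: G_def u_def v_def)
  qed
  have zero: "(LBINT t:{0..0::real}. f t) = 0" for f :: "real \<Rightarrow> complex"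
    unfolding set_lebesgue_integral_def
  proof (rule integral_eq_zero_AE)
    have "AE x in lborel. x \<noteq> (0::real)" by (rule AE_lborel_singleton)
    then show "AE x in lborel. indicat_real {0..0} x *\<^sub>R f x = 0" by eventually_elim auto
  qed
  have acdu: "acd 0 b u (\<lambda>x. r x * v x)" for b
  proof (rule acd_cong_AE)
    show "acd 0 b u (\<lambda>x. 0 + fu \<zeta> x)" unfolding u_def by (intro acd_add acd_const acd_primitive fui)
  qed (auto intro!: AE_I2 simp: fu_def uv)
  have acdv: "acd 0 b v (\<lambda>x. p x * u x + F x)" for b
  proof (rule acd_cong_AE)
    show "acd 0 b v (\<lambda>x. 0 + (fv \<zeta> x + F x))" unfolding v_def by (intro acd_add acd_const acd_primitive set_integral_add(1) fvi Fi)
  qed (auto intro!: AE_I2 simp: fv_def uv)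
  have init: "u 0 = c0" "v 0 = c1" by (simp_all add: u_def v_def zero[simplified])
  \<comment> \<open>The Gronwall bound comes out of the contraction: with F = 0, \<open>T 0\<close>
    has norm at most |c0| + |c1|, and the fixed point has norm at most twice that of
    \<open>T 0\<close>.\<close>
  have bound: "norm (u x) \<le> 2 * (norm c0 + norm c1) * exp (2 * Q x) \<and> norm (v x) \<le> 2 * (norm c0 + norm c1) * exp (2 * Q x)"
    if F0: "\<forall>x. F x = 0" and x: "x \<ge> 0" for x
  proof -
    have "norm (apply_bcontfun (T 0) x) \<le> norm c0 + norm c1" for x
    proof -
      have iW: "inverse (W y) > 0" "inverse (W y) \<le> 1" for y using Wpos[of y] W1[of y] by (auto simp: inverse_le_1_iff)
      have "apply_bcontfun (T 0) x = (of_real (inverse (W (max 0 x))) * c0, of_real (inverse (W (max 0 x))) * c1)"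
        using F0 by (simp add: T G_def fu_def fv_def)
      also have "norm \<dots> \<le> inverse (W (max 0 x)) * norm c0 + inverse (W (max 0 x)) * norm c1"
        using norm_Pair_le[of "of_real (inverse (W (max 0 x))) * c0" "of_real (inverse (W (max 0 x))) * c1"] iW(1)[of "max 0 x"]
        by (simp only: norm_mult norm_of_real abs_of_pos)
      also have "\<dots> \<le> 1 * norm c0 + 1 * norm c1" using iW by (intro add_mono mult_right_mono) auto
      finally show ?thesis by simp
    qed
    then have "norm (T 0) \<le> norm c0 + norm c1" by (rule norm_bound)
    moreover have "norm \<zeta> \<le> norm (T 0) + dist (T \<zeta>) (T 0)"
      using \<zeta> norm_triangle_sub[of \<zeta> "T 0"] by (simp add: dist_norm)
    moreover have "dist (T \<zeta>) (T 0) \<le> 1/2 * norm \<zeta>" using contr[rule_format, of \<zeta> 0] by simp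
    ultimately have n: "norm \<zeta> \<le> 2 * (norm c0 + norm c1)" by simp
    have "norm (fst (apply_bcontfun \<zeta> x)) \<le> norm \<zeta>" "norm (snd (apply_bcontfun \<zeta> x)) \<le> norm \<zeta>"
      using norm_bounded[of \<zeta> x] nfst[of "apply_bcontfun \<zeta> x"] nsnd[of "apply_bcontfun \<zeta> x"] by auto
    then have "norm (u x) \<le> W x * (2 * (norm c0 + norm c1))" "norm (v x) \<le> W x * (2 * (norm c0 + norm c1))"
      using n Wpos[of x] by (auto simp: uv[OF x] norm_mult intro!: mult_left_mono)
    then show ?thesis by (simp add: W_def mult.commute)
  qed
  show ?thesis using acdu acdv init bound by blast
qed

section \<open>The operator graph\<close>

lemma set_borel_measurable_mult:
  fixes f g :: "real \<Rightarrow> complex"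
  assumes "set_borel_measurable lborel S f" "set_borel_measurable lborel S g"
  shows "set_borel_measurable lborel S (\<lambda>x. f x * g x)"
proof -
  have "(\<lambda>x. (indicator S x *\<^sub>R f x) * (indicator S x *\<^sub>R g x)) \<in> borel_measurable lborel"
    using assms unfolding set_borel_measurable_def by (rule borel_measurable_times)
  also have "(\<lambda>x. (indicator S x *\<^sub>R f x) * (indicator S x *\<^sub>R g x)) = (\<lambda>x. indicator S x *\<^sub>R (f x * g x))"
    by (auto simp: indicator_def)
  finally show ?thesis by (simp add: set_borel_measurable_def)
qed

lemma set_borel_measurable_add:
  fixes f g :: "real \<Rightarrow> complex"
  assumes "set_borel_measurable lborel S f" "set_borel_measurable lborel S g"
  shows "set_borel_measurable lborel S (\<lambda>x. f x + g x)"
  using borel_measurable_add[OF assms[unfolded set_borel_measurable_def]]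
  by (simp add: set_borel_measurable_def scaleR_add_right)

lemma set_borel_measurable_const_mult:
  fixes f :: "real \<Rightarrow> complex"
  assumes "set_borel_measurable lborel S f"
  shows "set_borel_measurable lborel S (\<lambda>x. c * f x)"
  using borel_measurable_times[OF borel_measurable_const assms[unfolded set_borel_measurable_def], of c]
  by (simp add: set_borel_measurable_def)

lemma set_borel_measurable_norm_power2:
  fixes f :: "real \<Rightarrow> complex"
  assumes "set_borel_measurable lborel S f"
  shows "set_borel_measurable lborel S (\<lambda>x. (cmod (f x))\<^sup>2)"
proof -
  have "(\<lambda>x. (cmod (indicator S x *\<^sub>R f x))\<^sup>2) \<in> borel_measurable lborel"
    using assms unfolding set_borel_measurable_def by measurable
  also have "(\<lambda>x. (cmod (indicator S x *\<^sub>R f x))\<^sup>2) = (\<lambda>x. indicator S x *\<^sub>R (cmod (f x))\<^sup>2)"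
    by (auto simp: indicator_def)
  finally show ?thesis by (simp add: set_borel_measurable_def)
qed

lemma continuous_imp_set_borel_measurable:
  fixes f :: "real \<Rightarrow> 'a::{second_countable_topology, real_normed_vector}"
  shows "continuous_on S f \<Longrightarrow> S \<in> sets borel \<Longrightarrow> set_borel_measurable lborel S f"
  using set_measurable_continuous_on by (simp add: set_borel_measurable_def)

lemma norm_add_power2_le: "(norm (a + b))\<^sup>2 \<le> 2 * (norm a)\<^sup>2 + 2 * (norm b)\<^sup>2"
  for a b :: "'a::real_normed_vector"
proof -
  have "(norm (a + b))\<^sup>2 \<le> (norm a + norm b)\<^sup>2" by (rule power_mono[OF norm_triangle_ineq]) simp
  also have "\<dots> \<le> 2 * (norm a)\<^sup>2 + 2 * (norm b)\<^sup>2"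
    using zero_le_power2[of "norm a - norm b"] by (simp add: power2_sum power2_diff)
  finally show ?thesis .
qed

lemma L2_Rp_add:
  assumes "L2_Rp f" "L2_Rp g" shows "L2_Rp (\<lambda>x. f x + g x)"
proof -
  have m: "set_borel_measurable lborel {0..} (\<lambda>x. f x + g x)"
    using assms by (intro set_borel_measurable_add) (auto simp: L2_Rp_def)
  have "set_integrable lborel {0..} (\<lambda>x. 2 * (cmod (f x))\<^sup>2 + 2 * (cmod (g x))\<^sup>2)"
    using assms by (intro set_integral_add(1) set_integrable_mult_right) (auto simp: L2_Rp_def)
  then have "set_integrable lborel {0..} (\<lambda>x. (cmod (f x + g x))\<^sup>2)"
    by (rule set_integrable_bound[OF _ set_borel_measurable_norm_power2[OF m]])
       (use norm_add_power2_le[of "f _" "g _"] in \<open>auto intro!: AE_I2\<close>)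
  with m show ?thesis by (simp add: L2_Rp_def)
qed

lemma L2_Rp_cmult:
  assumes "L2_Rp f" shows "L2_Rp (\<lambda>x. c * f x)"
  using assms unfolding L2_Rp_def by (auto simp: norm_mult power_mult_distrib intro: set_borel_measurable_const_mult)

lemma L2_Rp_diff:
  assumes "L2_Rp f" "L2_Rp g" shows "L2_Rp (\<lambda>x. f x - g x)"
  using L2_Rp_add[OF assms(1) L2_Rp_cmult[OF assms(2), of "-1"]] by simp

abbreviation l2sq :: "real set \<Rightarrow> (real \<Rightarrow> complex) \<Rightarrow> real" where
  "l2sq S f \<equiv> LBINT x:S. (cmod (f x))\<^sup>2"

lemma L2_norm_Rp_power2: "(L2_norm_Rp f)\<^sup>2 = l2sq {0..} f"
proof -
  have "l2sq {0..} f \<ge> 0" unfolding set_lebesgue_integral_def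
    by (rule Bochner_Integration.integral_nonneg) simp
  then show ?thesis by (simp add: L2_norm_Rp_def)
qed

lemma L2_norm_Rp_nonneg: "L2_norm_Rp f \<ge> 0"
  unfolding L2_norm_Rp_def set_lebesgue_integral_def
  by (intro real_sqrt_ge_zero Bochner_Integration.integral_nonneg) simp

lemma LBINT_mono_set:
  fixes f :: "real \<Rightarrow> real"
  assumes f: "set_integrable lborel T f" and "S \<subseteq> T" "S \<in> sets borel" and pos: "\<And>x. x \<in> T \<Longrightarrow> f x \<ge> 0"
  shows "(LBINT x:S. f x) \<le> (LBINT x:T. f x)"
proof -
  have "set_integrable lborel S f" by (rule set_integrable_subset[OF f]) (use assms in auto)
  then show ?thesis using f assms(2) pos unfolding set_lebesgue_integral_def set_integrable_def
    by (intro integral_mono) (auto simp: indicator_def)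
qed

text \<open>The exceptional null sets for b = 1, 2, 3, ... are combined into one, which reconciles
  the local condition on the whole half line with the calculus on compact intervals.\<close>

lemma acd_all_iff:
  "(\<forall>b\<ge>0. acd 0 b F F') \<longleftrightarrow> AC_loc_Rp F \<and> (AE x in lborel. x > 0 \<longrightarrow> (F has_vector_derivative F' x) (at x))"
proof
  assume *: "\<forall>b\<ge>0. acd 0 b F F'"
  have "AE x in lborel. \<forall>n::nat. 0 < x \<and> x < real n \<longrightarrow> (F has_vector_derivative F' x) (at x)"
    unfolding AE_all_countable using * by (simp add: acd_def)
  then have "AE x in lborel. x > 0 \<longrightarrow> (F has_vector_derivative F' x) (at x)"
  proof (rule eventually_mono, intro impI)
    fix x :: real assume a: "\<forall>n::nat. 0 < x \<and> x < real n \<longrightarrow> (F has_vector_derivative F' x) (at x)" and "x > 0"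
    obtain n :: nat where "x < real n" using reals_Archimedean2 by blast
    then show "(F has_vector_derivative F' x) (at x)" using a \<open>x > 0\<close> by blast
  qed
  with * show "AC_loc_Rp F \<and> (AE x in lborel. x > 0 \<longrightarrow> (F has_vector_derivative F' x) (at x))"
    by (simp add: AC_loc_Rp_def acd_def)
next
  assume *: "AC_loc_Rp F \<and> (AE x in lborel. x > 0 \<longrightarrow> (F has_vector_derivative F' x) (at x))"
  show "\<forall>b\<ge>0. acd 0 b F F'"
  proof (intro allI impI)
    fix b :: real assume "b \<ge> 0"
    have "AE x in lborel. 0 < x \<and> x < b \<longrightarrow> (F has_vector_derivative F' x) (at x)"
      using conjunct2[OF *] by (rule eventually_mono) simp
    then show "acd 0 b F F'" using * \<open>b \<ge> 0\<close> by (simp add: acd_def AC_loc_Rp_def)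
  qed
qed

lemma LU_graph_iff:
  "(y, f) \<in> LU_graph q A B \<longleftrightarrow> L2_Rp y \<and> L2_Rp f \<and>
     (\<exists>y1 y2. (\<forall>b\<ge>0. acd 0 b y y1) \<and> (\<forall>b\<ge>0. acd 0 b y1 y2) \<and>
        ae_eq_Rp f (\<lambda>x. - y2 x + q x * y x) \<and> A * y 0 + B * y1 0 = 0)"
  unfolding acd_all_iff LU_graph_def by blast

lemma acd_all_continuous_on:
  assumes "\<forall>b\<ge>0. acd 0 b F F'" shows "continuous_on {0..} F"
proof -
  have "continuous_on UNIV (\<lambda>x. F (max 0 x))"
    by (rule continuous_on_comp_max_0) (use assms AC_on_imp_continuous_on in \<open>auto simp: acd_def\<close>)
  then have "continuous_on {0..} (\<lambda>x. F (max 0 x))" by (rule continuous_on_subset) simp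
  then show ?thesis by (subst (asm) continuous_on_cong[OF refl, of _ _ F]) auto
qed

lemma L1_loc_RpD: "L1_loc_Rp q \<Longrightarrow> set_integrable lborel {0..b} q"
  by (cases "b \<ge> 0") (auto simp: L1_loc_Rp_def)

lemma L1_loc_Rp_diff_const:
  assumes "L1_loc_Rp q" shows "L1_loc_Rp (\<lambda>x. q x - c)"
proof -
  have "set_integrable lborel {0..b} (\<lambda>x. c)" for b :: real
    by (rule borel_integrable_atLeastAtMost') (rule continuous_on_const)
  then show ?thesis using assms by (auto simp: L1_loc_Rp_def)
qed

lemma set_integrable_const_Icc: "set_integrable lborel {a..b::real} (\<lambda>x. c::'a::{banach,second_countable_topology})"
  by (rule borel_integrable_atLeastAtMost') (rule continuous_on_const)

section \<open>Necessity of the Molchanov condition\<close>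

lemma AE_neq: "AE x in lborel. x \<noteq> (c::real)"
  by (rule AE_lborel_singleton)

text \<open>Together with its mirror image, the building block of a cutoff supported in a window:
  the product of the two ramps vanishes outside, and each corner costs only a null set.\<close>

lemma acd_max_left: "acd b1 b2 (\<lambda>x. complex_of_real (max 0 (x - a))) (\<lambda>x. if x > a then 1 else 0)"
  unfolding acd_def
proof
  show "AC_on b1 b2 (\<lambda>x. complex_of_real (max 0 (x - a)))"
    by (rule AC_on_Lipschitz[OF AC_on_of_real, of 1]) (auto simp flip: of_real_diff)
  show "AE x in lborel. b1 < x \<and> x < b2 \<longrightarrow> ((\<lambda>x. complex_of_real (max 0 (x - a))) has_vector_derivative (if x > a then 1 else 0)) (at x)"
    using AE_neq[of a]
  proof (rule eventually_mono, intro impI)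
    fix x :: real assume "x \<noteq> a"
    then consider "x > a" | "x < a" by linarith
    then show "((\<lambda>x. complex_of_real (max 0 (x - a))) has_vector_derivative (if x > a then 1 else 0)) (at x)"
    proof cases
      case 1
      have "((\<lambda>x. complex_of_real (x - a)) has_vector_derivative 1) (at x)"
        using has_vector_derivative_of_real[of "\<lambda>x. x - a" 1 "at x"] by (auto intro!: derivative_eq_intros)
      then have "((\<lambda>x. complex_of_real (max 0 (x - a))) has_vector_derivative 1) (at x)"
        by (rule has_vector_derivative_transform_within_open[of _ _ _ "{a<..}"]) (use 1 in auto)
      then show ?thesis using 1 by simp
    next
      case 2
      have "((\<lambda>x. 0::complex) has_vector_derivative 0) (at x)" by simp
      then have "((\<lambda>x. complex_of_real (max 0 (x - a))) has_vector_derivative 0) (at x)"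
        by (rule has_vector_derivative_transform_within_open[of _ _ _ "{..<a}"]) (use 2 in auto)
      then show ?thesis using 2 by simp
    qed
  qed
qed

lemma acd_max_right: "acd b1 b2 (\<lambda>x. complex_of_real (max 0 (a - x))) (\<lambda>x. if x < a then - 1 else 0)"
  unfolding acd_def
proof
  show "AC_on b1 b2 (\<lambda>x. complex_of_real (max 0 (a - x)))"
    by (rule AC_on_Lipschitz[OF AC_on_of_real, of 1]) (auto simp flip: of_real_diff)
  show "AE x in lborel. b1 < x \<and> x < b2 \<longrightarrow> ((\<lambda>x. complex_of_real (max 0 (a - x))) has_vector_derivative (if x < a then - 1 else 0)) (at x)"
    using AE_neq[of a]
  proof (rule eventually_mono, intro impI)
    fix x :: real assume "x \<noteq> a"
    then consider "x < a" | "x > a" by linarith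
    then show "((\<lambda>x. complex_of_real (max 0 (a - x))) has_vector_derivative (if x < a then - 1 else 0)) (at x)"
    proof cases
      case 1
      have "((\<lambda>x. complex_of_real (a - x)) has_vector_derivative - 1) (at x)"
        using has_vector_derivative_of_real[of "\<lambda>x. a - x" "-1" "at x"] by (auto intro!: derivative_eq_intros)
      then have "((\<lambda>x. complex_of_real (max 0 (a - x))) has_vector_derivative - 1) (at x)"
        by (rule has_vector_derivative_transform_within_open[of _ _ _ "{..<a}"]) (use 1 in auto)
      then show ?thesis using 1 by simp
    next
      case 2
      have "((\<lambda>x. 0::complex) has_vector_derivative 0) (at x)" by simp
      then have "((\<lambda>x. complex_of_real (max 0 (a - x))) has_vector_derivative 0) (at x)"
        by (rule has_vector_derivative_transform_within_open[of _ _ _ "{a<..}"]) (use 2 in auto)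
      then show ?thesis using 2 by simp
    qed
  qed
qed

lemma L2_Rp_bounded_support:
  assumes m: "set_borel_measurable lborel {0..} f" and K: "\<And>x. x \<in> {a..b} \<Longrightarrow> cmod (f x) \<le> K"
    and z: "\<And>x. x \<ge> 0 \<Longrightarrow> x \<notin> {a..b} \<Longrightarrow> f x = 0" and "a \<le> b"
  shows "L2_Rp f" and "L2_norm_Rp f \<le> sqrt (K\<^sup>2 * (b - a))"
proof -
  have le: "indicat_real {0..} x * (cmod (f x))\<^sup>2 \<le> indicator {a..b} x * K\<^sup>2" for x
    using K[of x] z[of x] by (auto simp: indicator_def power_mono)
  have iK: "integrable lborel (\<lambda>x. indicator {a..b} x * K\<^sup>2)"
    using set_integrable_const_Icc[of a b "K\<^sup>2"] by (simp add: set_integrable_def)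
  have i: "set_integrable lborel {0..} (\<lambda>x. (cmod (f x))\<^sup>2)"
    unfolding set_integrable_def
    by (rule Bochner_Integration.integrable_bound[OF iK])
       (use le set_borel_measurable_norm_power2[OF m] in \<open>auto simp: set_borel_measurable_def intro!: AE_I2\<close>)
  then show "L2_Rp f" using m by (simp add: L2_Rp_def)
  have "l2sq {0..} f \<le> (\<integral>x. indicator {a..b} x * K\<^sup>2 \<partial>lborel)"
    unfolding set_lebesgue_integral_def
    by (rule integral_mono) (use i iK le in \<open>auto simp: set_integrable_def\<close>)
  also have "\<dots> = K\<^sup>2 * (b - a)" using \<open>a \<le> b\<close> by simp
  finally show "L2_norm_Rp f \<le> sqrt (K\<^sup>2 * (b - a))" unfolding L2_norm_Rp_def by simp
qed

text \<open>A solution of the eigenvalue equation on a window where |q| has bounded mass is controlled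
  by Gronwall; cutting it off with (x - a)^2 (a + h - x)^2 keeps it in the operator domain.\<close>
lemma localized_quasimode:
  fixes q :: "real \<Rightarrow> complex"
  assumes q: "L1_loc_Rp q" and h: "h > 0" and "M \<ge> 0"
  shows "\<exists>K c. c > 0 \<and> (\<forall>a\<ge>0. (LBINT x:{a..<a + h}. cmod (q x)) \<le> M \<longrightarrow>
     (\<exists>y g. (y, g) \<in> LU_graph q A B \<and> L2_norm_Rp (\<lambda>x. g x - mu * y x) \<le> K \<and>
        (\<forall>x. x \<notin> {a..<a + h} \<longrightarrow> y x = 0) \<and> c \<le> l2sq {a..<a + h} y))"
proof -
  \<comment> \<open>The a priori bound of \<open>linear_system_exists\<close> for initial data (1,
    0): over the window the coefficients 1 and q - mu have total mass at most h + M + |mu|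
    h.\<close>
  define C where "C = 2 * exp (2 * (h + M + cmod mu * h))"
  have C: "C > 0" by (simp add: C_def)
  \<comment> \<open>Bounds \<open>w\<close> below: |\<eta>2| is at most 8 h^2, |\<eta>1| at most 2
    h^3, and u, v at most \<open>C\<close>.\<close>
  define K where "K = 8 * h\<^sup>2 * C + 2 * (2 * h\<^sup>2 * h) * C"
  \<comment> \<open>Within distance \<open>s\<close> of a the solution stays within 1/2 of its
    initial value 1, while the distance to the right end remains at least h/2.\<close>
  define s where "s = min (1 / (2 * C)) (h / 2)"
  have s: "s > 0" "C * s \<le> 1/2" "s \<le> h/2" using C h by (auto simp: s_def min_def field_simps)
  \<comment> \<open>Lower bound for |y|^2 on [a + s/2, a + s], where the ramps are at least s/2 and
    h/2 and |u| is at least 1/2.\<close>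
  define c1 where "c1 = (((s/2) * (h/2))\<^sup>2 / 2)\<^sup>2"
  have c1: "c1 > 0" using s h by (simp add: c1_def)
  show ?thesis
  proof (rule exI[of _ "sqrt (K\<^sup>2 * h)"], rule exI[of _ "c1 * (s/2)"], intro conjI allI impI)
    show "0 < c1 * (s / 2)" using c1 s by simp
    fix a :: real assume a: "a \<ge> 0" and Ma: "(LBINT x:{a..<a + h}. cmod (q x)) \<le> M"
    \<comment> \<open>Switching both coefficients off to the left of a freezes (u, v) at (1, 0)
      there. Initial data at 0 thus act as data at a, and the mass of q before a does not enter the
      bound.\<close>
    define r :: "real \<Rightarrow> complex" where "r x = (if x \<ge> a then 1 else 0)" for x
    define p where "p x = r x * (q x - mu)" for x
    have qmu: "L1_loc_Rp (\<lambda>x. q x - mu)" by (rule L1_loc_Rp_diff_const[OF q])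
    have rb: "cmod (r x) \<le> 1" for x by (simp add: r_def)
    have ri: "set_integrable lborel {0..b} r" for b
    proof -
      have "set_borel_measurable lborel {0..b} r" unfolding set_borel_measurable_def r_def by measurable
      from set_integrable_mult_bounded[OF set_integrable_const_Icc[of 0 b 1] this rb] show ?thesis by simp
    qed
    have pi: "set_integrable lborel {0..b} p" for b
    proof -
      have "set_borel_measurable lborel {0..b} r" unfolding set_borel_measurable_def r_def by measurable
      from set_integrable_mult_bounded[OF L1_loc_RpD[OF qmu] this rb] show ?thesis
        by (simp add: p_def[abs_def] mult.commute)
    qed
    have L: "L1_loc_Rp r" "L1_loc_Rp p" "L1_loc_Rp (\<lambda>x. 0)"
      using ri pi by (auto simp: L1_loc_Rp_def set_integrable_def)
    define Q where "Q x = (LBINT t:{0..x}. norm (r t) + norm (p t) + norm (0::complex))" for x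
    obtain u v where uv: "\<forall>b\<ge>0. acd 0 b u (\<lambda>x. r x * v x) \<and> acd 0 b v (\<lambda>x. p x * u x + 0)" "u 0 = 1" "v 0 = 0"
       and bnd: "\<forall>x\<ge>0. norm (u x) \<le> 2 * (norm (1::complex) + norm (0::complex)) * exp (2 * Q x) \<and>
        norm (v x) \<le> 2 * (norm (1::complex) + norm (0::complex)) * exp (2 * Q x)"
      using linear_system_exists[OF L, of 1 0] unfolding Q_def by blast
    have acdu: "acd 0 b u (\<lambda>x. r x * v x)" and acdv: "acd 0 b v (\<lambda>x. p x * u x)" if "b \<ge> 0" for b
      using uv(1) that by auto
    have cu: "continuous_on {0..} u" and cv: "continuous_on {0..} v"
      using acd_all_continuous_on uv(1) by blast+
    have Qb: "Q x \<le> h + M + cmod mu * h" if x: "0 \<le> x" "x \<le> a + h" for x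
    proof -
      have qi: "set_integrable lborel {a..<a + h} (\<lambda>t. cmod (q t))"
        by (rule set_integrable_subset[OF set_integrable_norm[OF L1_loc_RpD[OF q, of "a + h"]]]) (use a in auto)
      have ci: "set_integrable lborel {a..<a + h} (\<lambda>t. 1 + cmod mu)"
        by (rule set_integrable_subset[OF set_integrable_const_Icc[of a "a + h"]]) auto
      have "Q x \<le> (LBINT t:{a..<a + h}. (1 + cmod mu) + cmod (q t))"
        unfolding Q_def set_lebesgue_integral_def
      proof (rule integral_mono_AE)
        show "integrable lborel (\<lambda>t. indicat_real {0..x} t *\<^sub>R (cmod (r t) + cmod (p t) + cmod (0::complex)))"
          using set_integral_add(1)[OF set_integrable_norm[OF ri] set_integrable_norm[OF pi]] by (simp add: set_integrable_def)
        show "integrable lborel (\<lambda>t. indicat_real {a..<a + h} t *\<^sub>R ((1 + cmod mu) + cmod (q t)))"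
          using set_integral_add(1)[OF ci qi] by (simp add: set_integrable_def)
        show "AE t in lborel. indicat_real {0..x} t *\<^sub>R (cmod (r t) + cmod (p t) + cmod (0::complex))
            \<le> indicat_real {a..<a + h} t *\<^sub>R ((1 + cmod mu) + cmod (q t))"
          using AE_neq[of "a + h"]
        proof (rule eventually_mono)
          fix t assume "t \<noteq> a + h"
          then show "indicat_real {0..x} t *\<^sub>R (cmod (r t) + cmod (p t) + cmod (0::complex))
            \<le> indicat_real {a..<a + h} t *\<^sub>R ((1 + cmod mu) + cmod (q t))"
            using x norm_triangle_ineq4[of "q t" mu] by (auto simp: indicator_def r_def p_def)
        qed
      qed
      also have "\<dots> = (LBINT t:{a..<a + h}. 1 + cmod mu) + (LBINT t:{a..<a + h}. cmod (q t))"
        by (rule set_integral_add(2)[OF ci qi])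
      also have "(LBINT t:{a..<a + h}. 1 + cmod mu) = (1 + cmod mu) * h"
        using h by (simp add: set_lebesgue_integral_def)
      finally show ?thesis using Ma by (simp add: algebra_simps)
    qed
    have uvC: "cmod (u x) \<le> C" "cmod (v x) \<le> C" if x: "0 \<le> x" "x \<le> a + h" for x
    proof -
      have "2 * exp (2 * Q x) \<le> C" using Qb[OF x] unfolding C_def by simp
      moreover have "cmod (u x) \<le> 2 * exp (2 * Q x)" "cmod (v x) \<le> 2 * exp (2 * Q x)"
        using bnd[rule_format, OF x(1)] by simp_all
      ultimately show "cmod (u x) \<le> C" "cmod (v x) \<le> C" by linarith+
    qed
    have rvi: "set_integrable lborel {0..x} (\<lambda>t. r t * v t)" for x
      by (rule set_integrable_mult_continuous[OF ri continuous_on_subset[OF cv]]) auto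
    have near1: "cmod (u x - 1) \<le> C * (x - a)" if x: "a \<le> x" "x \<le> a + h" for x
    proof -
      have "(LBINT t:{0..x}. r t * v t) = u x - u 0" using acdu[of x] x a by (intro acd_LBINT rvi) auto
      then have "cmod (u x - 1) = cmod (LBINT t:{0..x}. r t * v t)" using uv by simp
      also have "\<dots> \<le> (LBINT t:{0..x}. indicator {a..x} t * C)"
      proof (rule norm_LBINT_le[OF rvi])
        show "set_integrable lborel {0..x} (\<lambda>t. indicat_real {a..x} t * C)"
        proof -
          have "set_borel_measurable lborel {0..x} (indicat_real {a..x})" unfolding set_borel_measurable_def by measurable
          from set_integrable_mult_bounded[OF set_integrable_const_Icc[of 0 x C] this, of 1] show ?thesis
            by (simp add: mult.commute)
        qed
        fix t assume "t \<in> {0..x}"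
        then show "cmod (r t * v t) \<le> indicat_real {a..x} t * C" using uvC(2)[of t] x by (auto simp: r_def indicator_def)
      qed
      also have "\<dots> = C * (x - a)"
      proof -
        have "(\<lambda>t. indicat_real {0..x} t * (indicat_real {a..x} t * C)) = (\<lambda>t. indicat_real {a..x} t * C)"
          using a by (auto simp: indicator_def)
        then show ?thesis unfolding set_lebesgue_integral_def real_scaleR_def using x by simp
      qed
      finally show ?thesis .
    qed
    define m n where "m x = complex_of_real (max 0 (x - a))" and "n x = complex_of_real (max 0 (a + h - x))" for x
    define dm dn :: "real \<Rightarrow> complex" where "dm x = (if x > a then 1 else 0)" and "dn x = (if x < a + h then - 1 else 0)" for x
    have acdm: "acd 0 b m dm" and acdn: "acd 0 b n dn" for b
      unfolding m_def n_def dm_def dn_def by (rule acd_max_left acd_max_right)+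
    define E E1 where "E x = m x * n x" and "E1 x = m x * dn x + dm x * n x" for x
    have acdE: "acd 0 b E E1" for b unfolding E_def E1_def by (rule acd_mult[OF acdm acdn])
    \<comment> \<open>Squaring \<open>E\<close> makes \<eta> and its derivative vanish at both ends.
      The derivative 2 E E' is written as 2 E (n - m), a product of absolutely continuous functions,
      since \<open>E1\<close> itself jumps at the ends; the two agree because \<open>E\<close> is 0
      outside the window. The terms with factor 0 come from the product rule with a
      constant.\<close>
    define \<eta> \<eta>1 \<eta>2 where "\<eta> x = E x * E x" and "\<eta>1 x = 2 * E x * (n x + - 1 * m x)"
      and "\<eta>2 x = 2 * E x * (dn x + (- 1 * dm x + 0 * m x)) + (2 * E1 x + 0 * E x) * (n x + - 1 * m x)" for x
    have out: "E x = 0" "E1 x = 0" if "x \<notin> {a<..<a + h}" for x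
      using that by (auto simp: E_def E1_def m_def n_def dm_def dn_def)
    have eta1: "E x * E1 x + E1 x * E x = \<eta>1 x" for x
      by (cases "x \<in> {a<..<a + h}") (auto simp: out \<eta>1_def E1_def dm_def dn_def algebra_simps)
    have acd\<eta>: "acd 0 b \<eta> \<eta>1" for b
      using acd_mult[OF acdE acdE] unfolding \<eta>_def eta1 .
    have acd\<eta>1: "acd 0 b \<eta>1 \<eta>2" for b
    proof -
      have 1: "acd 0 b (\<lambda>x. 2 * E x) (\<lambda>x. 2 * E1 x + 0 * E x)" by (rule acd_mult[OF acd_const acdE])
      have 2: "acd 0 b (\<lambda>x. n x + - 1 * m x) (\<lambda>x. dn x + (- 1 * dm x + 0 * m x))"
        by (rule acd_add[OF acdn acd_mult[OF acd_const acdm]])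
      show ?thesis using acd_mult[OF 1 2] unfolding \<eta>1_def \<eta>2_def .
    qed
    have nb: "cmod (m x) \<le> h" "cmod (n x) \<le> h" "cmod (dm x) \<le> 1" "cmod (dn x) \<le> 1" if "x \<in> {a<..<a + h}" for x
      using that unfolding m_def n_def norm_of_real by (auto simp: dm_def dn_def)
    have nm: "cmod (n x + - 1 * m x) \<le> h" if "x \<in> {a<..<a + h}" for x
    proof -
      have "n x + - 1 * m x = complex_of_real (a + h - x - (x - a))" using that by (simp add: m_def n_def)
      then show ?thesis using that by (simp only: norm_of_real) auto
    qed
    have Eb: "cmod (E x) \<le> h\<^sup>2" if "x \<in> {a<..<a + h}" for x
      using nb[OF that] h unfolding E_def norm_mult power2_eq_square by (intro mult_mono) auto
    have E1b: "cmod (E1 x) \<le> h" if "x \<in> {a<..<a + h}" for x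
    proof -
      have "E1 x = n x + - 1 * m x" using that by (simp add: E1_def dm_def dn_def)
      then show ?thesis using nm[OF that] by simp
    qed
    have \<eta>1b: "cmod (\<eta>1 x) \<le> 2 * h\<^sup>2 * h" if "x \<in> {a<..<a + h}" for x
      unfolding \<eta>1_def norm_mult using Eb[OF that] nm[OF that] h by (intro mult_mono) auto
    have \<eta>2b: "cmod (\<eta>2 x) \<le> 8 * h\<^sup>2" if "x \<in> {a<..<a + h}" for x
    proof -
      have "cmod (\<eta>2 x) \<le> cmod (2 * E x * (dn x + (- 1 * dm x + 0 * m x))) + cmod ((2 * E1 x + 0 * E x) * (n x + - 1 * m x))"
        unfolding \<eta>2_def by (rule norm_triangle_ineq)
      also have "\<dots> \<le> 2 * h\<^sup>2 * 2 + 2 * h * h"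
      proof (rule add_mono)
        have "dn x + (- 1 * dm x + 0 * m x) = -2" using that by (simp add: dn_def dm_def)
        then show "cmod (2 * E x * (dn x + (- 1 * dm x + 0 * m x))) \<le> 2 * h\<^sup>2 * 2"
          using Eb[OF that] by (simp add: norm_mult)
        show "cmod ((2 * E1 x + 0 * E x) * (n x + - 1 * m x)) \<le> 2 * h * h"
          unfolding norm_mult using E1b[OF that] nm[OF that] h by (intro mult_mono) (auto simp: norm_mult)
      qed
      also have "\<dots> \<le> 8 * h\<^sup>2" by (simp add: power2_eq_square)
      finally show ?thesis .
    qed
    have \<eta>out: "\<eta> x = 0" "\<eta>1 x = 0" "\<eta>2 x = 0" if "x \<notin> {a<..<a + h}" for x
      using out[OF that] by (auto simp: \<eta>_def \<eta>1_def \<eta>2_def)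
    have \<eta>r: "\<eta> x * r x = \<eta> x" "\<eta>1 x * r x = \<eta>1 x" for x
      using \<eta>out[of x] by (auto simp: r_def)
    define y y1 where "y x = \<eta> x * u x" and "y1 x = \<eta>1 x * u x + \<eta> x * v x" for x
    \<comment> \<open>The commutator of the cutoff with the differential expression. It contains no
      q, so the image of y under L - mu is bounded pointwise even where q is not.\<close>
    define w where "w x = - (\<eta>2 x * u x + 2 * \<eta>1 x * v x)" for x
    define g where "g x = mu * y x + w x" for x
    have acdy: "acd 0 b y y1" if "b \<ge> 0" for b
    proof -
      have "acd 0 b y (\<lambda>x. \<eta> x * (r x * v x) + \<eta>1 x * u x)" unfolding y_def by (rule acd_mult[OF acd\<eta> acdu[OF that]])
      moreover have "(\<lambda>x. \<eta> x * (r x * v x) + \<eta>1 x * u x) = y1"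
        by (rule ext) (simp add: y1_def mult.assoc[symmetric] \<eta>r)
      ultimately show ?thesis by simp
    qed
    define y2 where "y2 x = (\<eta>1 x * (r x * v x) + \<eta>2 x * u x) + (\<eta> x * (p x * u x) + \<eta>1 x * v x)" for x
    have acdy1: "acd 0 b y1 y2" if "b \<ge> 0" for b
      unfolding y1_def y2_def by (rule acd_add[OF acd_mult[OF acd\<eta>1 acdu[OF that]] acd_mult[OF acd\<eta> acdv[OF that]]])
    have gy: "g x = - y2 x + q x * y x" for x
    proof -
      have "\<eta> x * (p x * u x) = \<eta> x * (q x - mu) * u x" unfolding p_def by (simp add: mult.assoc[symmetric] \<eta>r)
      moreover have "\<eta>1 x * (r x * v x) = \<eta>1 x * v x" by (simp add: mult.assoc[symmetric] \<eta>r)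
      ultimately have "y2 x = (\<eta>1 x * v x + \<eta>2 x * u x) + (\<eta> x * (q x - mu) * u x + \<eta>1 x * v x)"
        by (simp only: y2_def)
      then show ?thesis unfolding g_def w_def y_def by (simp add: algebra_simps)
    qed
    have mu': "set_borel_measurable lborel {0..} u" "set_borel_measurable lborel {0..} v"
      using cu cv by (auto intro: continuous_imp_set_borel_measurable)
    have m\<eta>: "set_borel_measurable lborel {0..} \<eta>" "set_borel_measurable lborel {0..} \<eta>1" "set_borel_measurable lborel {0..} \<eta>2"
      unfolding set_borel_measurable_def \<eta>_def \<eta>1_def \<eta>2_def E_def E1_def m_def n_def dm_def dn_def
      by measurable
    have L2y: "L2_Rp y"
    proof (rule L2_Rp_bounded_support(1))
      show "set_borel_measurable lborel {0..} y" unfolding y_def by (intro set_borel_measurable_mult m\<eta> mu')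
      show "a \<le> a + h" using h by simp
      fix x :: real
      show "x \<in> {a..a + h} \<Longrightarrow> cmod (y x) \<le> h\<^sup>2 * h\<^sup>2 * C"
      proof (cases "x \<in> {a<..<a + h}")
        case True
        then show ?thesis unfolding y_def \<eta>_def norm_mult using Eb[OF True] uvC(1)[of x] a by (intro mult_mono) auto
      next
        case False then show ?thesis using \<eta>out[OF False] C h by (simp add: y_def)
      qed
      show "x \<notin> {a..a + h} \<Longrightarrow> y x = 0" using \<eta>out[of x] by (auto simp: y_def)
    qed
    have w: "L2_Rp w" "L2_norm_Rp w \<le> sqrt (K\<^sup>2 * (a + h - a))"
    proof -
      have wm: "set_borel_measurable lborel {0..} w"
      proof -
        have "set_borel_measurable lborel {0..} (\<lambda>x. (-1) * (\<eta>2 x * u x + (2 * \<eta>1 x) * v x))"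
          by (intro set_borel_measurable_mult set_borel_measurable_add set_borel_measurable_const_mult m\<eta> mu')
        then show ?thesis unfolding w_def by simp
      qed
      have wK: "cmod (w x) \<le> K" for x
      proof (cases "x \<in> {a<..<a + h}")
        case True
        have "cmod (w x) \<le> cmod (\<eta>2 x * u x) + cmod (2 * \<eta>1 x * v x)"
          unfolding w_def norm_minus_cancel by (rule norm_triangle_ineq)
        also have "\<dots> \<le> K" unfolding K_def norm_mult norm_numeral
          using \<eta>2b[OF True] \<eta>1b[OF True] uvC[of x] True a h by (intro add_mono mult_mono) auto
        finally show ?thesis .
      next
        case False then show ?thesis using \<eta>out[OF False] C h by (simp add: w_def K_def)
      qed
      have wo: "w x = 0" if "x \<notin> {a..a + h}" for x using \<eta>out[of x] that by (auto simp: w_def)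
      have "a \<le> a + h" using h by simp
      from L2_Rp_bounded_support[OF wm wK wo this]
      show "L2_Rp w" "L2_norm_Rp w \<le> sqrt (K\<^sup>2 * (a + h - a))" by blast+
    qed
    have "L2_Rp g" unfolding g_def by (intro L2_Rp_add L2_Rp_cmult L2y w)
    moreover have "A * y 0 + B * y1 0 = 0" using \<eta>out[of 0] a by (auto simp: y_def y1_def)
    moreover have "ae_eq_Rp g (\<lambda>x. - y2 x + q x * y x)" unfolding ae_eq_Rp_def by (simp add: gy)
    ultimately have graph: "(y, g) \<in> LU_graph q A B"
      unfolding LU_graph_iff using L2y acdy acdy1 by blast
    have bound: "L2_norm_Rp (\<lambda>x. g x - mu * y x) \<le> sqrt (K\<^sup>2 * h)" using w(2) by (simp add: g_def)
    have supp: "y x = 0" if "x \<notin> {a..<a + h}" for x using \<eta>out[of x] that by (auto simp: y_def)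
    have lower: "c1 * (s/2) \<le> l2sq {a..<a + h} y"
    proof -
      have yi: "set_integrable lborel {a..<a + h} (\<lambda>x. (cmod (y x))\<^sup>2)"
        by (rule set_integrable_subset[of _ "{0..}"]) (use L2y a in \<open>auto simp: L2_Rp_def\<close>)
      have "c1 * (s/2) = (LBINT x:{a + s/2..a + s}. c1)" using s by (simp add: set_lebesgue_integral_def)
      also have "\<dots> \<le> l2sq {a + s/2..a + s} y"
      proof (rule set_integral_mono[OF set_integrable_const_Icc])
        show "set_integrable lborel {a + s/2..a + s} (\<lambda>x. (cmod (y x))\<^sup>2)"
          by (rule set_integrable_subset[OF yi]) (use s h in auto)
        fix x assume x: "x \<in> {a + s/2..a + s}"
        then have xr: "a \<le> x" "x \<le> a + h" "x \<in> {a<..<a + h}" using s h by auto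
        have "C * (x - a) \<le> C * s" using x C by (intro mult_left_mono) auto
        then have "cmod (u x - 1) \<le> 1/2" using near1[OF xr(1,2)] s by simp
        then have u2: "1/2 \<le> cmod (u x)" using norm_triangle_sub[of "1::complex" "u x"] by (simp add: norm_minus_commute)
        have E2: "(s/2) * (h/2) \<le> cmod (E x)"
          unfolding E_def norm_mult m_def n_def norm_of_real using x s h by (intro mult_mono) auto
        have "((s/2) * (h/2))\<^sup>2 * (1/2) \<le> (cmod (E x))\<^sup>2 * cmod (u x)"
          using E2 u2 s h by (intro mult_mono power_mono) auto
        also have "\<dots> = cmod (y x)" by (simp add: y_def \<eta>_def norm_mult power2_eq_square)
        finally show "c1 \<le> (cmod (y x))\<^sup>2" unfolding c1_def using s h by (intro power_mono) auto
      qed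
      also have "\<dots> \<le> l2sq {a..<a + h} y"
        by (rule LBINT_mono_set[OF yi]) (use s h in auto)
      finally show ?thesis .
    qed
    show "\<exists>y g. (y, g) \<in> LU_graph q A B \<and> L2_norm_Rp (\<lambda>x. g x - mu * y x) \<le> sqrt (K\<^sup>2 * h) \<and>
        (\<forall>x. x \<notin> {a..<a + h} \<longrightarrow> y x = 0) \<and> c1 * (s/2) \<le> l2sq {a..<a + h} y"
      using graph bound supp lower by blast
  qed
qed

text \<open>If the masses do not tend to infinity, infinitely many windows share one bound. The
  constants \<open>K\<close> and \<open>c\<close> of \<open>localized_quasimode\<close> do not
  depend on the position of the window, so they serve all of these at once.\<close>

lemma resolvent_compact_imp_molchanov:
  assumes q: "L1_loc_Rp q" and rc: "resolvent_compact (LU_graph q A B) mu"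
  shows "molchanov q"
  unfolding molchanov_def
proof (intro allI impI)
  fix h :: real and a :: "nat \<Rightarrow> real"
  assume "h > 0 \<and> (\<forall>n. a n \<ge> 0) \<and> (\<forall>m n. m \<noteq> n \<longrightarrow> {a m..<a m + h} \<inter> {a n..<a n + h} = {})"
  then have h: "h > 0" and a: "\<And>n. a n \<ge> 0"
    and disj: "\<And>m n. m \<noteq> n \<Longrightarrow> {a m..<a m + h} \<inter> {a n..<a n + h} = {}" by auto
  let ?I = "\<lambda>n. LBINT x:{a n..<a n + h}. cmod (q x)"
  show "filterlim ?I at_top sequentially"
  proof (rule ccontr)
    assume "\<not> filterlim ?I at_top sequentially"
    then obtain Z where "\<not> (\<forall>\<^sub>F n in sequentially. Z \<le> ?I n)" unfolding filterlim_at_top by blast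
    then have "\<forall>N. \<exists>n\<ge>N. ?I n < Z" by (auto simp: eventually_sequentially not_le)
    then have "\<forall>N. \<exists>n>N. n \<in> {n. ?I n < Z}" by (metis Suc_le_lessD mem_Collect_eq)
    then have inf: "infinite {n. ?I n < Z}" by (simp add: infinite_nat_iff_unbounded)
    define e where "e = enumerate {n. ?I n < Z}"
    have e: "?I (e n) \<le> max Z 0" for n using enumerate_in_set[OF inf, of n] by (simp add: e_def)
    have einj: "inj e" unfolding e_def using strict_mono_enumerate[OF inf] by (rule strict_mono_imp_inj_on)
    obtain K c where c: "c > 0" and Kc: "\<forall>a\<ge>0. (LBINT x:{a..<a + h}. cmod (q x)) \<le> max Z 0 \<longrightarrow>
       (\<exists>y g. (y, g) \<in> LU_graph q A B \<and> L2_norm_Rp (\<lambda>x. g x - mu * y x) \<le> K \<and>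
        (\<forall>x. x \<notin> {a..<a + h} \<longrightarrow> y x = 0) \<and> c \<le> l2sq {a..<a + h} y)"
      using localized_quasimode[OF q h, of "max Z 0" A B mu] by auto
    have "\<forall>n. \<exists>y g. (y, g) \<in> LU_graph q A B \<and> L2_norm_Rp (\<lambda>x. g x - mu * y x) \<le> K \<and>
        (\<forall>x. x \<notin> {a (e n)..<a (e n) + h} \<longrightarrow> y x = 0) \<and> c \<le> l2sq {a (e n)..<a (e n) + h} y"
      using Kc a e by blast
    from choice[OF this] obtain y where "\<forall>n. \<exists>g. (y n, g) \<in> LU_graph q A B \<and> L2_norm_Rp (\<lambda>x. g x - mu * y n x) \<le> K \<and>
        (\<forall>x. x \<notin> {a (e n)..<a (e n) + h} \<longrightarrow> y n x = 0) \<and> c \<le> l2sq {a (e n)..<a (e n) + h} (y n)" ..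
    from choice[OF this] obtain g where "\<forall>n. (y n, g n) \<in> LU_graph q A B \<and> L2_norm_Rp (\<lambda>x. g n x - mu * y n x) \<le> K \<and>
        (\<forall>x. x \<notin> {a (e n)..<a (e n) + h} \<longrightarrow> y n x = 0) \<and> c \<le> l2sq {a (e n)..<a (e n) + h} (y n)" ..
    then have yg: "\<And>n. (y n, g n) \<in> LU_graph q A B" "\<And>n. L2_norm_Rp (\<lambda>x. g n x - mu * y n x) \<le> K"
      "\<And>n x. x \<notin> {a (e n)..<a (e n) + h} \<Longrightarrow> y n x = 0" "\<And>n. c \<le> l2sq {a (e n)..<a (e n) + h} (y n)"
      by simp_all
    from rc[unfolded resolvent_compact_def, THEN spec[of _ y], THEN spec[of _ g], THEN spec[of _ K], THEN mp,
        OF conjI[OF allI[OF yg(1)] allI[OF yg(2)]]]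
    obtain r :: "nat \<Rightarrow> nat" where r: "strict_mono r"
      and cauchy: "\<forall>\<epsilon>>0. \<exists>N. \<forall>m\<ge>N. \<forall>n\<ge>N. L2_norm_Rp (\<lambda>x. y (r m) x - y (r n) x) < \<epsilon>"
      by (elim exE conjE)
    \<comment> \<open>Two distinct members closer than \<open>sqrt c\<close> are impossible: on the
      window of the first the second vanishes, so the difference already has squared norm at least
      \<open>c\<close> there.\<close>
    from cauchy c obtain N where N: "\<forall>m\<ge>N. \<forall>n\<ge>N. L2_norm_Rp (\<lambda>x. y (r m) x - y (r n) x) < sqrt c"
      by (meson real_sqrt_gt_zero)
    define i j where "i = r N" and "j = r (Suc N)"
    have ij: "e i \<noteq> e j" using r einj by (simp add: i_def j_def inj_eq strict_mono_eq)
    have lt: "L2_norm_Rp (\<lambda>x. y i x - y j x) < sqrt c" using N by (simp add: i_def j_def)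
    have L2: "L2_Rp (\<lambda>x. y i x - y j x)" using yg(1) by (intro L2_Rp_diff) (auto simp: LU_graph_def)
    have "c \<le> l2sq {a (e i)..<a (e i) + h} (y i)" by (rule yg(4))
    also have "\<dots> = (LBINT x:{a (e i)..<a (e i) + h}. (cmod (y i x - y j x))\<^sup>2)"
    proof (rule set_lebesgue_integral_cong)
      show "\<forall>x. x \<in> {a (e i)..<a (e i) + h} \<longrightarrow> (cmod (y i x))\<^sup>2 = (cmod (y i x - y j x))\<^sup>2"
      proof (intro allI impI)
        fix x assume "x \<in> {a (e i)..<a (e i) + h}"
        then have "x \<notin> {a (e j)..<a (e j) + h}" using disj[OF ij] by blast
        then show "(cmod (y i x))\<^sup>2 = (cmod (y i x - y j x))\<^sup>2" using yg(3) by simp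
      qed
    qed simp
    also have "\<dots> \<le> (LBINT x:{0..}. (cmod (y i x - y j x))\<^sup>2)"
      by (rule LBINT_mono_set) (use L2 a[of "e i"] in \<open>auto simp: L2_Rp_def\<close>)
    finally have "c \<le> (L2_norm_Rp (\<lambda>x. y i x - y j x))\<^sup>2" by (simp add: L2_norm_Rp_power2)
    also have "\<dots> < (sqrt c)\<^sup>2" by (rule power_strict_mono[OF lt L2_norm_Rp_nonneg]) simp
    finally show False using c by simp
  qed
qed

section \<open>Energy estimates for sectorial potentials\<close>

text \<open>On [-pi/2, pi/2] the cosine first increases and then decreases, so its minimum over a
  subinterval is attained at an endpoint; this yields the constant \<delta> of the rotated
  sector.\<close>

lemma cos_ge_min_endpoints:
  assumes "a \<le> t" "t \<le> b" "- (pi/2) \<le> a" "b \<le> pi/2"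
  shows "min (cos a) (cos b) \<le> cos t"
proof (cases "t \<ge> 0")
  case True
  then have "cos b \<le> cos t" using assms by (intro cos_monotone_0_pi_le) auto
  then show ?thesis by simp
next
  case False
  then have "cos (- a) \<le> cos (- t)" using assms by (intro cos_monotone_0_pi_le) auto
  then show ?thesis by simp
qed

text \<open>Rotating by theta moves both the sector and the positive real axis into the right half plane.\<close>
lemma sectorial_rotation:
  assumes "sectorial q"
  obtains x0 q0 \<theta> \<delta> where "x0 \<ge> 0" "cos \<theta> > 0" "\<delta> > 0"
    "\<forall>x>x0. \<delta> * cmod (q x - q0) \<le> Re (cis \<theta> * (q x - q0))"
proof -
  obtain x0 q0 \<alpha> \<beta> where s: "x0 \<ge> 0" "-pi < \<alpha>" "\<alpha> \<le> \<beta>" "\<beta> < pi" "\<beta> - \<alpha> < pi"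
     and q: "\<forall>x>x0. q x = q0 \<or> (\<alpha> \<le> Arg (q x - q0) \<and> Arg (q x - q0) \<le> \<beta>)"
    using assms unfolding sectorial_def by blast
  \<comment> \<open>The angle must satisfy |\<theta>| < pi/2, \<alpha> + \<theta> > -pi/2 and
    \<beta> + \<theta> < pi/2. Comparing each lower with each upper bound, \<open>L < U\<close>
    amounts to 0 < pi, -pi < \<alpha>, \<beta> < pi and \<beta> - \<alpha> < pi.\<close>
  define L U where "L = max (- (pi/2)) (- (pi/2) - \<alpha>)" and "U = min (pi/2) (pi/2 - \<beta>)"
  define \<theta> where "\<theta> = (L + U) / 2"
  have "L < U" unfolding L_def U_def max_less_iff_conj min_less_iff_conj using s by simp
  then have "L < \<theta>" "\<theta> < U" unfolding \<theta>_def by simp_all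
  moreover have "- (pi/2) \<le> L" "- (pi/2) - \<alpha> \<le> L" "U \<le> pi/2" "U \<le> pi/2 - \<beta>"
    unfolding L_def U_def by (rule max.cobounded1 max.cobounded2 min.cobounded1 min.cobounded2)+
  ultimately have lo: "- (pi/2) < \<theta>" "- (pi/2) - \<alpha> < \<theta>" and hi: "\<theta> < pi/2" "\<theta> < pi/2 - \<beta>"
    by simp_all
  define \<delta> where "\<delta> = min (cos (\<alpha> + \<theta>)) (cos (\<beta> + \<theta>))"
  show thesis
  proof
    show "x0 \<ge> 0" by fact
    show "cos \<theta> > 0" using lo hi by (intro cos_gt_zero_pi) auto
    show "\<delta> > 0" unfolding \<delta>_def using lo hi s by (auto intro!: cos_gt_zero_pi)
    show "\<forall>x>x0. \<delta> * cmod (q x - q0) \<le> Re (cis \<theta> * (q x - q0))"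
    proof (intro allI impI)
      fix x assume "x > x0"
      show "\<delta> * cmod (q x - q0) \<le> Re (cis \<theta> * (q x - q0))"
      proof (cases "q x = q0")
        case False
        define \<phi> where "\<phi> = Arg (q x - q0)"
        have \<phi>: "\<alpha> \<le> \<phi>" "\<phi> \<le> \<beta>" using q \<open>x > x0\<close> False unfolding \<phi>_def by auto
        have "q x - q0 = of_real (cmod (q x - q0)) * cis \<phi>"
          using rcis_cmod_Arg[of "q x - q0"] unfolding \<phi>_def rcis_def by simp
        then have "cis \<theta> * (q x - q0) = cis \<theta> * (of_real (cmod (q x - q0)) * cis \<phi>)" by (rule arg_cong)
        also have "\<dots> = of_real (cmod (q x - q0)) * cis (\<phi> + \<theta>)"
          by (simp add: cis_mult[symmetric])
        finally have "cis \<theta> * (q x - q0) = of_real (cmod (q x - q0)) * cis (\<phi> + \<theta>)" .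
        then have "Re (cis \<theta> * (q x - q0)) = cmod (q x - q0) * cos (\<phi> + \<theta>)" by simp
        moreover have "\<delta> \<le> cos (\<phi> + \<theta>)" unfolding \<delta>_def
          using \<phi> lo hi by (intro cos_ge_min_endpoints) auto
        moreover from this have "\<delta> * cmod (q x - q0) \<le> cos (\<phi> + \<theta>) * cmod (q x - q0)"
          by (rule mult_right_mono) simp
        ultimately show ?thesis by (simp only: mult.commute)
      qed simp
    qed
  qed
qed

section \<open>Weighted inequalities and the cut-off energy estimate\<close>

lemma two_mult_le_weighted_squares:
  fixes a b \<epsilon> :: real
  assumes "\<epsilon> > 0"
  shows "2 * a * b \<le> \<epsilon> * a\<^sup>2 + b\<^sup>2 / \<epsilon>"
proof -
  have "0 \<le> (sqrt \<epsilon> * a - b / sqrt \<epsilon>)\<^sup>2" by simp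
  also have "\<dots> = \<epsilon> * a\<^sup>2 + b\<^sup>2 / \<epsilon> - 2 * a * b"
    using assms by (simp add: power2_diff power_mult_distrib power_divide)
  finally show ?thesis by simp
qed

lemma set_integrable_cmod_power2:
  fixes z :: "real \<Rightarrow> complex"
  assumes "continuous_on {a..b} z" shows "set_integrable lborel {a..b} (\<lambda>x. (cmod (z x))\<^sup>2)"
  by (rule borel_integrable_atLeastAtMost') (intro continuous_intros assms)

text \<open>Since z vanishes at R, |z(x)|^2 is the integral of -(|z|^2)' over [x, R], and (|z|^2)'
  is at most 2 |z'| |z|. The free parameter trades a small share of the energy for a large share of
  the L2 norm.\<close>

lemma sup_bound_vanishing_end:
  assumes z: "acd a R z z'" and cz': "continuous_on {a..R} z'" and zR: "z R = 0"
    and x: "a \<le> x" "x \<le> R" and "\<epsilon> > 0"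
  shows "(cmod (z x))\<^sup>2 \<le> \<epsilon> * l2sq {a..R} z' + l2sq {a..R} z / \<epsilon>"
proof -
  have cz: "continuous_on {a..R} z" using z AC_on_imp_continuous_on by (auto simp: acd_def)
  define D where "D t = z t * cnj (z' t) + z' t * cnj (z t)" for t
  have D: "acd a R (\<lambda>t. z t * cnj (z t)) D"
    using z cz' acd_mult[OF z acd_cnj[OF z]] by (simp add: D_def[abs_def])
  have iD: "set_integrable lborel {x..R} D"
    unfolding D_def by (rule borel_integrable_atLeastAtMost') (intro continuous_intros continuous_on_subset[OF cz] continuous_on_subset[OF cz'], use x in auto)
  have "(LBINT t:{x..R}. D t) = z R * cnj (z R) - z x * cnj (z x)"
    by (rule acd_LBINT[OF acd_subset[OF D] _ iD]) (use x in auto)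
  then have eq: "(cmod (z x))\<^sup>2 = cmod (LBINT t:{x..R}. D t)"
    by (simp add: zR norm_mult power2_eq_square)
  have iG: "set_integrable lborel {a..R} (\<lambda>t. \<epsilon> * (cmod (z' t))\<^sup>2 + (cmod (z t))\<^sup>2 / \<epsilon>)"
    by (intro set_integral_add(1) set_integrable_mult_right set_integrable_divide set_integrable_cmod_power2 cz cz')
  note eq
  also have "cmod (LBINT t:{x..R}. D t) \<le> (LBINT t:{x..R}. \<epsilon> * (cmod (z' t))\<^sup>2 + (cmod (z t))\<^sup>2 / \<epsilon>)"
  proof (rule norm_LBINT_le[OF iD])
    show "set_integrable lborel {x..R} (\<lambda>t. \<epsilon> * (cmod (z' t))\<^sup>2 + (cmod (z t))\<^sup>2 / \<epsilon>)"
      by (rule set_integrable_subset[OF iG]) (use x in auto)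
    fix t
    have "cmod (D t) \<le> 2 * cmod (z' t) * cmod (z t)"
      unfolding D_def using norm_triangle_ineq[of "z t * cnj (z' t)" "z' t * cnj (z t)"] by (simp add: norm_mult mult_ac)
    then show "cmod (D t) \<le> \<epsilon> * (cmod (z' t))\<^sup>2 + (cmod (z t))\<^sup>2 / \<epsilon>"
      using two_mult_le_weighted_squares[OF \<open>\<epsilon> > 0\<close>, of "cmod (z' t)" "cmod (z t)"] by linarith
  qed
  also have "\<dots> \<le> (LBINT t:{a..R}. \<epsilon> * (cmod (z' t))\<^sup>2 + (cmod (z t))\<^sup>2 / \<epsilon>)"
    by (rule LBINT_mono_set[OF iG]) (use x \<open>\<epsilon> > 0\<close> in auto)
  also have "\<dots> = \<epsilon> * l2sq {a..R} z' + l2sq {a..R} z / \<epsilon>"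
    by (subst set_integral_add(2)) (auto intro!: set_integrable_mult_right set_integrable_divide set_integrable_cmod_power2 cz cz')
  finally show ?thesis .
qed

text \<open>The right-hand side is the real part of e times the derivative of \<eta> y1 cnj z when
  y1' = (q - mu) y - f and the cutoff \<eta> has slope -\<kappa>. Substituting \<eta> y1 = z' +
  \<kappa> y isolates |z'|^2. The coefficient K - 1/2 reflects the share of |z|^2 spent on f, and
  3/c bounds c + 2/c because c is at most 1.\<close>

lemma energy_density_lower_bound:
  fixes e q mu q0 y y1 f z z' :: complex and \<eta> \<kappa> K c \<delta>' :: real
  assumes e: "cmod e = 1" "Re e = c" "c > 0" and \<eta>: "0 \<le> \<eta>" "\<eta> \<le> 1" and "\<kappa> \<ge> 0"
    and mu: "mu = q0 - of_real K * cnj e"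
    and z: "z = of_real \<eta> * y" and z': "z' = of_real \<eta> * y1 - of_real \<kappa> * y"
    and sec: "\<delta>' * cmod (q - q0) \<le> Re (e * (q - q0))"
  shows "(c/2) * (cmod z')\<^sup>2 + (K - 1/2) * (cmod z)\<^sup>2 + \<delta>' * (cmod (q - q0) * (cmod z)\<^sup>2) - (cmod f)\<^sup>2 / 2 - (3/c) * (\<kappa>\<^sup>2 * (cmod y)\<^sup>2)
    \<le> Re (e * (of_real \<eta> * y1 * cnj z' + (of_real \<eta> * ((q - mu) * y - f) + - of_real \<kappa> * y1) * cnj z))"
proof -
  have c1: "c \<le> 1" using e complex_Re_le_cmod[of e] by simp
  have a: "of_real \<eta> * y1 = z' + of_real \<kappa> * y" by (simp add: z')
  \<comment> \<open>\<open>T\<close> is purely imaginary, but the rotation by e gives it a real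
    part; half of the term c |z'|^2 is spent on absorbing it.\<close>
  define T where "T = of_real \<kappa> * (y * cnj z' - z' * cnj y)"
  have id: "of_real \<eta> * y1 * cnj z' + (of_real \<eta> * ((q - mu) * y - f) + - of_real \<kappa> * y1) * cnj z
      = of_real ((cmod z')\<^sup>2 - \<kappa>\<^sup>2 * (cmod y)\<^sup>2) + T + (q - mu) * of_real ((cmod z)\<^sup>2) - of_real \<eta> * f * cnj z"
  proof -
    have "of_real \<eta> * y1 * cnj z' + (of_real \<eta> * ((q - mu) * y - f) + - of_real \<kappa> * y1) * cnj z
      = (of_real \<eta> * y1) * cnj z' + (q - mu) * (z * cnj z) - of_real \<eta> * f * cnj z - of_real \<kappa> * (of_real \<eta> * y1) * cnj y"
      unfolding z by (simp add: algebra_simps)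
    also have "\<dots> = (z' * cnj z') - of_real (\<kappa>\<^sup>2) * (y * cnj y) + T + (q - mu) * (z * cnj z) - of_real \<eta> * f * cnj z"
      unfolding a T_def by (simp add: algebra_simps power2_eq_square)
    finally show ?thesis unfolding complex_norm_square[symmetric] by simp
  qed
  have "Re (e * (of_real ((cmod z')\<^sup>2 - \<kappa>\<^sup>2 * (cmod y)\<^sup>2))) = c * (cmod z')\<^sup>2 - c * (\<kappa>\<^sup>2 * (cmod y)\<^sup>2)"
    using e by (simp add: algebra_simps)
  moreover have "- (2 * \<kappa> * cmod y * cmod z') \<le> Re (e * T)"
  proof -
    have "cmod (e * T) \<le> \<kappa> * (cmod y * cmod z' + cmod z' * cmod y)"
      using e \<open>\<kappa> \<ge> 0\<close> norm_triangle_ineq4[of "y * cnj z'" "z' * cnj y"]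
      by (simp add: T_def norm_mult mult_left_mono)
    then show ?thesis using abs_Re_le_cmod[of "e * T"] by (simp add: algebra_simps)
  qed
  moreover have "2 * \<kappa> * cmod y * cmod z' \<le> (c/2) * (cmod z')\<^sup>2 + (2/c) * (\<kappa>\<^sup>2 * (cmod y)\<^sup>2)"
    using two_mult_le_weighted_squares[of "c/2" "cmod z'" "\<kappa> * cmod y"] e(3)
    by (simp add: power_mult_distrib mult_ac divide_simps)
  moreover have "c * (\<kappa>\<^sup>2 * (cmod y)\<^sup>2) + (2/c) * (\<kappa>\<^sup>2 * (cmod y)\<^sup>2) \<le> (3/c) * (\<kappa>\<^sup>2 * (cmod y)\<^sup>2)"
  proof -
    have "c * c \<le> 1" using c1 e(3) by (simp add: mult_le_one)
    then have "c \<le> 1/c" using e(3) by (simp add: field_simps)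
    then have "c + 2/c \<le> 3/c" using e(3) by (simp add: field_simps)
    from mult_right_mono[OF this, of "\<kappa>\<^sup>2 * (cmod y)\<^sup>2"] show ?thesis by (simp add: algebra_simps)
  qed
  moreover have "\<delta>' * (cmod (q - q0) * (cmod z)\<^sup>2) + K * (cmod z)\<^sup>2 \<le> Re (e * ((q - mu) * of_real ((cmod z)\<^sup>2)))"
  proof -
    have "e * cnj e = 1" using complex_norm_square[of e] e(1) by simp
    then have "e * (q - mu) = e * (q - q0) + of_real K"
      unfolding mu by (simp add: algebra_simps)
    then have "Re (e * (q - mu)) = Re (e * (q - q0)) + K" by simp
    then have "\<delta>' * cmod (q - q0) + K \<le> Re (e * (q - mu))" using sec by simp
    from mult_right_mono[OF this, of "(cmod z)\<^sup>2"] show ?thesis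
      unfolding mult.assoc[symmetric, of e] by (simp add: algebra_simps)
  qed
  moreover have "- ((cmod f)\<^sup>2 / 2 + (cmod z)\<^sup>2 / 2) \<le> Re (e * (- (of_real \<eta> * f * cnj z)))"
  proof -
    have "cmod (e * (- (of_real \<eta> * f * cnj z))) = \<eta> * (cmod f * cmod z)"
      using e \<eta> by (simp add: norm_mult)
    also have "\<dots> \<le> 1 * (cmod f * cmod z)" using \<eta> by (intro mult_right_mono) auto
    also have "\<dots> \<le> (cmod f)\<^sup>2 / 2 + (cmod z)\<^sup>2 / 2"
      using two_mult_le_weighted_squares[of 1 "cmod f" "cmod z"] by simp
    finally show ?thesis using abs_Re_le_cmod[of "e * (- (of_real \<eta> * f * cnj z))"] by linarith
  qed
  moreover have "Re (e * (of_real ((cmod z')\<^sup>2 - \<kappa>\<^sup>2 * (cmod y)\<^sup>2) + T + (q - mu) * of_real ((cmod z)\<^sup>2) - of_real \<eta> * f * cnj z))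
     = Re (e * (of_real ((cmod z')\<^sup>2 - \<kappa>\<^sup>2 * (cmod y)\<^sup>2))) + Re (e * T) + Re (e * ((q - mu) * of_real ((cmod z)\<^sup>2)))
      + Re (e * (- (of_real \<eta> * f * cnj z)))"
    unfolding diff_conv_add_uminus[of _ "of_real \<eta> * f * cnj z"] distrib_left plus_complex.sel by simp
  moreover have "(K - 1/2) * (cmod z)\<^sup>2 = K * (cmod z)\<^sup>2 - (cmod z)\<^sup>2 / 2" by (simp add: algebra_simps)
  ultimately show ?thesis unfolding id by linarith
qed

text \<open>Dirichlet data are included: if B = 0 then A is nonzero and a = 0, while the quotient is
  0 by convention for division by zero. Otherwise b = -(A/B) a.\<close>

lemma boundary_condition_bound:
  fixes A B a b :: complex
  assumes "A * a + B * b = 0" "cmod A + cmod B > 0"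
  shows "cmod (b * cnj a) \<le> cmod A / cmod B * (cmod a)\<^sup>2"
proof (cases "B = 0")
  case True
  then show ?thesis using assms by simp
next
  case False
  then have "b = - (A / B) * a" using assms(1) by (simp add: field_simps add_eq_0_iff)
  then show ?thesis by (simp add: norm_mult norm_divide power2_eq_square)
qed

lemma set_integrable_of_power2:
  fixes f :: "real \<Rightarrow> complex"
  assumes m: "set_borel_measurable lborel {0..b} f" and i: "set_integrable lborel {0..b} (\<lambda>x. (cmod (f x))\<^sup>2)"
  shows "set_integrable lborel {0..b} f"
proof (rule set_integrable_bound[OF _ m])
  show "set_integrable lborel {0..b} (\<lambda>x. 1 + (cmod (f x))\<^sup>2)"
    by (intro set_integral_add(1) set_integrable_const_Icc i)
  have "cmod (f x) \<le> 1 + (cmod (f x))\<^sup>2" for x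
    using zero_le_power2[of "cmod (f x) - 1"] norm_ge_zero[of "f x"] unfolding power2_diff one_power2 by linarith
  then show "AE x in lborel. x \<in> {0..b} \<longrightarrow> cmod (f x) \<le> norm (1 + (cmod (f x))\<^sup>2)"
    by (intro AE_I2) auto
qed

lemma L2_RpD:
  assumes "L2_Rp f"
  shows "set_borel_measurable lborel {0..b} f" "set_integrable lborel {0..b} (\<lambda>x. (cmod (f x))\<^sup>2)"
    "set_integrable lborel {0..b} f"
proof -
  show 1: "set_borel_measurable lborel {0..b} f"
    using assms by (auto simp: L2_Rp_def intro: set_borel_measurable_subset)
  show 2: "set_integrable lborel {0..b} (\<lambda>x. (cmod (f x))\<^sup>2)"
    using assms by (auto simp: L2_Rp_def intro: set_integrable_subset)
  show "set_integrable lborel {0..b} f" by (rule set_integrable_of_power2[OF 1 2])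
qed

lemma acd_linear_cutoff:
  assumes "acd a b y y1"
  shows "acd a b (\<lambda>x. of_real (1 - \<kappa> * x) * y x) (\<lambda>x. of_real (1 - \<kappa> * x) * y1 x - of_real \<kappa> * y x)"
proof -
  have "acd a b (\<lambda>x. 1 + (- of_real \<kappa>) * complex_of_real x) (\<lambda>x. 0 + ((- of_real \<kappa>) * 1 + 0 * complex_of_real x))"
    by (rule acd_add[OF acd_const acd_mult[OF acd_const acd_of_real]])
  moreover have "(\<lambda>x. 1 + (- of_real \<kappa>) * complex_of_real x) = (\<lambda>x. of_real (1 - \<kappa> * x))"
    "(\<lambda>x. 0 + ((- of_real \<kappa>) * 1 + 0 * complex_of_real x)) = (\<lambda>x. - of_real \<kappa>)"
    by (auto simp: fun_eq_iff)
  ultimately have "acd a b (\<lambda>x. of_real (1 - \<kappa> * x)) (\<lambda>x. - of_real \<kappa>)" by simp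
  from acd_mult[OF this assms] show ?thesis by (simp only: mult_minus_left diff_conv_add_uminus)
qed

lemma set_integral_Re:
  fixes f :: "real \<Rightarrow> complex"
  assumes "set_integrable lborel S f"
  shows "(LBINT x:S. Re (f x)) = Re (LBINT x:S. f x)" "set_integrable lborel S (\<lambda>x. Re (f x))"
  using integral_Re[OF assms[unfolded set_integrable_def]] integrable_Re[OF assms[unfolded set_integrable_def]]
  by (simp_all add: set_lebesgue_integral_def set_integrable_def)

text \<open>Integrate the pointwise bound. The constant \<open>G\<close> collects what has no sign:
  the mass of q - q0 on [0, x0] and the boundary form, both multiplied by the supremum of |z|^2.
  With the chosen \<epsilon>, G \<epsilon> is at most c/4, leaving c/4 of the energy; the part
  G/\<epsilon> of the shift absorbs the remaining multiple of the L2 norm, and 3/2 leaves 1 after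
  the share 1/2 spent on f.\<close>

lemma energy_inequality:
  fixes q :: "real \<Rightarrow> complex" and A B q0 :: complex
  assumes q: "L1_loc_Rp q" and AB: "cmod A + cmod B > 0" and x0: "x0 \<ge> 0" and c: "cos \<theta> > 0" and \<delta>: "\<delta> > 0"
    and sec: "\<forall>x>x0. \<delta> * cmod (q x - q0) \<le> Re (cis \<theta> * (q x - q0))"
  defines "c \<equiv> cos \<theta>" and "G \<equiv> (LBINT x:{0..x0}. cmod (q x - q0)) + cmod A / cmod B"
  defines "\<epsilon> \<equiv> c / (4 * (G + 1))"
  defines "mu \<equiv> q0 - of_real (3/2 + G / \<epsilon>) * cnj (cis \<theta>)"
  assumes R: "R \<ge> x0" and \<kappa>: "\<kappa> \<ge> 0" "\<kappa> * R \<le> 1"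
    and y: "acd 0 R y y1" and y1: "acd 0 R y1 (\<lambda>x. (q x - mu) * y x - f x)"
    and fm: "set_borel_measurable lborel {0..R} f" and f2: "set_integrable lborel {0..R} (\<lambda>x. (cmod (f x))\<^sup>2)"
    and bc: "A * y 0 + B * y1 0 = 0" and yR: "of_real (1 - \<kappa> * R) * y R = 0"
  defines "z \<equiv> \<lambda>x. of_real (1 - \<kappa> * x) * y x" and "z' \<equiv> \<lambda>x. of_real (1 - \<kappa> * x) * y1 x - of_real \<kappa> * y x"
  shows "(c/4) * l2sq {0..R} z' + l2sq {0..R} z
      + \<delta> * (LBINT x:{x0..R}. cmod (q x - q0) * (cmod (z x))\<^sup>2)
    \<le> l2sq {0..R} f / 2 + (3/c) * (\<kappa>\<^sup>2 * l2sq {0..R} y)"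
proof -
  define e where "e = cis \<theta>"
  define K where "K = 3/2 + G / \<epsilon>"
  define w where "w x = cmod (q x - q0)" for x
  have R0: "R \<ge> 0" using R x0 by simp
  have cpos: "c > 0" using c by (simp add: c_def)
  have N0: "(LBINT x:{0..x0}. w x) \<ge> 0" unfolding set_lebesgue_integral_def
    by (rule Bochner_Integration.integral_nonneg) (simp add: w_def)
  have G0: "G \<ge> 0" using N0 unfolding G_def w_def by simp
  have eps: "\<epsilon> > 0" using cpos G0 by (simp add: \<epsilon>_def)
  have cy: "continuous_on {0..R} y" and cy1: "continuous_on {0..R} y1"
    using y y1 AC_on_imp_continuous_on by (auto simp: acd_def)
  have cz: "continuous_on {0..R} z" and cz': "continuous_on {0..R} z'"
    unfolding z_def z'_def by (intro continuous_intros cy cy1)+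
  have z: "acd 0 R z z'" unfolding z_def z'_def by (rule acd_linear_cutoff[OF y])
  have zR: "z R = 0" using yR by (simp add: z_def)
  have z0: "z 0 = y 0" by (simp add: z_def)
  have fi: "set_integrable lborel {0..R} f" by (rule set_integrable_of_power2[OF fm f2])
  have qi: "set_integrable lborel {0..R} (\<lambda>x. q x - mu)" "set_integrable lborel {0..b} w" for b
    unfolding w_def by (intro L1_loc_RpD[OF L1_loc_Rp_diff_const[OF q]] set_integrable_norm)+
  define D where "D x = of_real (1 - \<kappa> * x) * y1 x * cnj (z' x)
      + (of_real (1 - \<kappa> * x) * ((q x - mu) * y x - f x) + - of_real \<kappa> * y1 x) * cnj (z x)" for x
  have D: "acd 0 R (\<lambda>x. (of_real (1 - \<kappa> * x) * y1 x) * cnj (z x)) D"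
    using acd_mult[OF acd_linear_cutoff[OF y1, of \<kappa>] acd_cnj[OF z]] unfolding D_def[abs_def] by simp
  have iD: "set_integrable lborel {0..R} D"
  proof -
    have "set_integrable lborel {0..R} (\<lambda>x. ((q x - mu) * y x - f x) * (of_real (1 - \<kappa> * x) * cnj (z x)))"
      by (intro set_integrable_mult_continuous set_integral_diff(1) qi fi cy continuous_intros cz)
    moreover have "set_integrable lborel {0..R} (\<lambda>x. of_real (1 - \<kappa> * x) * y1 x * cnj (z' x) + - of_real \<kappa> * y1 x * cnj (z x))"
      by (rule borel_integrable_atLeastAtMost') (intro continuous_intros cy1 cz cz')
    ultimately have "set_integrable lborel {0..R} (\<lambda>x. ((q x - mu) * y x - f x) * (of_real (1 - \<kappa> * x) * cnj (z x)) + (of_real (1 - \<kappa> * x) * y1 x * cnj (z' x) + - of_real \<kappa> * y1 x * cnj (z x)))"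
      by (rule set_integral_add(1))
    moreover have "(\<lambda>x. ((q x - mu) * y x - f x) * (of_real (1 - \<kappa> * x) * cnj (z x)) + (of_real (1 - \<kappa> * x) * y1 x * cnj (z' x) + - of_real \<kappa> * y1 x * cnj (z x))) = D"
      unfolding D_def by (rule ext) (simp add: algebra_simps)
    ultimately show ?thesis by simp
  qed
  have "(LBINT x:{0..R}. D x) = - (y1 0 * cnj (y 0))"
    using acd_LBINT[OF D R0 iD] by (simp add: zR z0)
  then have eD: "Re (LBINT x:{0..R}. e * D x) \<le> cmod A / cmod B * (cmod (z 0))\<^sup>2"
  proof -
    assume *: "(LBINT x:{0..R}. D x) = - (y1 0 * cnj (y 0))"
    have "Re (LBINT x:{0..R}. e * D x) = Re (e * - (y1 0 * cnj (y 0)))" using * by simp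
    also have "\<dots> \<le> cmod (e * - (y1 0 * cnj (y 0)))" by (rule complex_Re_le_cmod)
    also have "\<dots> = cmod (y1 0 * cnj (y 0))" by (simp add: norm_mult e_def)
    also have "\<dots> \<le> cmod A / cmod B * (cmod (z 0))\<^sup>2" unfolding z0 by (rule boundary_condition_bound[OF bc AB])
    finally show ?thesis .
  qed
  have ieD: "set_integrable lborel {0..R} (\<lambda>x. e * D x)" by (intro set_integrable_mult_right iD)
  have Re: "(LBINT x:{0..R}. Re (e * D x)) = Re (LBINT x:{0..R}. e * D x)"
    and iRe: "set_integrable lborel {0..R} (\<lambda>x. Re (e * D x))"
    by (rule set_integral_Re[OF ieD])+
  have wz: "set_integrable lborel {0..R} (\<lambda>x. w x * (cmod (z x))\<^sup>2)"
    by (intro set_integrable_mult_continuous qi continuous_intros cz)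
  have iz: "set_integrable lborel {0..R} (\<lambda>x. (cmod (z x))\<^sup>2)" "set_integrable lborel {0..R} (\<lambda>x. (cmod (z' x))\<^sup>2)"
      "set_integrable lborel {0..R} (\<lambda>x. (cmod (y x))\<^sup>2)"
    by (intro set_integrable_cmod_power2 cz cz' cy)+
  \<comment> \<open>Up to \<open>x0\<close> only the trivial bound Re (e (q - q0)) >= -|q - q0| is
    available.\<close>
  define d where "d x = (if x > x0 then \<delta> else - 1)" for x
  define P where "P x = (c/2) * (cmod (z' x))\<^sup>2 + (K - 1/2) * (cmod (z x))\<^sup>2" for x
  define N where "N x = (cmod (f x))\<^sup>2 / 2 + (3/c) * (\<kappa>\<^sup>2 * (cmod (y x))\<^sup>2)" for x
  have iP: "set_integrable lborel {0..R} P" unfolding P_def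
    by (intro set_integral_add(1) set_integrable_mult_right iz)
  have iN: "set_integrable lborel {0..R} N" unfolding N_def
    by (intro set_integral_add(1) set_integrable_mult_right set_integrable_divide iz f2)
  have idw: "set_integrable lborel {0..R} (\<lambda>x. d x * (w x * (cmod (z x))\<^sup>2))"
  proof -
    have "set_borel_measurable lborel {0..R} d" unfolding set_borel_measurable_def d_def by measurable
    moreover have "norm (d x) \<le> max \<delta> 1" for x using \<delta> by (auto simp: d_def)
    ultimately have "set_integrable lborel {0..R} (\<lambda>x. (w x * (cmod (z x))\<^sup>2) * d x)"
      by (intro set_integrable_mult_bounded[OF wz])
    then show ?thesis by (simp add: mult.commute)
  qed
  have e1: "cmod e = 1" and e2: "Re e = c" and muK: "mu = q0 - of_real K * cnj e"
    by (simp_all add: e_def c_def mu_def K_def)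
  have "(LBINT x:{0..R}. P x + d x * (w x * (cmod (z x))\<^sup>2) - N x) \<le> (LBINT x:{0..R}. Re (e * D x))"
  proof (rule set_integral_mono[OF _ iRe])
    show "set_integrable lborel {0..R} (\<lambda>x. P x + d x * (w x * (cmod (z x))\<^sup>2) - N x)"
      by (intro set_integral_diff(1) set_integral_add(1) iP idw iN)
    fix x assume x: "x \<in> {0..R}"
    have "\<kappa> * x \<le> \<kappa> * R" using x \<kappa> by (intro mult_left_mono) auto
    then have \<eta>: "0 \<le> 1 - \<kappa> * x" "1 - \<kappa> * x \<le> 1" using x \<kappa> by auto
    have "d x * cmod (q x - q0) \<le> Re (e * (q x - q0))"
      using sec[rule_format, of x] abs_Re_le_cmod[of "e * (q x - q0)"] by (auto simp: d_def e_def norm_mult)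
    from energy_density_lower_bound[OF e1 e2 cpos \<eta> \<kappa>(1) muK, of "z x" "y x" "z' x" "y1 x" "d x" "q x" "f x", OF _ _ this]
    have "(c/2) * (cmod (z' x))\<^sup>2 + (K - 1/2) * (cmod (z x))\<^sup>2 + d x * (cmod (q x - q0) * (cmod (z x))\<^sup>2) - (cmod (f x))\<^sup>2 / 2 - (3/c) * (\<kappa>\<^sup>2 * (cmod (y x))\<^sup>2)
      \<le> Re (e * D x)"
      unfolding D_def by (simp only: z_def z'_def)
    then show "P x + d x * (w x * (cmod (z x))\<^sup>2) - N x \<le> Re (e * D x)"
      unfolding P_def N_def w_def by linarith
  qed
  also have "(LBINT x:{0..R}. P x + d x * (w x * (cmod (z x))\<^sup>2) - N x) = (LBINT x:{0..R}. P x) + (LBINT x:{0..R}. d x * (w x * (cmod (z x))\<^sup>2)) - (LBINT x:{0..R}. N x)"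
    using set_integral_diff(2)[OF set_integral_add(1)[OF iP idw] iN] set_integral_add(2)[OF iP idw] by simp
  finally have main: "(LBINT x:{0..R}. P x) + (LBINT x:{0..R}. d x * (w x * (cmod (z x))\<^sup>2)) - (LBINT x:{0..R}. N x)
      \<le> cmod A / cmod B * (cmod (z 0))\<^sup>2"
    using eD Re by simp
  define Z1 Z0 where "Z1 = l2sq {0..R} z'" and "Z0 = l2sq {0..R} z"
  define S where "S = \<epsilon> * Z1 + Z0 / \<epsilon>"
  have sup: "(cmod (z x))\<^sup>2 \<le> S" if "0 \<le> x" "x \<le> R" for x
    unfolding S_def Z1_def Z0_def by (rule sup_bound_vanishing_end[OF z cz' zR that eps])
  have Peq: "(LBINT x:{0..R}. P x) = (c/2) * Z1 + (K - 1/2) * Z0"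
    unfolding P_def Z1_def Z0_def by (subst set_integral_add(2)) (auto intro!: set_integrable_mult_right iz)
  have Neq: "(LBINT x:{0..R}. N x) = l2sq {0..R} f / 2 + (3/c) * (\<kappa>\<^sup>2 * l2sq {0..R} y)"
    unfolding N_def by (subst set_integral_add(2)) (auto intro!: set_integrable_mult_right set_integrable_divide iz f2)
  have wz0: "set_integrable lborel {0..x0} (\<lambda>x. w x * (cmod (z x))\<^sup>2)" and wz1: "set_integrable lborel {x0<..R} (\<lambda>x. w x * (cmod (z x))\<^sup>2)"
    by (rule set_integrable_subset[OF wz]; use R x0 in auto)+
  have "(LBINT x:{0..R}. d x * (w x * (cmod (z x))\<^sup>2)) = (LBINT x:{0..x0}. d x * (w x * (cmod (z x))\<^sup>2)) + (LBINT x:{x0<..R}. d x * (w x * (cmod (z x))\<^sup>2))"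
    using LBINT_split_at[OF idw x0 R order_refl] by simp
  also have "(LBINT x:{0..x0}. d x * (w x * (cmod (z x))\<^sup>2)) = (LBINT x:{0..x0}. (-1) * (w x * (cmod (z x))\<^sup>2))"
    by (rule set_lebesgue_integral_cong) (auto simp: d_def)
  also have "\<dots> = - (LBINT x:{0..x0}. w x * (cmod (z x))\<^sup>2)" unfolding set_integral_mult_right by simp
  also have "(LBINT x:{x0<..R}. d x * (w x * (cmod (z x))\<^sup>2)) = (LBINT x:{x0<..R}. \<delta> * (w x * (cmod (z x))\<^sup>2))"
    by (rule set_lebesgue_integral_cong) (auto simp: d_def)
  also have "\<dots> = \<delta> * (LBINT x:{x0<..R}. w x * (cmod (z x))\<^sup>2)" by simp
  also have "(LBINT x:{x0<..R}. w x * (cmod (z x))\<^sup>2) = (LBINT x:{x0..R}. w x * (cmod (z x))\<^sup>2)"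
    unfolding set_lebesgue_integral_def
  proof (rule integral_cong_AE)
    show "AE x in lborel. indicat_real {x0<..R} x *\<^sub>R (w x * (cmod (z x))\<^sup>2) = indicat_real {x0..R} x *\<^sub>R (w x * (cmod (z x))\<^sup>2)"
      using AE_neq[of x0] by (rule eventually_mono) (auto simp: indicator_def)
    show "(\<lambda>x. indicat_real {x0<..R} x *\<^sub>R (w x * (cmod (z x))\<^sup>2)) \<in> borel_measurable lborel"
      using wz1 by (simp add: set_integrable_def borel_measurable_integrable)
    have "set_integrable lborel {x0..R} (\<lambda>x. w x * (cmod (z x))\<^sup>2)"
      by (rule set_integrable_subset[OF wz]; use R x0 in auto)
    then show "(\<lambda>x. indicat_real {x0..R} x *\<^sub>R (w x * (cmod (z x))\<^sup>2)) \<in> borel_measurable lborel"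
      by (simp add: set_integrable_def borel_measurable_integrable)
  qed
  finally have deq: "(LBINT x:{0..R}. d x * (w x * (cmod (z x))\<^sup>2)) = - (LBINT x:{0..x0}. w x * (cmod (z x))\<^sup>2) + \<delta> * (LBINT x:{x0..R}. w x * (cmod (z x))\<^sup>2)" .
  have "(LBINT x:{0..x0}. w x * (cmod (z x))\<^sup>2) \<le> (LBINT x:{0..x0}. w x * S)"
  proof (rule set_integral_mono[OF wz0])
    show "set_integrable lborel {0..x0} (\<lambda>x. w x * S)" by (intro set_integrable_mult_left qi)
    show "w x * (cmod (z x))\<^sup>2 \<le> w x * S" if "x \<in> {0..x0}" for x
      using sup[of x] that R by (intro mult_left_mono) (auto simp: w_def)
  qed
  also have "\<dots> = (LBINT x:{0..x0}. w x) * S" by simp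
  finally have "(LBINT x:{0..x0}. w x * (cmod (z x))\<^sup>2) + cmod A / cmod B * (cmod (z 0))\<^sup>2 \<le> (LBINT x:{0..x0}. w x) * S + cmod A / cmod B * S"
    using sup[of 0] R0 by (intro add_mono mult_left_mono) auto
  also have "\<dots> = G * S" by (simp add: G_def w_def algebra_simps)
  also have "\<dots> = G * \<epsilon> * Z1 + G / \<epsilon> * Z0" by (simp add: S_def algebra_simps)
  also have "\<dots> \<le> (c/4) * Z1 + G / \<epsilon> * Z0"
  proof -
    have "G * \<epsilon> \<le> c/4" using G0 cpos by (simp add: \<epsilon>_def field_simps)
    moreover have "Z1 \<ge> 0" unfolding Z1_def set_lebesgue_integral_def by (rule Bochner_Integration.integral_nonneg) simp
    ultimately have "G * \<epsilon> * Z1 \<le> (c/4) * Z1" by (rule mult_right_mono)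
    then show ?thesis by simp
  qed
  finally have "(LBINT x:{0..x0}. w x * (cmod (z x))\<^sup>2) + cmod A / cmod B * (cmod (z 0))\<^sup>2 \<le> (c/4) * Z1 + G / \<epsilon> * Z0" .
  moreover have "(K - 1/2) * Z0 = Z0 + G / \<epsilon> * Z0" by (simp add: K_def algebra_simps)
  moreover have "(c/2) * Z1 = (c/4) * Z1 + (c/4) * Z1" by simp
  ultimately have "(c/4) * Z1 + Z0 + \<delta> * (LBINT x:{x0..R}. w x * (cmod (z x))\<^sup>2) \<le> (LBINT x:{0..R}. N x)"
    using main unfolding Peq deq by linarith
  then show ?thesis unfolding Neq Z1_def Z0_def w_def .
qed

text \<open>Removes the error of the cutoff with slope 1/R by letting R tend to infinity.\<close>

lemma le_of_le_add_inverse_square: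
  fixes X a K R0 :: real
  assumes "\<And>R. R \<ge> R0 \<Longrightarrow> X \<le> a + K * (1/R)\<^sup>2"
  shows "X \<le> a"
proof -
  have "((\<lambda>R::real. 1/R) \<longlongrightarrow> 0) at_top"
    by (rule tendsto_divide_0[OF tendsto_const]) (rule filterlim_at_top_imp_at_infinity[OF filterlim_ident])
  then have "((\<lambda>R. a + K * (1/R)\<^sup>2) \<longlongrightarrow> a + K * 0\<^sup>2) at_top"
    by (intro tendsto_intros)
  then show ?thesis
    using tendsto_lowerbound[of "\<lambda>R. a + K * (1/R)\<^sup>2" "a + K * 0\<^sup>2" at_top X] assms
    by (auto simp: eventually_at_top_linorder)
qed

lemma LBINT_nonneg:
  fixes f :: "real \<Rightarrow> real"
  shows "(\<And>x. f x \<ge> 0) \<Longrightarrow> (LBINT x:S. f x) \<ge> 0"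
  unfolding set_lebesgue_integral_def by (rule Bochner_Integration.integral_nonneg) simp

text \<open>A meta-level proposition, so that an assumption of this shape applies directly as a
  rule. The condition y R = 0 permits the cutoff of slope 0, hence bounds on y1 itself; shooting
  uses this form.\<close>

abbreviation (input) finite_energy_bound :: "(real \<Rightarrow> complex) \<Rightarrow> complex \<Rightarrow> complex \<Rightarrow> complex \<Rightarrow> real \<Rightarrow> real \<Rightarrow> prop" where
  "finite_energy_bound q A B mu x0 C \<equiv> (\<And>R y y1 f. R \<ge> x0 \<Longrightarrow> acd 0 R y y1 \<Longrightarrow> acd 0 R y1 (\<lambda>x. (q x - mu) * y x - f x) \<Longrightarrow>
       set_borel_measurable lborel {0..R} f \<Longrightarrow> set_integrable lborel {0..R} (\<lambda>x. (cmod (f x))\<^sup>2) \<Longrightarrow>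
       A * y 0 + B * y1 0 = 0 \<Longrightarrow> y R = 0 \<Longrightarrow>
       l2sq {0..R} y \<le> C * l2sq {0..R} f \<and>
       l2sq {0..R} y1 \<le> C * l2sq {0..R} f)"

text \<open>Square integrability of y replaces the condition at R. The bounds are over [0, r] with a
  constant independent of r, since finiteness of the integrals of |y1|^2 and of the weighted density
  over the half line is a consequence, not a hypothesis.\<close>

abbreviation (input) global_energy_bound :: "(real \<Rightarrow> complex) \<Rightarrow> complex \<Rightarrow> complex \<Rightarrow> complex \<Rightarrow> complex \<Rightarrow> real \<Rightarrow> real \<Rightarrow> prop" where
  "global_energy_bound q A B q0 mu x0 C \<equiv> (\<And>y y1 f r. (\<forall>b\<ge>0. acd 0 b y y1) \<Longrightarrow> (\<forall>b\<ge>0. acd 0 b y1 (\<lambda>x. (q x - mu) * y x - f x)) \<Longrightarrow>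
       L2_Rp y \<Longrightarrow> L2_Rp f \<Longrightarrow> A * y 0 + B * y1 0 = 0 \<Longrightarrow> r \<ge> x0 \<Longrightarrow>
       l2sq {0..r} y \<le> C * l2sq {0..} f \<and>
       l2sq {0..r} y1 \<le> C * l2sq {0..} f \<and>
       (LBINT x:{x0..r}. cmod (q x - q0) * (cmod (y x))\<^sup>2) \<le> C * l2sq {0..} f)"

text \<open>Both bounds are instances of \<open>energy_inequality\<close> with the same
  \<open>mu\<close>: slope \<kappa> = 0 when y R = 0, and \<kappa> = 1/R with R tending to infinity
  on the half line.\<close>

lemma energy_estimates:
  fixes q :: "real \<Rightarrow> complex" and A B :: complex
  assumes q: "L1_loc_Rp q" and sect: "sectorial q" and AB: "cmod A + cmod B > 0"
  obtains x0 q0 mu C where "x0 \<ge> 0" "C > 0"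
    "PROP finite_energy_bound q A B mu x0 C"
    "PROP global_energy_bound q A B q0 mu x0 C"
proof -
  obtain x0 q0 \<theta> \<delta> where x0: "x0 \<ge> 0" and c: "cos \<theta> > 0" and \<delta>: "\<delta> > 0"
    and sec: "\<forall>x>x0. \<delta> * cmod (q x - q0) \<le> Re (cis \<theta> * (q x - q0))"
    by (rule sectorial_rotation[OF sect])
  define c where "c = cos \<theta>"
  have cpos: "c > 0" using c by (simp add: c_def)
  define G where "G = (LBINT x:{0..x0}. cmod (q x - q0)) + cmod A / cmod B"
  define mu where "mu = q0 - of_real (3/2 + G / (c / (4 * (G + 1)))) * cnj (cis \<theta>)"
  note energy = energy_inequality[OF q AB x0 c \<delta> sec, folded c_def, folded G_def, folded mu_def]
  \<comment> \<open>A common lower bound for the three coefficients of the energy, so that each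
    nonnegative term can be read off separately.\<close>
  define m where "m = min (c/4) (min 1 \<delta>)"
  have m: "m > 0" "m \<le> c/4" "m \<le> 1" "m \<le> \<delta>" using cpos \<delta> by (auto simp: m_def)
  have split: "m * a \<le> s \<and> m * b \<le> s \<and> m * d \<le> s"
    if "(c/4) * a + b + \<delta> * d \<le> s" "a \<ge> 0" "b \<ge> 0" "d \<ge> 0" for a b d s :: real
  proof -
    have "m * a \<le> (c/4) * a" "m * b \<le> 1 * b" "m * d \<le> \<delta> * d" using m that by (intro mult_right_mono; simp)+
    moreover have "(c/4) * a \<ge> 0" "\<delta> * d \<ge> 0" using that cpos \<delta> by auto
    ultimately show ?thesis using that by linarith
  qed
  \<comment> \<open>The energy is at most half the squared norm of f, and recovering
    \<open>y1\<close> from z' below costs a factor 8.\<close>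
  define C where "C = 4 / m"
  have C: "C > 0" using m by (simp add: C_def)
  show thesis
  proof (rule that[OF x0 C])
    fix R y y1 f
    assume R: "R \<ge> x0" and y: "acd 0 R y y1" and y1: "acd 0 R y1 (\<lambda>x. (q x - mu) * y x - f x)"
      and fm: "set_borel_measurable lborel {0..R} f" and f2: "set_integrable lborel {0..R} (\<lambda>x. (cmod (f x))\<^sup>2)"
      and bc: "A * y 0 + B * y1 0 = 0" and yR: "y R = 0"
    let ?F = "LBINT x:{0..R}. (cmod (f x))\<^sup>2"
    have nn: "l2sq {0..R} y1 \<ge> 0" "l2sq {0..R} y \<ge> 0"
        "(LBINT x:{x0..R}. cmod (q x - q0) * (cmod (y x))\<^sup>2) \<ge> 0"
      by (rule LBINT_nonneg; simp)+
    have "(c/4) * l2sq {0..R} y1 + l2sq {0..R} y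
      + \<delta> * (LBINT x:{x0..R}. cmod (q x - q0) * (cmod (y x))\<^sup>2) \<le> ?F / 2"
      using energy[OF R order_refl _ y y1 fm f2 bc, simplified] yR by simp
    from split[OF this nn] have "m * l2sq {0..R} y1 \<le> ?F / 2" "m * l2sq {0..R} y \<le> ?F / 2"
      by blast+
    moreover have "?F \<ge> 0" by (rule LBINT_nonneg) simp
    ultimately show "l2sq {0..R} y \<le> C * ?F \<and> l2sq {0..R} y1 \<le> C * ?F"
      using m by (simp add: C_def field_simps)
  next
    fix y y1 f r
    assume y: "\<forall>b\<ge>0. acd 0 b y y1" and y1: "\<forall>b\<ge>0. acd 0 b y1 (\<lambda>x. (q x - mu) * y x - f x)"
      and Ly: "L2_Rp y" and Lf: "L2_Rp f" and bc: "A * y 0 + B * y1 0 = 0" and r: "r \<ge> x0"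
    let ?F = "LBINT x:{0..}. (cmod (f x))\<^sup>2" and ?Y = "LBINT x:{0..}. (cmod (y x))\<^sup>2"
    have r0: "r \<ge> 0" using r x0 by simp
    have cy: "continuous_on {0..b} y" and cy1: "continuous_on {0..b} y1" for b
      using acd_all_continuous_on[OF y] acd_all_continuous_on[OF y1] by (auto intro: continuous_on_subset)
    have qi: "set_integrable lborel {0..b} (\<lambda>x. cmod (q x - q0))" for b
      by (intro set_integrable_norm L1_loc_RpD[OF L1_loc_Rp_diff_const[OF q]])
    have Y0: "?Y \<ge> 0" "?F \<ge> 0" by (rule LBINT_nonneg; simp)+
    \<comment> \<open>Collects the errors of order \<kappa>^2: the term 3/c of the energy inequality
      enlarged by 8/m, and the term \<kappa> y in \<eta> y1 = z' + \<kappa> y with factor 8.\<close>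
    define K where "K = (24 / (c * m) + 8) * ?Y"
    have bound: "l2sq {0..r} y \<le> C * ?F + K * (1/R)\<^sup>2 \<and>
       l2sq {0..r} y1 \<le> C * ?F + K * (1/R)\<^sup>2 \<and>
       (LBINT x:{x0..r}. cmod (q x - q0) * (cmod (y x))\<^sup>2) \<le> C * ?F + K * (1/R)\<^sup>2"
      \<comment> \<open>For such R the cutoff is at least 1/2 on [0, r], so y and y1 are recovered
        from z and z' with fixed factors.\<close>
      if Rr: "R \<ge> 2 * r + 1" for R
    proof -
      have R: "R > 0" "R \<ge> x0" "R \<ge> r" "R \<ge> 0" using Rr r r0 by auto
      define \<kappa> where "\<kappa> = 1 / R"
      have \<kappa>: "\<kappa> \<ge> 0" "\<kappa> * R = 1" using R by (auto simp: \<kappa>_def)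
      define z where "z x = of_real (1 - \<kappa> * x) * y x" for x
      define z' where "z' x = of_real (1 - \<kappa> * x) * y1 x - of_real \<kappa> * y x" for x
      have cz: "continuous_on {0..b} z" and cz': "continuous_on {0..b} z'" for b
        unfolding z_def z'_def by (intro continuous_intros cy cy1)+
      have F: "l2sq {0..R} f \<le> ?F" and Y: "l2sq {0..R} y \<le> ?Y"
        by (rule LBINT_mono_set; use Lf Ly in \<open>auto simp: L2_Rp_def\<close>)+
      define s where "s = ?F / 2 + (3/c) * (\<kappa>\<^sup>2 * ?Y)"
      have "(c/4) * l2sq {0..R} z' + l2sq {0..R} z
        + \<delta> * (LBINT x:{x0..R}. cmod (q x - q0) * (cmod (z x))\<^sup>2)
        \<le> l2sq {0..R} f / 2 + (3/c) * (\<kappa>\<^sup>2 * l2sq {0..R} y)"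
        unfolding z_def z'_def
        by (rule energy) (use R \<kappa> y y1 bc L2_RpD[OF Lf] in auto)
      also have "\<dots> \<le> s" unfolding s_def using F Y cpos by (intro add_mono mult_left_mono divide_right_mono) auto
      finally have e: "m * l2sq {0..R} z' \<le> s \<and> m * l2sq {0..R} z \<le> s \<and>
         m * (LBINT x:{x0..R}. cmod (q x - q0) * (cmod (z x))\<^sup>2) \<le> s"
        by (rule split) (auto intro!: LBINT_nonneg)
      have half: "1/2 \<le> 1 - \<kappa> * x" if "x \<in> {0..r}" for x
      proof -
        have "\<kappa> * x \<le> \<kappa> * (R/2)" using that Rr \<kappa> by (intro mult_left_mono) auto
        then show ?thesis using \<kappa> by simp
      qed
      have yz: "(cmod (y x))\<^sup>2 \<le> 4 * (cmod (z x))\<^sup>2" if "x \<in> {0..r}" for x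
      proof -
        have "1/2 * cmod (y x) \<le> cmod (z x)"
          unfolding z_def norm_mult norm_of_real using half[OF that] by (intro mult_right_mono) auto
        from power_mono[OF this, of 2] show ?thesis by (simp add: power_mult_distrib power_divide)
      qed
      have y1z: "(cmod (y1 x))\<^sup>2 \<le> 8 * (cmod (z' x))\<^sup>2 + 8 * \<kappa>\<^sup>2 * (cmod (y x))\<^sup>2" if "x \<in> {0..r}" for x
      proof -
        have "1/2 * cmod (y1 x) \<le> cmod (of_real (1 - \<kappa> * x) * y1 x)"
          unfolding norm_mult norm_of_real using half[OF that] by (intro mult_right_mono) auto
        from power_mono[OF this, of 2] have "(cmod (y1 x))\<^sup>2 \<le> 4 * (cmod (of_real (1 - \<kappa> * x) * y1 x))\<^sup>2"
          by (simp add: power_mult_distrib power_divide)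
        also have "of_real (1 - \<kappa> * x) * y1 x = z' x + of_real \<kappa> * y x" by (simp add: z'_def)
        also have "4 * (cmod (z' x + of_real \<kappa> * y x))\<^sup>2 \<le> 4 * (2 * (cmod (z' x))\<^sup>2 + 2 * (cmod (of_real \<kappa> * y x))\<^sup>2)"
          by (intro mult_left_mono norm_add_power2_le) simp
        finally show ?thesis by (simp add: norm_mult power_mult_distrib)
      qed
      have iz: "set_integrable lborel {0..b} (\<lambda>x. (cmod (z x))\<^sup>2)" "set_integrable lborel {0..b} (\<lambda>x. (cmod (z' x))\<^sup>2)"
        "set_integrable lborel {0..b} (\<lambda>x. (cmod (y x))\<^sup>2)" "set_integrable lborel {0..b} (\<lambda>x. (cmod (y1 x))\<^sup>2)" for b
        by (intro set_integrable_cmod_power2 cz cz' cy cy1)+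
      have iw: "set_integrable lborel {x0..b} (\<lambda>x. cmod (q x - q0) * (cmod (z x))\<^sup>2)" "set_integrable lborel {x0..b} (\<lambda>x. cmod (q x - q0) * (cmod (y x))\<^sup>2)" for b
      proof -
        have "set_integrable lborel {0..b} (\<lambda>x. cmod (q x - q0) * (cmod (z x))\<^sup>2)" "set_integrable lborel {0..b} (\<lambda>x. cmod (q x - q0) * (cmod (y x))\<^sup>2)"
          by (intro set_integrable_mult_continuous qi continuous_intros cz cy)+
        then show "set_integrable lborel {x0..b} (\<lambda>x. cmod (q x - q0) * (cmod (z x))\<^sup>2)" "set_integrable lborel {x0..b} (\<lambda>x. cmod (q x - q0) * (cmod (y x))\<^sup>2)"
          using x0 by - (erule set_integrable_subset; simp)+
      qed
      have "l2sq {0..r} y \<le> (LBINT x:{0..r}. 4 * (cmod (z x))\<^sup>2)"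
        by (rule set_integral_mono[OF iz(3) set_integrable_mult_right[OF iz(1)] yz])
      also have "\<dots> \<le> (LBINT x:{0..R}. 4 * (cmod (z x))\<^sup>2)"
        by (rule LBINT_mono_set[OF set_integrable_mult_right[OF iz(1)]]) (use R in auto)
      also have "\<dots> \<le> 4 * (s / m)" using e m by (simp add: field_simps)
      finally have 1: "l2sq {0..r} y \<le> 4 * (s / m)" .
      have "(LBINT x:{x0..r}. cmod (q x - q0) * (cmod (y x))\<^sup>2) \<le> (LBINT x:{x0..r}. 4 * (cmod (q x - q0) * (cmod (z x))\<^sup>2))"
      proof (rule set_integral_mono[OF iw(2) set_integrable_mult_right[OF iw(1)]])
        fix x assume "x \<in> {x0..r}"
        then show "cmod (q x - q0) * (cmod (y x))\<^sup>2 \<le> 4 * (cmod (q x - q0) * (cmod (z x))\<^sup>2)"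
          using mult_left_mono[OF yz[of x], of "cmod (q x - q0)"] x0 by simp
      qed
      also have "\<dots> \<le> (LBINT x:{x0..R}. 4 * (cmod (q x - q0) * (cmod (z x))\<^sup>2))"
        by (rule LBINT_mono_set[OF set_integrable_mult_right[OF iw(1)]]) (use R in auto)
      also have "\<dots> \<le> 4 * (s / m)" using e m by (simp add: field_simps)
      finally have 2: "(LBINT x:{x0..r}. cmod (q x - q0) * (cmod (y x))\<^sup>2) \<le> 4 * (s / m)" .
      have i3: "set_integrable lborel {0..b} (\<lambda>x. 8 * (cmod (z' x))\<^sup>2 + 8 * \<kappa>\<^sup>2 * (cmod (y x))\<^sup>2)" for b
        by (intro set_integral_add(1) set_integrable_mult_right iz)
      have "l2sq {0..r} y1 \<le> (LBINT x:{0..r}. 8 * (cmod (z' x))\<^sup>2 + 8 * \<kappa>\<^sup>2 * (cmod (y x))\<^sup>2)"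
        by (rule set_integral_mono[OF iz(4) i3 y1z])
      also have "\<dots> \<le> (LBINT x:{0..R}. 8 * (cmod (z' x))\<^sup>2 + 8 * \<kappa>\<^sup>2 * (cmod (y x))\<^sup>2)"
        by (rule LBINT_mono_set[OF i3]) (use R in auto)
      also have "\<dots> = 8 * l2sq {0..R} z' + 8 * \<kappa>\<^sup>2 * l2sq {0..R} y"
        by (subst set_integral_add(2)) (auto intro!: set_integrable_mult_right iz)
      also have "\<dots> \<le> 8 * (s / m) + 8 * \<kappa>\<^sup>2 * ?Y"
        using e m Y by (intro add_mono mult_left_mono) (auto simp: field_simps)
      finally have 3: "l2sq {0..r} y1 \<le> 8 * (s / m) + 8 * \<kappa>\<^sup>2 * ?Y" .
      have "s / m = ?F / (2 * m) + 3 / (c * m) * ?Y * \<kappa>\<^sup>2"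
        unfolding s_def using m cpos by (simp add: add_divide_distrib)
      moreover have "8 * (?F / (2 * m)) = C * ?F" by (simp add: C_def)
      moreover have "8 * (3 / (c * m) * ?Y * \<kappa>\<^sup>2) = 24 / (c * m) * ?Y * \<kappa>\<^sup>2" by simp
      moreover have "K * \<kappa>\<^sup>2 = 24 / (c * m) * ?Y * \<kappa>\<^sup>2 + 8 * \<kappa>\<^sup>2 * ?Y"
        unfolding K_def distrib_right by (simp only: mult_ac)
      ultimately have K\<kappa>: "8 * (s / m) + 8 * \<kappa>\<^sup>2 * ?Y = C * ?F + K * (1/R)\<^sup>2"
        unfolding \<kappa>_def[symmetric] by linarith
      have "s \<ge> 0" using Y0 cpos by (simp add: s_def)
      then have "s / m \<ge> 0" "8 * \<kappa>\<^sup>2 * ?Y \<ge> 0" using m Y0 by simp_all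
      then have "4 * (s / m) \<le> 8 * (s / m) + 8 * \<kappa>\<^sup>2 * ?Y" by linarith
      with 1 2 3 show ?thesis unfolding K\<kappa> by linarith
    qed
    show "l2sq {0..r} y \<le> C * ?F \<and> l2sq {0..r} y1 \<le> C * ?F \<and>
       (LBINT x:{x0..r}. cmod (q x - q0) * (cmod (y x))\<^sup>2) \<le> C * ?F"
      by (intro conjI; rule le_of_le_add_inverse_square[where K=K and ?R0.0="2 * r + 1"]; drule bound; elim conjE; assumption)
  qed
qed

section \<open>The resolvent set\<close>

text \<open>Monotone convergence along [0, n]; this is how the bounds over [0, r] become statements
  about the L2 norm on the half line.\<close>

lemma L2_Rp_of_bounded_LBINT:
  assumes cont: "continuous_on {0..} y" and bound: "\<And>r. r \<ge> r0 \<Longrightarrow> l2sq {0..r} y \<le> M"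
  shows "L2_Rp y" "l2sq {0..} y \<le> M"
proof -
  let ?g = "\<lambda>x. (cmod (y x))\<^sup>2"
  have gi: "set_integrable lborel {0..b} ?g" for b
    by (rule set_integrable_cmod_power2) (rule continuous_on_subset[OF cont], auto)
  have U: "(\<Union>n. {0..real n}) = {0..}"
    using real_arch_simple by auto
  have inc: "incseq (\<lambda>n. LBINT x:{0..real n}. ?g x)"
    by (intro incseq_SucI LBINT_mono_set[OF gi]) auto
  have le: "(LBINT x:{0..real n}. ?g x) \<le> M" for n
  proof -
    have "(LBINT x:{0..real n}. ?g x) \<le> (LBINT x:{0..max r0 (real n)}. ?g x)"
      by (rule LBINT_mono_set[OF gi]) auto
    also have "\<dots> \<le> M" by (rule bound) simp
    finally show ?thesis .
  qed
  obtain l where l: "(\<lambda>n. LBINT x:{0..real n}. ?g x) \<longlonglongrightarrow> l"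
    using incseq_convergent[OF inc] le by blast
  have i: "set_integrable lborel {0..} ?g"
    using pos_integrable_to_top[of "\<lambda>n. {0..real n}" lborel ?g l] l gi
    unfolding U by (auto simp: mono_def)
  have m: "set_borel_measurable lborel {0..} y" by (rule continuous_imp_set_borel_measurable[OF cont]) simp
  show "L2_Rp y" using i m by (simp add: L2_Rp_def)
  have "(\<lambda>n. LBINT x:{0..real n}. ?g x) \<longlonglongrightarrow> (LBINT x:(\<Union>n. {0..real n}). ?g x)"
    by (rule set_integral_cont_up) (use i U in \<open>auto simp: incseq_def\<close>)
  then show "(LBINT x:{0..}. ?g x) \<le> M"
    unfolding U using le by (intro LIMSEQ_le_const2) auto
qed

lemma continuous_zero_of_LBINT:
  fixes g :: "real \<Rightarrow> complex"
  assumes g: "continuous_on {0..R} g" and "R > 0" and le: "l2sq {0..R} g \<le> 0" and x: "x \<in> {0..R}"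
  shows "g x = 0"
proof -
  have "l2sq {0..R} g = 0" by (rule antisym[OF le LBINT_nonneg]) simp
  moreover have "l2sq {0..R} g = integral {0..R} (\<lambda>x. (cmod (g x))\<^sup>2)"
    by (rule set_borel_integral_eq_integral(2)[OF set_integrable_cmod_power2[OF g]])
  ultimately have "integral {0..R} (\<lambda>x. (cmod (g x))\<^sup>2) = 0" by simp
  moreover have "continuous_on {0..R} (\<lambda>x. (cmod (g x))\<^sup>2)" by (intro continuous_intros g)
  ultimately have "\<forall>x\<in>{0..R}. (cmod (g x))\<^sup>2 = 0"
    using integral_eq_0_iff[of 0 R "\<lambda>x. (cmod (g x))\<^sup>2"] \<open>R > 0\<close> by simp
  then show ?thesis using x by simp
qed

lemma LBINT_add_power2_le:
  fixes f g :: "real \<Rightarrow> complex"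
  assumes "continuous_on {a..b} f" "continuous_on {a..b} g"
  shows "(LBINT x:{a..b}. (cmod (f x + g x))\<^sup>2) \<le> 2 * l2sq {a..b} f + 2 * l2sq {a..b} g"
proof -
  have i: "set_integrable lborel {a..b} (\<lambda>x. (cmod (f x))\<^sup>2)" "set_integrable lborel {a..b} (\<lambda>x. (cmod (g x))\<^sup>2)"
    "set_integrable lborel {a..b} (\<lambda>x. (cmod (f x + g x))\<^sup>2)"
    by (intro set_integrable_cmod_power2 continuous_intros assms)+
  have "(LBINT x:{a..b}. (cmod (f x + g x))\<^sup>2) \<le> (LBINT x:{a..b}. 2 * (cmod (f x))\<^sup>2 + 2 * (cmod (g x))\<^sup>2)"
    by (rule set_integral_mono[OF i(3) set_integral_add(1)]) (auto intro!: set_integrable_mult_right i norm_add_power2_le)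
  also have "\<dots> = 2 * l2sq {a..b} f + 2 * l2sq {a..b} g"
    by (subst set_integral_add(2)) (auto intro!: set_integrable_mult_right i)
  finally show ?thesis .
qed

lemma acd_add_cmult:
  assumes "acd a b w w'" "acd a b u u'" shows "acd a b (\<lambda>x. w x + c * u x) (\<lambda>x. w' x + c * u' x)"
  using acd_add[OF assms(1) acd_mult[OF acd_const assms(2)], of c] by simp

lemma continuous_on_Icc_of_acd: "\<forall>b\<ge>0. acd 0 b F F' \<Longrightarrow> continuous_on {0..b} F"
  by (rule continuous_on_subset[OF acd_all_continuous_on]) auto

text \<open>Shooting: solve on [0,b] with y b = 0 by adding a multiple of the homogeneous solution that
  satisfies the boundary condition at 0. The energy estimate bounds the multiples, and a limit
  point of them as b tends to infinity yields the square integrable solution.\<close>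
lemma boundary_value_problem_solvable:
  fixes q :: "real \<Rightarrow> complex" and A B mu :: complex
  assumes q: "L1_loc_Rp q" and AB: "cmod A + cmod B > 0" and x0: "x0 \<ge> 0" and C: "C > 0"
    and energy: "PROP finite_energy_bound q A B mu x0 C"
    and f: "L2_Rp f"
  shows "\<exists>y y1. (\<forall>b\<ge>0. acd 0 b y y1) \<and> (\<forall>b\<ge>0. acd 0 b y1 (\<lambda>x. (q x - mu) * y x - f x)) \<and>
     L2_Rp y \<and> A * y 0 + B * y1 0 = 0"
proof -
  have L1: "L1_loc_Rp (\<lambda>_. 1)" "L1_loc_Rp (\<lambda>_. 0)" by (auto simp: L1_loc_Rp_def intro: set_integrable_const_Icc)
  have Lp: "L1_loc_Rp (\<lambda>x. q x - mu)" by (rule L1_loc_Rp_diff_const[OF q])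
  have Lf: "L1_loc_Rp (\<lambda>x. - f x)" using L2_RpD(3)[OF f] by (auto simp: L1_loc_Rp_def set_integrable_def)
  \<comment> \<open>The initial data (B, -A) satisfy A u(0) + B v(0) = 0, so adding multiples of u
    to the particular solution w preserves the boundary condition.\<close>
  obtain u v where uv: "\<forall>b\<ge>0. acd 0 b u (\<lambda>x. 1 * v x) \<and> acd 0 b v (\<lambda>x. (q x - mu) * u x + 0)" and uv0: "u 0 = B" "v 0 = - A"
    using linear_system_exists[OF L1(1) Lp L1(2), of B "- A"] by blast
  obtain w w1 where ww: "\<forall>b\<ge>0. acd 0 b w (\<lambda>x. 1 * w1 x) \<and> acd 0 b w1 (\<lambda>x. (q x - mu) * w x + - f x)" and ww0: "w 0 = 0" "w1 0 = 0"
    using linear_system_exists[OF L1(1) Lp Lf, of 0 0] by blast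
  have u: "\<forall>b\<ge>0. acd 0 b u v" and v: "\<forall>b\<ge>0. acd 0 b v (\<lambda>x. (q x - mu) * u x)" using uv by auto
  have w: "\<forall>b\<ge>0. acd 0 b w w1" and w1: "\<forall>b\<ge>0. acd 0 b w1 (\<lambda>x. (q x - mu) * w x - f x)" using ww by auto
  note cu = continuous_on_Icc_of_acd[OF u] and cv = continuous_on_Icc_of_acd[OF v] and cw = continuous_on_Icc_of_acd[OF w]
  define Y where "Y c x = w x + c * u x" for c x
  define Y1 where "Y1 c x = w1 x + c * v x" for c x
  have Y: "\<forall>b\<ge>0. acd 0 b (Y c) (Y1 c)" for c
    unfolding Y_def[abs_def] Y1_def[abs_def] using w u by (auto intro: acd_add_cmult)
  have Y1: "\<forall>b\<ge>0. acd 0 b (Y1 c) (\<lambda>x. (q x - mu) * Y c x - f x)" for c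
  proof (intro allI impI)
    fix b :: real assume "b \<ge> 0"
    then have "acd 0 b (Y1 c) (\<lambda>x. ((q x - mu) * w x - f x) + c * ((q x - mu) * u x))"
      unfolding Y1_def[abs_def] using w1 v by (auto intro: acd_add_cmult)
    moreover have "(\<lambda>x. ((q x - mu) * w x - f x) + c * ((q x - mu) * u x)) = (\<lambda>x. (q x - mu) * Y c x - f x)"
      by (rule ext) (simp add: Y_def algebra_simps)
    ultimately show "acd 0 b (Y1 c) (\<lambda>x. (q x - mu) * Y c x - f x)" by simp
  qed
  have bc: "A * Y c 0 + B * Y1 c 0 = 0" for c by (simp add: Y_def Y1_def uv0 ww0)
  have cY: "continuous_on {0..b} (Y c)" for b c by (rule continuous_on_Icc_of_acd[OF Y])
  \<comment> \<open>A zero at R would make u a solution of the problem on [0, R] with f = 0; the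
    energy bound then forces u and v to vanish at 0, that is A = B = 0.\<close>
  have nz: "u R \<noteq> 0" if R: "R \<ge> x0" "R > 0" for R
  proof
    assume uR: "u R = 0"
    have 0: "set_borel_measurable lborel {0..R} (\<lambda>x. 0::complex)" "set_integrable lborel {0..R} (\<lambda>x. (cmod 0)\<^sup>2)"
      by (auto simp: set_borel_measurable_def set_integrable_def)
    have v': "acd 0 R v (\<lambda>x. (q x - mu) * u x - 0)" using v R by simp
    have bc0: "A * u 0 + B * v 0 = 0" by (simp add: uv0)
    have uR': "acd 0 R u v" using u R by simp
    have "l2sq {0..R} u \<le> 0" "l2sq {0..R} v \<le> 0"
      using energy[OF R(1) uR' v' 0 bc0 uR] by simp_all
    then have "u 0 = 0" "v 0 = 0" using continuous_zero_of_LBINT[OF cu R(2), of 0] continuous_zero_of_LBINT[OF cv R(2), of 0] R by auto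
    then show False using uv0 AB by simp
  qed
  define b where "b n = x0 + 1 + real n" for n
  define c where "c n = - w (b n) / u (b n)" for n
  have b: "b n \<ge> x0" "b n > 0" for n using x0 by (auto simp: b_def)
  have Yb: "Y (c n) (b n) = 0" for n using nz[OF b] by (simp add: Y_def c_def)
  let ?F = "LBINT x:{0..}. (cmod (f x))\<^sup>2"
  have F0: "?F \<ge> 0" by (rule LBINT_nonneg) simp
  have En: "l2sq {0..r} (Y (c n)) \<le> C * ?F" if "r \<le> b n" for n r
  proof -
    have a1: "acd 0 (b n) (Y (c n)) (Y1 (c n))" "acd 0 (b n) (Y1 (c n)) (\<lambda>x. (q x - mu) * Y (c n) x - f x)"
      using Y Y1 b(2)[of n] by auto
    have "l2sq {0..r} (Y (c n)) \<le> l2sq {0..b n} (Y (c n))"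
      by (rule LBINT_mono_set[OF set_integrable_cmod_power2[OF cY]]) (use that in auto)
    also have "\<dots> \<le> C * l2sq {0..b n} f"
      using energy[OF b(1) a1 L2_RpD(1)[OF f] L2_RpD(2)[OF f] bc Yb] by simp
    also have "\<dots> \<le> C * ?F"
      by (intro mult_left_mono LBINT_mono_set) (use C f in \<open>auto simp: L2_Rp_def\<close>)
    finally show ?thesis .
  qed
  define r1 where "r1 = x0 + 1"
  have r1: "r1 > 0" "r1 \<ge> x0" "r1 \<le> b n" for n using x0 by (auto simp: r1_def b_def)
  define U where "U = l2sq {0..r1} u"
  have U: "U > 0"
  proof (rule ccontr)
    assume "\<not> U > 0"
    then have "u r1 = 0" using continuous_zero_of_LBINT[OF cu r1(1), of r1] r1 by (simp add: U_def)
    then show False using nz r1 by blast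
  qed
  define W where "W = l2sq {0..r1} w"
  \<comment> \<open>On the fixed interval [0, r1], \<open>c n\<close> times u is the difference of
    \<open>Y (c n)\<close>, bounded uniformly in n by the energy estimate, and the fixed function w,
    while u has positive L2 norm there.\<close>
  have cb: "(cmod (c n))\<^sup>2 \<le> (2 * (C * ?F) + 2 * W) / U" for n
  proof -
    have "(cmod (c n))\<^sup>2 * U = (LBINT x:{0..r1}. (cmod (Y (c n) x + - w x))\<^sup>2)"
      unfolding U_def set_integral_mult_right[symmetric] by (simp add: Y_def norm_mult power_mult_distrib)
    also have "\<dots> \<le> 2 * l2sq {0..r1} (Y (c n)) + 2 * (LBINT x:{0..r1}. (cmod (- w x))\<^sup>2)"
      by (intro LBINT_add_power2_le cY continuous_intros cw)
    also have "\<dots> \<le> 2 * (C * ?F) + 2 * W" using En[OF r1(3)] by (simp add: W_def)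
    finally show ?thesis using U by (simp add: field_simps)
  qed
  have "bounded (range c)"
    unfolding bounded_iff using cb by (auto intro!: exI[of _ "sqrt ((2 * (C * ?F) + 2 * W) / U)"] real_le_rsqrt)
  then obtain l k where k: "strict_mono (k :: nat \<Rightarrow> nat)" and l: "(c \<circ> k) \<longlonglongrightarrow> l"
    using bounded_imp_convergent_subsequence by blast
  have cYl: "continuous_on {0..} (Y l)" by (rule acd_all_continuous_on[OF Y])
  \<comment> \<open>The index n is chosen for each r, large enough that b (k n) exceeds r and that
    replacing \<open>c (k n)\<close> by \<open>l\<close> changes the solution on [0, r] by less than
    1 in squared norm; the resulting bound no longer depends on r.\<close>
  have "l2sq {0..r} (Y l) \<le> 2 * (C * ?F) + 2" if "r \<ge> 0" for r
  proof -
    define V where "V = l2sq {0..r} u"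
    have V: "V \<ge> 0" unfolding V_def by (rule LBINT_nonneg) simp
    have "(\<lambda>n. (cmod (l - c (k n)))\<^sup>2 * V) \<longlonglongrightarrow> (cmod (l - l))\<^sup>2 * V"
      using l by (intro tendsto_intros) (simp add: o_def)
    then have "(\<lambda>n. (cmod (l - c (k n)))\<^sup>2 * V) \<longlonglongrightarrow> 0" by simp
    then have "\<forall>\<^sub>F n in sequentially. (cmod (l - c (k n)))\<^sup>2 * V < 1" by (rule order_tendstoD) simp
    moreover obtain N :: nat where N: "r \<le> real N" using real_arch_simple by blast
    ultimately obtain n where n: "n \<ge> N" "(cmod (l - c (k n)))\<^sup>2 * V < 1"
      unfolding eventually_sequentially by (meson nat_le_linear order_refl)
    have "r \<le> b (k n)" using N n(1) seq_suble[OF k, of n] x0 by (simp add: b_def)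
    then have 1: "(LBINT x:{0..r}. (cmod (Y (c (k n)) x))\<^sup>2) \<le> C * ?F" by (rule En)
    have "l2sq {0..r} (Y l) = (LBINT x:{0..r}. (cmod (Y (c (k n)) x + (l - c (k n)) * u x))\<^sup>2)"
      by (simp add: Y_def algebra_simps)
    also have "\<dots> \<le> 2 * (LBINT x:{0..r}. (cmod (Y (c (k n)) x))\<^sup>2) + 2 * (LBINT x:{0..r}. (cmod ((l - c (k n)) * u x))\<^sup>2)"
      by (intro LBINT_add_power2_le cY continuous_intros cu)
    also have "(LBINT x:{0..r}. (cmod ((l - c (k n)) * u x))\<^sup>2) = (cmod (l - c (k n)))\<^sup>2 * V"
      unfolding V_def set_integral_mult_right[symmetric] by (simp add: norm_mult power_mult_distrib)
    finally show ?thesis using 1 n(2) by linarith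
  qed
  then have "L2_Rp (Y l)" by (rule L2_Rp_of_bounded_LBINT(1)[OF cYl])
  with Y Y1 bc show ?thesis by blast
qed

text \<open>Since \<open>acd\<close> tolerates changes on null sets, the equation can be read with
  the explicit derivative y1' = (q - mu) y - f for f = g - mu y, the form in which the energy bounds
  are stated.\<close>

lemma LU_graph_acd:
  assumes "(y, g) \<in> LU_graph q A B"
  obtains y1 where "\<forall>b\<ge>0. acd 0 b y y1" "\<forall>b\<ge>0. acd 0 b y1 (\<lambda>x. (q x - mu) * y x - (g x - mu * y x))"
    "L2_Rp y" "L2_Rp (\<lambda>x. g x - mu * y x)" "A * y 0 + B * y1 0 = 0"
proof -
  obtain y1 y2 where *: "L2_Rp y" "L2_Rp g" "\<forall>b\<ge>0. acd 0 b y y1" "\<forall>b\<ge>0. acd 0 b y1 y2"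
     "ae_eq_Rp g (\<lambda>x. - y2 x + q x * y x)" "A * y 0 + B * y1 0 = 0"
    using assms unfolding LU_graph_iff by blast
  have "\<forall>b\<ge>0. acd 0 b y1 (\<lambda>x. (q x - mu) * y x - (g x - mu * y x))"
  proof (intro allI impI)
    fix b :: real assume "b \<ge> 0"
    show "acd 0 b y1 (\<lambda>x. (q x - mu) * y x - (g x - mu * y x))"
    proof (rule acd_cong_AE)
      show "acd 0 b y1 y2" using * \<open>b \<ge> 0\<close> by simp
      show "AE x in lborel. 0 < x \<and> x < b \<longrightarrow> y2 x = (q x - mu) * y x - (g x - mu * y x)"
        using *(5) unfolding ae_eq_Rp_def by (rule eventually_mono) (auto simp: algebra_simps)
    qed
  qed
  with * show thesis by (intro that L2_Rp_diff L2_Rp_cmult) auto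
qed

lemma in_resolvent_set_of_energy:
  fixes q :: "real \<Rightarrow> complex" and A B mu :: complex
  assumes q: "L1_loc_Rp q" and AB: "cmod A + cmod B > 0" and x0: "x0 \<ge> 0" and C: "C > 0"
    and energy: "PROP finite_energy_bound q A B mu x0 C"
    and apriori: "PROP global_energy_bound q A B q0 mu x0 C"
  shows "in_resolvent_set (LU_graph q A B) mu"
proof -
  have est: "l2sq {0..} y \<le> C * (LBINT x:{0..}. (cmod (g x - mu * y x))\<^sup>2)" and cont: "continuous_on {0..} y"
    if yg: "(y, g) \<in> LU_graph q A B" for y g
  proof -
    obtain y1 where y1: "\<forall>b\<ge>0. acd 0 b y y1" "\<forall>b\<ge>0. acd 0 b y1 (\<lambda>x. (q x - mu) * y x - (g x - mu * y x))"
    "L2_Rp y" "L2_Rp (\<lambda>x. g x - mu * y x)" "A * y 0 + B * y1 0 = 0"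
      by (rule LU_graph_acd[OF yg, of mu])
    show c: "continuous_on {0..} y" by (rule acd_all_continuous_on[OF y1(1)])
    show "l2sq {0..} y \<le> C * (LBINT x:{0..}. (cmod (g x - mu * y x))\<^sup>2)"
      by (rule L2_Rp_of_bounded_LBINT(2)[OF c apriori[OF y1, THEN conjunct1]])
  qed
  have normest: "L2_norm_Rp y \<le> sqrt C * L2_norm_Rp (\<lambda>x. g x - mu * y x)" if "(y, g) \<in> LU_graph q A B" for y g
    unfolding L2_norm_Rp_def real_sqrt_mult[symmetric] using est[OF that] by simp
  show ?thesis unfolding in_resolvent_set_def
  proof (intro conjI allI impI)
    fix f assume f: "L2_Rp f"
    obtain y y1 where y: "\<forall>b\<ge>0. acd 0 b y y1" "\<forall>b\<ge>0. acd 0 b y1 (\<lambda>x. (q x - mu) * y x - f x)" "L2_Rp y" "A * y 0 + B * y1 0 = 0"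
      using boundary_value_problem_solvable[OF q AB x0 C energy f] by blast
    define g where "g x = mu * y x + f x" for x
    have "L2_Rp g" unfolding g_def by (intro L2_Rp_add L2_Rp_cmult y f)
    moreover have "ae_eq_Rp g (\<lambda>x. - ((q x - mu) * y x - f x) + q x * y x)"
      unfolding ae_eq_Rp_def g_def by (simp add: algebra_simps)
    ultimately have "(y, g) \<in> LU_graph q A B" unfolding LU_graph_iff using y by blast
    moreover have "ae_eq_Rp (\<lambda>x. g x - mu * y x) f" by (simp add: ae_eq_Rp_def g_def)
    ultimately show "\<exists>y g. (y, g) \<in> LU_graph q A B \<and> ae_eq_Rp (\<lambda>x. g x - mu * y x) f" by blast
  next
    fix y g assume *: "(y, g) \<in> LU_graph q A B \<and> ae_eq_Rp (\<lambda>x. g x - mu * y x) (\<lambda>x. 0)"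
    have "(LBINT x:{0..}. (cmod (g x - mu * y x))\<^sup>2) = 0"
      unfolding set_lebesgue_integral_def
      by (rule integral_eq_zero_AE) (use * in \<open>auto simp: ae_eq_Rp_def indicator_def elim!: eventually_mono\<close>)
    then have le: "l2sq {0..} y \<le> 0" using est[of y g] * by simp
    have "L2_Rp y" using * by (auto simp: LU_graph_def)
    have "y x = 0" if "x \<ge> 0" for x
    proof (rule continuous_zero_of_LBINT)
      show "continuous_on {0..x + 1} y" by (rule continuous_on_subset[OF cont]) (use * in auto)
      have "l2sq {0..x + 1} y \<le> l2sq {0..} y"
        by (rule LBINT_mono_set) (use \<open>L2_Rp y\<close> in \<open>auto simp: L2_Rp_def\<close>)
      then show "l2sq {0..x + 1} y \<le> 0" using le by simp
    qed (use that in auto)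
    then show "ae_eq_Rp y (\<lambda>x. 0)" by (simp add: ae_eq_Rp_def)
  next
    show "\<exists>C. \<forall>y g. (y, g) \<in> LU_graph q A B \<longrightarrow> L2_norm_Rp y \<le> C * L2_norm_Rp (\<lambda>x. g x - mu * y x)"
      using normest by blast
  qed
qed

section \<open>Sufficiency of the Molchanov condition\<close>

text \<open>The sequential condition is equivalent in effect to uniform growth of the window masses:
  otherwise deficient windows can be picked recursively, each beyond the end of its predecessor,
  giving a disjoint system with masses below \<open>Z\<close>.\<close>

lemma molchanov_tail:
  assumes mol: "molchanov q" and h: "h > 0"
  shows "\<exists>r\<ge>0. \<forall>a\<ge>r. Z \<le> (LBINT x:{a..<a + h}. cmod (q x))"
proof (rule ccontr)
  let ?I = "\<lambda>a. LBINT x:{a..<a + h}. cmod (q x)"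
  assume "\<not> ?thesis"
  then have "\<forall>r. \<exists>a. r \<ge> 0 \<longrightarrow> a \<ge> r \<and> ?I a < Z" by (meson not_le)
  from choice[OF this] obtain s where s: "\<forall>r. r \<ge> 0 \<longrightarrow> s r \<ge> r \<and> ?I (s r) < Z" ..
  define a where "a = rec_nat (s 0) (\<lambda>_ x. s (x + h))"
  have a0: "a 0 = s 0" and aS: "a (Suc n) = s (a n + h)" for n by (simp_all add: a_def)
  have pos: "a n \<ge> 0" for n
  proof (induction n)
    case 0 then show ?case using s a0 by simp
  next
    case (Suc n)
    then have "s (a n + h) \<ge> a n + h" using s h by simp
    then show ?case using Suc h aS by simp
  qed
  have step: "a n + h \<le> a (Suc n)" for n using s pos[of n] h aS by simp
  have IZ: "?I (a n) < Z" for n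
  proof (cases n)
    case 0 then show ?thesis using s a0 by simp
  next
    case (Suc m) then show ?thesis using s pos[of m] h aS by simp
  qed
  have lt: "a m + h \<le> a n" if "m < n" for m n
    using that
  proof (induction n)
    case (Suc n)
    show ?case
    proof (cases "m = n")
      case True then show ?thesis using step by simp
    next
      case False
      then have "a m + h \<le> a n" using Suc by simp
      then show ?thesis using step[of n] h by linarith
    qed
  qed simp
  have "{a m..<a m + h} \<inter> {a n..<a n + h} = {}" if "m \<noteq> n" for m n
  proof (cases "m < n")
    case True then show ?thesis using lt[of m n] by auto
  next
    case False then show ?thesis using lt[of n m] that by auto
  qed
  then have "filterlim (\<lambda>n. ?I (a n)) at_top sequentially"
    using mol h pos unfolding molchanov_def by blast
  then have "\<forall>\<^sub>F n in sequentially. Z \<le> ?I (a n)" by (simp add: filterlim_at_top)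
  then obtain n where "Z \<le> ?I (a n)" by (auto simp: eventually_sequentially)
  with IZ[of n] show False by simp
qed

text \<open>Optimizing the weight turns the family of weighted inequalities into Cauchy-Schwarz; the
  optimal choice is s = a / J.\<close>

lemma square_le_of_weighted:
  fixes a J h :: real
  assumes "a \<ge> 0" "J \<ge> 0" "h \<ge> 0" and le: "\<And>s. s > 0 \<Longrightarrow> 2 * a \<le> s * J + h / s"
  shows "a\<^sup>2 \<le> h * J"
proof (cases "a = 0")
  case True then show ?thesis using assms by simp
next
  case False
  then have a: "a > 0" using assms by simp
  show ?thesis
  proof (cases "J = 0")
    case True
    \<comment> \<open>With J = 0 any large s works; this one bounds 2 a by a h / (h + 1), which is
      at most a, a contradiction to a > 0.\<close>
    have "2 * a \<le> h / ((h + 1) / a)" using le[of "(h + 1) / a"] True a assms by simp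
    also have "\<dots> = a * (h / (h + 1))" by simp
    also have "\<dots> \<le> a * 1" using a assms by (intro mult_left_mono) auto
    finally show ?thesis using a by simp
  next
    case False
    then have "2 * a \<le> a / J * J + h / (a / J)" using a assms by (intro le) auto
    also have "\<dots> = a + h * J / a" using False by simp
    finally have "a \<le> h * J / a" by simp
    then show ?thesis using a by (simp add: field_simps power2_eq_square)
  qed
qed

lemma LBINT_const_Icc: "a \<le> b \<Longrightarrow> (LBINT x:{a..b}. c) = (b - a) * (c::real)"
  by (simp add: set_lebesgue_integral_def)

text \<open>Cauchy-Schwarz for the integral of \<open>y1\<close>, obtained by integrating |y1| <=
  (s/2) |y1|^2 + 1/(2 s) and optimizing over s.\<close>

lemma acd_increment_bound:
  assumes y: "\<forall>b\<ge>0. acd 0 b y y1" and c1: "continuous_on {0..} y1" and x: "0 \<le> x" "x \<le> t"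
  shows "(cmod (y t - y x))\<^sup>2 \<le> (t - x) * l2sq {x..t} y1"
proof (rule square_le_of_weighted)
  show "l2sq {x..t} y1 \<ge> 0" by (rule LBINT_nonneg) simp
  have c: "continuous_on {x..t} y1" by (rule continuous_on_subset[OF c1]) (use x in auto)
  have i: "set_integrable lborel {x..t} y1" by (rule borel_integrable_atLeastAtMost'[OF c])
  have eq: "y t - y x = (LBINT s:{x..t}. y1 s)"
    by (rule acd_LBINT[symmetric, OF acd_subset[of 0 t]]) (use x y i in auto)
  fix s :: real assume s: "s > 0"
  have i2: "set_integrable lborel {x..t} (\<lambda>u. (s/2) * (cmod (y1 u))\<^sup>2)" "set_integrable lborel {x..t} (\<lambda>u. 1 / (2 * s))"
    by (intro set_integrable_mult_right set_integrable_cmod_power2 c set_integrable_const_Icc)+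
  have "cmod (y t - y x) \<le> (LBINT u:{x..t}. (s/2) * (cmod (y1 u))\<^sup>2 + 1 / (2 * s))"
    unfolding eq
  proof (rule norm_LBINT_le[OF i set_integral_add(1)[OF i2]])
    fix u
    show "cmod (y1 u) \<le> (s/2) * (cmod (y1 u))\<^sup>2 + 1 / (2 * s)"
      using two_mult_le_weighted_squares[OF s, of "cmod (y1 u)" 1] by (simp add: field_simps)
  qed
  also have "\<dots> = (s/2) * l2sq {x..t} y1 + (t - x) * (1 / (2 * s))"
    unfolding set_integral_add(2)[OF i2] LBINT_const_Icc[OF x(2)] by simp
  finally have "2 * cmod (y t - y x) \<le> 2 * ((s/2) * l2sq {x..t} y1 + (t - x) * (1 / (2 * s)))"
    by (rule mult_left_mono) simp
  also have "\<dots> = s * l2sq {x..t} y1 + (t - x) / s"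
  proof -
    have "2 * ((t - x) * (1 / (2 * s))) = (t - x) / s" using s by (simp add: divide_simps)
    then show ?thesis unfolding distrib_left by (simp only:)
  qed
  finally show "2 * cmod (y t - y x) \<le> s * l2sq {x..t} y1 + (t - x) / s" .
qed (use x in auto)

lemma window_oscillation:
  assumes y: "\<forall>b\<ge>0. acd 0 b y y1" and c1: "continuous_on {0..} y1" and a: "a \<ge> 0"
    and xt: "x \<in> {a..a + h}" "t \<in> {a..a + h}"
  shows "(cmod (y x))\<^sup>2 \<le> 2 * (cmod (y t))\<^sup>2 + 2 * h * l2sq {a..a + h} y1"
proof -
  let ?J = "LBINT s:{a..a + h}. (cmod (y1 s))\<^sup>2"
  have main: "(cmod (y v - y u))\<^sup>2 \<le> h * ?J" if "a \<le> u" "u \<le> v" "v \<le> a + h" for u v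
  proof -
    have "(cmod (y v - y u))\<^sup>2 \<le> (v - u) * l2sq {u..v} y1"
      using that a by (intro acd_increment_bound[OF y c1]) auto
    also have "\<dots> \<le> h * ?J"
    proof (rule mult_mono)
      show "l2sq {u..v} y1 \<le> ?J"
        by (rule LBINT_mono_set[OF set_integrable_cmod_power2[OF continuous_on_subset[OF c1]]]) (use that a in auto)
    qed (use that in \<open>auto intro!: LBINT_nonneg\<close>)
    finally show ?thesis .
  qed
  have "(cmod (y x - y t))\<^sup>2 \<le> h * ?J"
    using main[of x t] main[of t x] xt by (cases "x \<le> t") (auto simp: norm_minus_commute)
  moreover have "(cmod (y x))\<^sup>2 \<le> 2 * (cmod (y t))\<^sup>2 + 2 * (cmod (y x - y t))\<^sup>2"
    using norm_add_power2_le[of "y t" "y x - y t"] by simp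
  ultimately show ?thesis by simp
qed

text \<open>Averaging \<open>window_oscillation\<close> over t against the weight w bounds |y(x)|^2
  by a weighted mean of |y|^2 plus an oscillation term; integration over x adds one more factor h. A
  heavy weight therefore forces a small L2 mass.\<close>

lemma window_L2_bound:
  assumes y: "\<forall>b\<ge>0. acd 0 b y y1" and c1: "continuous_on {0..} y1" and a: "a \<ge> 0" and h: "h > 0"
    and wi: "set_integrable lborel {a..a + h} w" and w0: "\<And>x. w x \<ge> (0::real)"
    and W: "W > 0" "W \<le> (LBINT x:{a..a + h}. w x)"
  shows "l2sq {a..a + h} y \<le> (2 * h / W) * (LBINT x:{a..a + h}. w x * (cmod (y x))\<^sup>2)
     + 2 * h\<^sup>2 * l2sq {a..a + h} y1"
proof -
  define J where "J = l2sq {a..a + h} y1"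
  define P where "P = (LBINT x:{a..a + h}. w x * (cmod (y x))\<^sup>2)"
  define V where "V = (LBINT x:{a..a + h}. w x)"
  have P0: "P \<ge> 0" unfolding P_def by (rule LBINT_nonneg) (simp add: w0)
  have V: "V > 0" "W \<le> V" using W by (auto simp: V_def)
  have cy: "continuous_on {a..a + h} y" by (rule continuous_on_subset[OF acd_all_continuous_on[OF y]]) (use a in auto)
  have iwy: "set_integrable lborel {a..a + h} (\<lambda>t. w t * (cmod (y t))\<^sup>2)"
    by (intro set_integrable_mult_continuous wi continuous_intros cy)
  have pt: "(cmod (y x))\<^sup>2 \<le> 2 * P / W + 2 * h * J" if x: "x \<in> {a..a + h}" for x
  proof -
    have i2: "set_integrable lborel {a..a + h} (\<lambda>t. 2 * (w t * (cmod (y t))\<^sup>2))" "set_integrable lborel {a..a + h} (\<lambda>t. 2 * h * J * w t)"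
      by (intro set_integrable_mult_right iwy wi)+
    have "(LBINT t:{a..a + h}. (cmod (y x))\<^sup>2 * w t) \<le> (LBINT t:{a..a + h}. 2 * (w t * (cmod (y t))\<^sup>2) + 2 * h * J * w t)"
    proof (rule set_integral_mono[OF set_integrable_mult_right[OF wi] set_integral_add(1)[OF i2]])
      fix t assume "t \<in> {a..a + h}"
      from mult_right_mono[OF window_oscillation[OF y c1 a x this] w0[of t]]
      show "(cmod (y x))\<^sup>2 * w t \<le> 2 * (w t * (cmod (y t))\<^sup>2) + 2 * h * J * w t"
        by (simp add: J_def algebra_simps)
    qed
    then have "(cmod (y x))\<^sup>2 * V \<le> 2 * P + 2 * h * J * V"
      unfolding set_integral_add(2)[OF i2] by (simp add: V_def P_def)
    then have "(cmod (y x))\<^sup>2 \<le> (2 * P + 2 * h * J * V) / V" using V(1) by (simp add: pos_le_divide_eq)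
    also have "\<dots> = 2 * P / V + 2 * h * J" using V(1) by (simp add: add_divide_distrib)
    also have "2 * P / V \<le> 2 * P / W" using V W P0 by (intro divide_left_mono) auto
    finally show ?thesis by simp
  qed
  have "l2sq {a..a + h} y \<le> (LBINT x:{a..a + h}. 2 * P / W + 2 * h * J)"
    by (rule set_integral_mono[OF set_integrable_cmod_power2[OF cy] set_integrable_const_Icc pt])
  also have "\<dots> = h * (2 * P / W + 2 * h * J)" using h by (subst LBINT_const_Icc) auto
  also have "\<dots> = (2 * h / W) * P + 2 * h\<^sup>2 * J" by (simp add: algebra_simps power2_eq_square)
  finally show ?thesis unfolding P_def J_def .
qed

section \<open>Tails and uniform convergence on compact intervals\<close>

lemma LBINT_Icc_combine:
  fixes f :: "real \<Rightarrow> real"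
  assumes f: "set_integrable lborel {a..c} f" and "a \<le> b" "b \<le> c"
  shows "(LBINT x:{a..c}. f x) = (LBINT x:{a..b}. f x) + (LBINT x:{b..c}. f x)"
proof -
  have i: "set_integrable lborel {b..c} f" "set_integrable lborel {b<..c} f"
    using assms by (auto intro: set_integrable_subset[OF f])
  have "(LBINT x:{b<..c}. f x) = (LBINT x:{b..c}. f x)"
    unfolding set_lebesgue_integral_def
  proof (rule integral_cong_AE)
    show "AE x in lborel. indicat_real {b<..c} x *\<^sub>R f x = indicat_real {b..c} x *\<^sub>R f x"
      using AE_neq[of b] by (rule eventually_mono) (auto simp: indicator_def)
  qed (use i in \<open>auto simp: set_integrable_def borel_measurable_integrable\<close>)
  then show ?thesis using LBINT_split_at[OF f assms(2,3)] by simp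
qed

text \<open>The constants do not depend on the number of windows because every integral is additive
  over adjacent ones.\<close>

lemma tail_L2_bound:
  assumes y: "\<forall>b\<ge>0. acd 0 b y y1" and c1: "continuous_on {0..} y1" and r: "r \<ge> 0" and h: "h > 0"
    and wi: "\<And>b. set_integrable lborel {0..b} w" and w0: "\<And>x. w x \<ge> (0::real)"
    and W: "W > 0" "\<And>a. a \<ge> r \<Longrightarrow> W \<le> (LBINT x:{a..a + h}. w x)"
  shows "l2sq {r..r + real N * h} y \<le> (2 * h / W) * (LBINT x:{r..r + real N * h}. w x * (cmod (y x))\<^sup>2)
     + 2 * h\<^sup>2 * l2sq {r..r + real N * h} y1"
proof (induction N)
  case 0
  have n: "(LBINT x:{r}. f x) = 0" for f :: "real \<Rightarrow> real"
    unfolding set_lebesgue_integral_def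
    by (rule integral_eq_zero_AE, rule eventually_mono[OF AE_neq[of r]]) simp
  then show ?case by simp
next
  case (Suc N)
  define a where "a = r + real N * h"
  have a: "a \<ge> r" "a \<ge> 0" "r + real (Suc N) * h = a + h" using r h by (auto simp: a_def algebra_simps)
  have cy: "continuous_on {r..a + h} y" by (rule continuous_on_subset[OF acd_all_continuous_on[OF y]]) (use r in auto)
  have c1': "continuous_on {r..a + h} y1" by (rule continuous_on_subset[OF c1]) (use r in auto)
  have wi': "set_integrable lborel {r..a + h} w" "set_integrable lborel {a..a + h} w"
    by (rule set_integrable_subset[OF wi[of "a + h"]]; use r a in auto)+
  have iwy: "set_integrable lborel {r..a + h} (\<lambda>t. w t * (cmod (y t))\<^sup>2)"
    by (intro set_integrable_mult_continuous wi' continuous_intros cy)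
  have ah: "a \<le> a + h" using h by simp
  have win: "l2sq {a..a + h} y \<le> (2 * h / W) * (LBINT x:{a..a + h}. w x * (cmod (y x))\<^sup>2)
     + 2 * h\<^sup>2 * l2sq {a..a + h} y1"
    by (rule window_L2_bound[OF y c1 a(2) h wi'(2) w0 W(1) W(2)[OF a(1)]])
  show ?case
    unfolding a(3) LBINT_Icc_combine[OF set_integrable_cmod_power2[OF cy] a(1) ah] LBINT_Icc_combine[OF set_integrable_cmod_power2[OF c1'] a(1) ah]
      LBINT_Icc_combine[OF iwy a(1) ah]
    using win Suc.IH[folded a_def] by (simp only: distrib_left)
qed

text \<open>The Arzela-Ascoli argument: convergence at finitely many rational grid points is carried
  to all of [0, r] by equicontinuity, with a loss of e/3 in each of three terms.\<close>

lemma uniform_Cauchy_of_equicontinuous: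
  fixes Y :: "nat \<Rightarrow> real \<Rightarrow> complex"
  assumes eq: "\<And>n x t. 0 \<le> x \<Longrightarrow> x \<le> t \<Longrightarrow> (cmod (Y n t - Y n x))\<^sup>2 \<le> (t - x) * D" and D: "D \<ge> 0"
    and conv: "\<And>x. x \<in> \<rat> \<inter> {0..} \<Longrightarrow> \<exists>l. (\<lambda>n. Y n x) \<longlonglongrightarrow> l" and e: "e > 0" and r: "r \<ge> 0"
  shows "\<exists>N. \<forall>m\<ge>N. \<forall>n\<ge>N. \<forall>x\<in>{0..r}. cmod (Y m x - Y n x) < e"
proof -
  \<comment> \<open>A grid of mesh 1/K with D / K < (e/3)^2, so that a step to the nearest grid
    point on the left changes every \<open>Y n\<close> by less than e/3.\<close>
  obtain K :: nat where K: "9 * (D + 1) / e\<^sup>2 < real K" using reals_Archimedean2 by blast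
  have "9 * (D + 1) / e\<^sup>2 > 0" using D e by simp
  then have K0: "real K > 0" using K by linarith
  have DK: "1 / real K * D < (e/3)\<^sup>2"
  proof -
    have "9 * (D + 1) < real K * e\<^sup>2" using K e by (simp add: pos_divide_less_eq)
    then have "D < real K * (e/3)\<^sup>2" by (simp add: power_divide)
    then show ?thesis using K0 by (simp add: pos_divide_less_eq mult.commute)
  qed
  define J where "J = nat \<lceil>r * real K\<rceil>"
  have "\<forall>j::nat. \<exists>N. \<forall>m\<ge>N. \<forall>n\<ge>N. cmod (Y m (real j / real K) - Y n (real j / real K)) < e/3"
  proof
    fix j :: nat
    have "real j / real K \<in> \<rat> \<inter> {0..}" by simp
    then obtain l where "(\<lambda>n. Y n (real j / real K)) \<longlonglongrightarrow> l" using conv by blast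
    then have "Cauchy (\<lambda>n. Y n (real j / real K))" by (rule LIMSEQ_imp_Cauchy)
    then show "\<exists>N. \<forall>m\<ge>N. \<forall>n\<ge>N. cmod (Y m (real j / real K) - Y n (real j / real K)) < e/3"
      using CauchyD[of _ "e/3"] e by simp
  qed
  from choice[OF this] obtain Nf where Nf: "\<forall>j. \<forall>m\<ge>Nf j. \<forall>n\<ge>Nf j. cmod (Y m (real j / real K) - Y n (real j / real K)) < e/3" ..
  define N where "N = Max (Nf ` {..J})"
  have NN: "Nf j \<le> N" if "j \<le> J" for j unfolding N_def using that by (intro Max_ge) auto
  have "cmod (Y m x - Y n x) < e" if mn: "m \<ge> N" "n \<ge> N" and x: "x \<in> {0..r}" for m n x
  proof -
    define j where "j = nat \<lfloor>x * real K\<rfloor>"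
    have "0 \<le> x * real K" using x K0 by simp
    then have jr: "real j \<le> x * real K" "x * real K < real j + 1" unfolding j_def by linarith+
    have "x * real K \<le> r * real K" using x K0 by (intro mult_right_mono) auto
    then have "real j \<le> r * real K" using jr by linarith
    then have jJ: "j \<le> J" unfolding J_def by linarith
    define t where "t = real j / real K"
    have t: "0 \<le> t" "t \<le> x" using jr K0 by (auto simp: t_def field_simps)
    have "x \<le> (real j + 1) / real K" using jr(2) K0 by (simp add: pos_le_divide_eq)
    then have tx: "x - t \<le> 1 / real K" by (simp add: t_def add_divide_distrib)
    have small: "cmod (Y i x - Y i t) < e/3" for i
    proof -
      have "(cmod (Y i x - Y i t))\<^sup>2 \<le> (x - t) * D" by (rule eq[OF t(1,2)])
      also have "\<dots> \<le> 1 / real K * D" using tx D by (intro mult_right_mono) auto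
      also have "\<dots> < (e/3)\<^sup>2" by (rule DK)
      finally show ?thesis by (rule power2_less_imp_less) (use e in simp)
    qed
    have "m \<ge> Nf j" "n \<ge> Nf j" using NN[OF jJ] mn by auto
    then have "cmod (Y m t - Y n t) < e/3" using Nf unfolding t_def by blast
    moreover have "cmod (Y m x - Y n x) = cmod ((Y m x - Y m t) + (Y m t - Y n t) - (Y n x - Y n t))" by simp
    then have "cmod (Y m x - Y n x) \<le> cmod (Y m x - Y m t) + cmod (Y m t - Y n t) + cmod (Y n x - Y n t)"
      using norm_triangle_ineq4[of "(Y m x - Y m t) + (Y m t - Y n t)" "Y n x - Y n t"]
        norm_triangle_ineq[of "Y m x - Y m t" "Y m t - Y n t"] by linarith
    ultimately show ?thesis using small[of m] small[of n] by linarith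
  qed
  then show ?thesis by blast
qed

text \<open>On compact intervals the H1-bound gives uniform convergence of a subsequence. At infinity,
  on windows of small length h the L2-mass is bounded by h^2 times the energy plus h / W times the
  potential energy, where W is the mass of |q - q0| on the window, which is large by Molchanov.\<close>
lemma resolvent_compact_of_apriori:
  fixes q :: "real \<Rightarrow> complex" and A B mu :: complex
  assumes q: "L1_loc_Rp q" and mol: "molchanov q" and x0: "x0 \<ge> 0" and C: "C > 0"
    and apriori: "PROP global_energy_bound q A B q0 mu x0 C"
  shows "resolvent_compact (LU_graph q A B) mu"
  unfolding resolvent_compact_def
proof (intro allI impI, elim conjE)
  fix y g :: "nat \<Rightarrow> real \<Rightarrow> complex" and M :: real
  assume yg: "\<forall>n. (y n, g n) \<in> LU_graph q A B" and M: "\<forall>n. L2_norm_Rp (\<lambda>x. g n x - mu * y n x) \<le> M"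
  define D where "D = C * M\<^sup>2"
  have D: "D \<ge> 0" using C by (simp add: D_def)
  define w where "w x = cmod (q x - q0)" for x
  have w0: "w x \<ge> 0" for x by (simp add: w_def)
  have wi: "set_integrable lborel {0..b} w" for b
    unfolding w_def by (intro set_integrable_norm L1_loc_RpD[OF L1_loc_Rp_diff_const[OF q]])
  have "\<forall>n. \<exists>z. (\<forall>b\<ge>0. acd 0 b (y n) z) \<and> continuous_on {0..} z \<and> (\<forall>r\<ge>x0. (l2sq {0..r} (y n)) \<le> D \<and>
       (l2sq {0..r} z) \<le> D \<and> (LBINT x:{x0..r}. w x * (cmod (y n x))\<^sup>2) \<le> D)"
  proof
    fix n
    obtain z where z: "\<forall>b\<ge>0. acd 0 b (y n) z" "\<forall>b\<ge>0. acd 0 b z (\<lambda>x. (q x - mu) * y n x - (g n x - mu * y n x))"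
      "L2_Rp (y n)" "L2_Rp (\<lambda>x. g n x - mu * y n x)" "A * y n 0 + B * z 0 = 0"
      by (rule LU_graph_acd[OF yg[rule_format, of n], of mu])
    have "(LBINT x:{0..}. (cmod (g n x - mu * y n x))\<^sup>2) = (L2_norm_Rp (\<lambda>x. g n x - mu * y n x))\<^sup>2"
      by (rule L2_norm_Rp_power2[symmetric])
    also have "\<dots> \<le> M\<^sup>2" using M L2_norm_Rp_nonneg by (intro power_mono) auto
    finally have le: "C * (LBINT x:{0..}. (cmod (g n x - mu * y n x))\<^sup>2) \<le> D"
      unfolding D_def using C by (intro mult_left_mono) auto
    have "\<forall>r\<ge>x0. (l2sq {0..r} (y n)) \<le> D \<and>
       (l2sq {0..r} z) \<le> D \<and> (LBINT x:{x0..r}. w x * (cmod (y n x))\<^sup>2) \<le> D"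
    proof (intro allI impI)
      fix r assume "r \<ge> x0"
      from apriori[OF z this] le show "l2sq {0..r} (y n) \<le> D \<and>
       (l2sq {0..r} z) \<le> D \<and> (LBINT x:{x0..r}. w x * (cmod (y n x))\<^sup>2) \<le> D"
        unfolding w_def by linarith
    qed
    with z(1) acd_all_continuous_on[OF z(2)]
    show "\<exists>z. (\<forall>b\<ge>0. acd 0 b (y n) z) \<and> continuous_on {0..} z \<and> (\<forall>r\<ge>x0. (l2sq {0..r} (y n)) \<le> D \<and>
       (l2sq {0..r} z) \<le> D \<and> (LBINT x:{x0..r}. w x * (cmod (y n x))\<^sup>2) \<le> D)"
      by (intro exI[of _ z] conjI)
  qed
  from choice[OF this] obtain y1 where y1: "\<forall>n. (\<forall>b\<ge>0. acd 0 b (y n) (y1 n)) \<and> continuous_on {0..} (y1 n) \<and> (\<forall>r\<ge>x0. (l2sq {0..r} (y n)) \<le> D \<and>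
       (l2sq {0..r} (y1 n)) \<le> D \<and> (LBINT x:{x0..r}. w x * (cmod (y n x))\<^sup>2) \<le> D)" ..
  have ay: "\<forall>b\<ge>0. acd 0 b (y n) (y1 n)" and cy1: "continuous_on {0..} (y1 n)" for n using y1 by simp_all
  have cy: "continuous_on {0..} (y n)" for n by (rule acd_all_continuous_on[OF ay])
  have iy: "set_integrable lborel {a..b} (\<lambda>x. (cmod (y n x))\<^sup>2)" and iy1: "set_integrable lborel {a..b} (\<lambda>x. (cmod (y1 n x))\<^sup>2)" if "a \<ge> 0" for a b n
    by (rule set_integrable_cmod_power2, rule continuous_on_subset[OF cy] continuous_on_subset[OF cy1], use that in auto)+
  have sub: "l2sq {a..b} (y n) \<le> D" "l2sq {a..b} (y1 n) \<le> D" if "a \<ge> 0" for a b n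
  proof -
    have "l2sq {a..b} (y n) \<le> l2sq {0..max b x0} (y n)"
      "l2sq {a..b} (y1 n) \<le> l2sq {0..max b x0} (y1 n)"
      by (rule LBINT_mono_set; use iy iy1 that in auto)+
    moreover have "l2sq {0..max b x0} (y n) \<le> D" "l2sq {0..max b x0} (y1 n) \<le> D"
      using y1 by simp_all
    ultimately show "l2sq {a..b} (y n) \<le> D" "l2sq {a..b} (y1 n) \<le> D" by linarith+
  qed
  have hoelder: "(cmod (y n t - y n x))\<^sup>2 \<le> (t - x) * D" if "0 \<le> x" "x \<le> t" for n x t
  proof -
    have "(cmod (y n t - y n x))\<^sup>2 \<le> (t - x) * l2sq {x..t} (y1 n)"
      by (rule acd_increment_bound[OF ay cy1 that])
    also have "\<dots> \<le> (t - x) * D" using that sub(2) by (intro mult_left_mono) auto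
    finally show ?thesis .
  qed
  \<comment> \<open>Averaging the oscillation bound over [x, x + 1] gives 2 D from |y|^2 and 2 D
    from |y1|^2. Pointwise bounds at the rationals are what the diagonal subsequence needs.\<close>
  have bounded: "cmod (y n x) \<le> sqrt (4 * D)" if x: "x \<in> \<rat> \<inter> {0..}" for n x
  proof -
    have x0: "x \<ge> 0" using x by simp
    have "(LBINT t:{x..x + 1}. (cmod (y n x))\<^sup>2) \<le> (LBINT t:{x..x + 1}. 2 * (cmod (y n t))\<^sup>2 + 2 * D)"
    proof (rule set_integral_mono[OF set_integrable_const_Icc])
      show "set_integrable lborel {x..x + 1} (\<lambda>t. 2 * (cmod (y n t))\<^sup>2 + 2 * D)"
        by (intro set_integral_add(1) set_integrable_mult_right iy x0 set_integrable_const_Icc)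
      fix t assume "t \<in> {x..x + 1}"
      then have "(cmod (y n x))\<^sup>2 \<le> 2 * (cmod (y n t))\<^sup>2 + 2 * 1 * l2sq {x..x + 1} (y1 n)"
        by (intro window_oscillation[OF ay cy1 x0]) auto
      then show "(cmod (y n x))\<^sup>2 \<le> 2 * (cmod (y n t))\<^sup>2 + 2 * D" using sub(2)[OF x0, of "x + 1" n] by linarith
    qed
    also have "\<dots> = 2 * l2sq {x..x + 1} (y n) + 2 * D"
      by (subst set_integral_add(2)) (auto intro!: set_integrable_mult_right iy x0 set_integrable_const_Icc simp: LBINT_const_Icc)
    also have "\<dots> \<le> 4 * D" using sub(1)[OF x0, of "x + 1" n] by linarith
    finally have "(cmod (y n x))\<^sup>2 \<le> 4 * D" by (simp add: LBINT_const_Icc)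
    then show ?thesis by (rule real_le_rsqrt)
  qed
  have "countable (\<rat> \<inter> {0::real..})" using countable_rat by (rule countable_subset[rotated]) auto
  from function_convergent_subsequence[OF this, of y, OF bounded]
  obtain k :: "nat \<Rightarrow> nat" where k: "strict_mono k" and conv: "\<And>x. x \<in> \<rat> \<inter> {0..} \<Longrightarrow> \<exists>l. (\<lambda>n. y (k n) x) \<longlonglongrightarrow> l"
    by blast
  have "\<exists>N. \<forall>m\<ge>N. \<forall>n\<ge>N. L2_norm_Rp (\<lambda>x. y (k m) x - y (k n) x) < \<epsilon>" if \<epsilon>: "\<epsilon> > 0" for \<epsilon>
  proof -
    \<comment> \<open>The tail of a difference costs at most 4 \<tau> = \<epsilon>^2 / 4, and the
      compact part another \<epsilon>^2 / 4, which leaves strict room below \<epsilon>^2.\<close>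
    define \<tau> where "\<tau> = \<epsilon>\<^sup>2 / 16"
    have \<tau>: "\<tau> > 0" using \<epsilon> by (simp add: \<tau>_def)
    \<comment> \<open>The window length is fixed first, so that the oscillation term 2 h^2 D is at
      most \<tau>/2; \<open>W\<close> is then chosen to make the weighted term at most \<tau>/2.
      Using D + 1 avoids the case D = 0.\<close>
    define h where "h = sqrt (\<tau> / (4 * (D + 1)))"
    have h: "h > 0" using \<tau> D by (simp add: h_def)
    have D1: "\<tau> / 2 * (D / (D + 1)) \<le> \<tau> / 2" using \<tau> D by (intro mult_left_le) auto
    have "h\<^sup>2 = \<tau> / (4 * (D + 1))" using \<tau> D by (simp add: h_def)
    then have "2 * h\<^sup>2 * D = 2 * (\<tau> / (4 * (D + 1))) * D" by (simp only:)
    also have "\<dots> = \<tau> / 2 * (D / (D + 1))" using D by (simp add: divide_simps)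
    finally have "2 * h\<^sup>2 * D = \<tau> / 2 * (D / (D + 1))" .
    then have h2: "2 * h\<^sup>2 * D \<le> \<tau> / 2" using D1 by simp
    define W where "W = 4 * h * (D + 1) / \<tau>"
    have W: "W > 0" using h D \<tau> by (simp add: W_def)
    have "(2 * h / W) * D = \<tau> / 2 * (D / (D + 1))" using h D \<tau> by (simp add: W_def divide_simps)
    then have hW: "(2 * h / W) * D \<le> \<tau> / 2" using D1 by simp
    \<comment> \<open>The extra |q0| h pays for passing from |q| in the Molchanov condition to the
      weight |q - q0|.\<close>
    obtain r0 where r0: "r0 \<ge> 0" "\<forall>a\<ge>r0. W + cmod q0 * h \<le> (LBINT x:{a..<a + h}. cmod (q x))"
      using molchanov_tail[OF mol h] by blast
    define r where "r = max r0 x0"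
    have r: "r \<ge> r0" "r \<ge> x0" "r \<ge> 0" using r0 by (auto simp: r_def)
    have Wa: "W \<le> (LBINT x:{a..a + h}. w x)" if "a \<ge> r" for a
    proof -
      have a0: "a \<ge> 0" using that r by simp
      have qi: "set_integrable lborel {a..a + h} (\<lambda>x. cmod (q x))" and wi': "set_integrable lborel {a..a + h} w"
        by (rule set_integrable_subset[of _ "{0..a + h}"]; use a0 set_integrable_norm[OF L1_loc_RpD[OF q]] wi in auto)+
      have "W + cmod q0 * h \<le> (LBINT x:{a..<a + h}. cmod (q x))" using r0(2) that r by simp
      also have "\<dots> \<le> (LBINT x:{a..a + h}. cmod (q x))" by (rule LBINT_mono_set[OF qi]) auto
      also have "\<dots> \<le> (LBINT x:{a..a + h}. w x + cmod q0)"
      proof (rule set_integral_mono[OF qi set_integral_add(1)[OF wi' set_integrable_const_Icc]])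
        show "cmod (q x) \<le> w x + cmod q0" for x using norm_triangle_ineq[of "q x - q0" q0] by (simp add: w_def)
      qed
      also have "\<dots> = (LBINT x:{a..a + h}. w x) + h * cmod q0"
        using h by (subst set_integral_add(2)[OF wi' set_integrable_const_Icc]) (simp add: LBINT_const_Icc)
      finally show ?thesis by (simp add: mult.commute)
    qed
    have tail: "l2sq {r..R} (y n) \<le> \<tau>" for n R
    proof -
      obtain N :: nat where "(R - r) / h \<le> real N" using real_arch_simple by blast
      then have N: "R \<le> r + real N * h" using h by (simp add: field_simps)
      define b where "b = r + real N * h"
      have b: "b \<ge> r" using h by (simp add: b_def)
      have iw: "set_integrable lborel {x0..b} (\<lambda>x. w x * (cmod (y n x))\<^sup>2)"
      proof (rule set_integrable_mult_continuous)
        show "set_integrable lborel {x0..b} w" by (rule set_integrable_subset[OF wi[of b]]) (use x0 in auto)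
        show "continuous_on {x0..b} (\<lambda>x. (cmod (y n x))\<^sup>2)"
          by (intro continuous_intros continuous_on_subset[OF cy]) (use x0 in auto)
      qed
      have "l2sq {r..R} (y n) \<le> l2sq {r..b} (y n)"
        by (rule LBINT_mono_set[OF iy[OF r(3)]]) (use N in \<open>auto simp: b_def\<close>)
      also have "\<dots> \<le> (2 * h / W) * (LBINT x:{r..b}. w x * (cmod (y n x))\<^sup>2) + 2 * h\<^sup>2 * l2sq {r..b} (y1 n)"
        unfolding b_def by (rule tail_L2_bound[OF ay cy1 r(3) h wi w0 W Wa])
      also have "\<dots> \<le> (2 * h / W) * D + 2 * h\<^sup>2 * D"
      proof (intro add_mono mult_left_mono)
        have "(LBINT x:{r..b}. w x * (cmod (y n x))\<^sup>2) \<le> (LBINT x:{x0..b}. w x * (cmod (y n x))\<^sup>2)"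
          by (rule LBINT_mono_set[OF iw]) (use r w0 in auto)
        also have "\<dots> \<le> D" using y1 b r by simp
        finally show "(LBINT x:{r..b}. w x * (cmod (y n x))\<^sup>2) \<le> D" .
        show "l2sq {r..b} (y1 n) \<le> D" by (rule sub(2)[OF r(3)])
      qed (use h W in auto)
      also have "\<dots> \<le> \<tau>" using h2 hW by linarith
      finally show ?thesis .
    qed
    \<comment> \<open>Uniform closeness \<open>e\<close> on [0, r] costs r e^2, at most \<epsilon>^2
      / 4.\<close>
    define e where "e = \<epsilon> / (2 * sqrt (r + 1))"
    have e: "e > 0" using \<epsilon> r by (simp add: e_def)
    have e2: "r * e\<^sup>2 \<le> \<epsilon>\<^sup>2 / 4" using r by (simp add: e_def power_divide power_mult_distrib field_simps)
    obtain N where N: "\<forall>m\<ge>N. \<forall>n\<ge>N. \<forall>x\<in>{0..r}. cmod (y (k m) x - y (k n) x) < e"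
      using uniform_Cauchy_of_equicontinuous[of "\<lambda>n. y (k n)" D e r, OF hoelder D conv e r(3)] by blast
    have "L2_norm_Rp (\<lambda>x. y (k m) x - y (k n) x) < \<epsilon>" if mn: "m \<ge> N" "n \<ge> N" for m n
    proof -
      have cd: "continuous_on {0..} (\<lambda>x. y (k m) x - y (k n) x)" by (intro continuous_intros cy)
      have id: "set_integrable lborel {0..b} (\<lambda>x. (cmod (y (k m) x - y (k n) x))\<^sup>2)" for b
        by (rule set_integrable_cmod_power2) (rule continuous_on_subset[OF cd], auto)
      have "(LBINT x:{0..R}. (cmod (y (k m) x - y (k n) x))\<^sup>2) \<le> \<epsilon>\<^sup>2 / 2" if R: "R \<ge> r" for R
      proof -
        have "(LBINT x:{0..R}. (cmod (y (k m) x - y (k n) x))\<^sup>2) = (LBINT x:{0..r}. (cmod (y (k m) x - y (k n) x))\<^sup>2) + (LBINT x:{r..R}. (cmod (y (k m) x + - y (k n) x))\<^sup>2)"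
          using LBINT_Icc_combine[OF id r(3) R] by simp
        also have "(LBINT x:{0..r}. (cmod (y (k m) x - y (k n) x))\<^sup>2) \<le> (LBINT x:{0..r}. e\<^sup>2)"
        proof (rule set_integral_mono[OF id set_integrable_const_Icc])
          fix x assume "x \<in> {0..r}"
          then have "cmod (y (k m) x - y (k n) x) < e" using N mn by blast
          then show "(cmod (y (k m) x - y (k n) x))\<^sup>2 \<le> e\<^sup>2" by (intro power_mono) auto
        qed
        also have "(LBINT x:{0..r}. e\<^sup>2) = r * e\<^sup>2" using r by (simp add: LBINT_const_Icc)
        also have "r * e\<^sup>2 \<le> \<epsilon>\<^sup>2 / 4" by (rule e2)
        also have "(LBINT x:{r..R}. (cmod (y (k m) x + - y (k n) x))\<^sup>2) \<le> 2 * l2sq {r..R} (y (k m)) + 2 * (LBINT x:{r..R}. (cmod (- y (k n) x))\<^sup>2)"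
          by (intro LBINT_add_power2_le continuous_intros continuous_on_subset[OF cy]) (use r in auto)
        also have "\<dots> \<le> 2 * \<tau> + 2 * \<tau>" using tail[of R "k m"] tail[of R "k n"] by simp
        finally show ?thesis by (simp add: \<tau>_def)
      qed
      from L2_Rp_of_bounded_LBINT(2)[OF cd this]
      have "(LBINT x:{0..}. (cmod (y (k m) x - y (k n) x))\<^sup>2) \<le> \<epsilon>\<^sup>2 / 2" .
      also have "\<dots> < \<epsilon>\<^sup>2" using \<epsilon> by simp
      finally have "L2_norm_Rp (\<lambda>x. y (k m) x - y (k n) x) < sqrt (\<epsilon>\<^sup>2)"
        unfolding L2_norm_Rp_def by (rule real_sqrt_less_mono)
      then show ?thesis using \<epsilon> by simp
    qed
    then show ?thesis by blast
  qed
  with k show "\<exists>r::nat \<Rightarrow> nat. strict_mono r \<and> (\<forall>\<epsilon>>0. \<exists>N. \<forall>m\<ge>N. \<forall>n\<ge>N.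
            L2_norm_Rp (\<lambda>x. y (r m) x - y (r n) x) < \<epsilon>)"
    by (intro exI[of _ k] conjI allI impI)
qed

theorem theorem2:
  fixes q :: "real \<Rightarrow> complex" and A B :: complex
  assumes "L1_loc_Rp q"
    and "sectorial q"
    and "cmod A + cmod B > 0"
  shows "has_compact_resolvent (LU_graph q A B) \<longleftrightarrow> molchanov q"
proof
  assume "has_compact_resolvent (LU_graph q A B)"
  then show "molchanov q"
    using resolvent_compact_imp_molchanov[OF assms(1)] by (auto simp: has_compact_resolvent_def)
next
  assume mol: "molchanov q"
  show "has_compact_resolvent (LU_graph q A B)"
  proof (rule energy_estimates[OF assms])
    fix x0 C :: real and q0 mu :: complex
    assume x0: "x0 \<ge> 0" and C: "C > 0"
      and energy: "PROP finite_energy_bound q A B mu x0 C"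
      and apriori: "PROP global_energy_bound q A B q0 mu x0 C"
    have "in_resolvent_set (LU_graph q A B) mu"
      by (rule in_resolvent_set_of_energy[OF assms(1,3) x0 C energy apriori])
    moreover have "resolvent_compact (LU_graph q A B) mu"
      by (rule resolvent_compact_of_apriori[OF assms(1) mol x0 C apriori])
    ultimately show ?thesis by (auto simp: has_compact_resolvent_def)
  qed
qed

end
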